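(* Let $H$ be a Hilbert space, and let $X=(X_n)_{n\in\mathbb N}$ and $A=(A_n)_{n\in\mathbb N}$ be inductive families of sets. The unital completely positive maps $\Gamma:\mathcal S_{X,A}\to\mathcal B(H)$ are in a canonical bijective correspondence with the unital completely positive maps $\Phi:C(\Omega_A)\to L^\infty(\Omega_X)\bar\otimes\mathcal B(H)$.
   Context: All Hilbert spaces are assumed separable. For $d\in\mathbb N$, $[d]=\{1,\dots,d\}$. An inductive family of sets is a sequence $X=(X_n)_{n\in\mathbb N}$ of finite sets such that, for every $n$, $X_{n+1}=X_n\times[d_n^X]$ for some $d_n^X\in\mathbb N$. Set $d_0^X=|X_1|$ and let $\Omega_X=\prod_{n=0}^\infty[d_n^X]$ be the corresponding Cantor space (with the product topology). $C(\Omega_X)$ is the C*-algebra of continuous complex-valued functions on $\Omega_X$. $L^\infty(\Omega_X)$ is taken with respect to the product $\mu_X$ of the uniform probability measures on the sets $[d_n^X]$. The same notation is used for $A$. $\mathcal B(H)$ is the algebra of bounded operators on $H$, and $\bar\otimes$ is the von Neumann algebra tensor product. For finite sets $S,U$, let $\mathcal D_U$ be the C*-algebra of diagonal $|U|\times|U|$ matrices with canonical basis $(\delta_u)_{u\in U}$, and let $\mathcal S_{S,U}$ be the operator system coproduct of $|S|$ copies of $\mathcal D_U$: it comes with unital complete order embeddings $\iota_s:\mathcal D_U\to\mathcal S_{S,U}$, $s\in S$, such that for any operator system $\mathcal R$ and unital completely positive maps $\phi_s:\mathcal D_U\to\mathcal R$, $s\in S$, there is a unique unital completely positive map $\phi:\mathcal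 S_{S,U}\to\mathcal R$ with $\phi\circ\iota_s=\phi_s$ for all $s$. Write $e_{s,u}=\iota_s(\delta_u)$. For inductive families $X,A$, let $\gamma_{X_n,A_n}:\mathcal S_{X_n,A_n}\to\mathcal S_{X_{n+1},A_{n+1}}$ be the unital completely positive map with $\gamma_{X_n,A_n}(e_{x,a})=\frac1{d_n^X}\sum_{i=1}^{d_n^X}\sum_{j=1}^{d_n^A}e_{(x,i),(a,j)}$, $x\in X_n$, $a\in A_n$. The operator system $\mathcal S_{X,A}$ is the inductive limit of the sequence $(\mathcal S_{X_n,A_n},\gamma_{X_n,A_n})_{n\in\mathbb N}$ in the category of operator systems and unital completely positive maps. That is, it comes with unital completely positive maps $\gamma^{(n)}_{X,A}:\mathcal S_{X_n,A_n}\to\mathcal S_{X,A}$ satisfying $\gamma^{(n+1)}_{X,A}\circ\gamma_{X_n,A_n}=\gamma^{(n)}_{X,A}$. Moreover, whenever $\mathcal R$ is an operator system and $\rho_n:\mathcal S_{X_n,A_n}\to\mathcal R$ are unital completely positive maps with $\rho_{n+1}\circ\gamma_{X_n,A_n}=\rho_n$ for all $n$, there is a unique unital completely positive map $\rho:\mathcal S_{X,A}\to\mathcal R$ with $\rho\circ\gamma^{(n)}_{X,A}=\rho_n$ for all $n$. *)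

theory Defs
  imports "HOL-Probability.Probability" "HOL-Library.Function_Algebras"
begin

section \<open>Complex vector spaces and Hilbert spaces\<close>

class scaleC =
  fixes scaleC :: "complex \<Rightarrow> 'a \<Rightarrow> 'a"  (infixr \<open>*\<^sub>C\<close> 75)

class complex_vector = ab_group_add + scaleC +
  assumes scaleC_add_right: "c *\<^sub>C (x + y) = c *\<^sub>C x + c *\<^sub>C y"
    and scaleC_add_left: "(c + d) *\<^sub>C x = c *\<^sub>C x + d *\<^sub>C x"
    and scaleC_scaleC: "c *\<^sub>C d *\<^sub>C x = (c * d) *\<^sub>C x"
    and scaleC_one: "1 *\<^sub>C x = x"

text \<open>The inner product is antilinear in the first and linear in the second variable.\<close>

class chilbert_space = complex_vector + banach +
  fixes cinner :: "'a \<Rightarrow> 'a \<Rightarrow> complex"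
  assumes scaleR_scaleC: "r *\<^sub>R x = complex_of_real r *\<^sub>C x"
    and cinner_commute: "cinner x y = cnj (cinner y x)"
    and cinner_add_right: "cinner x (y + z) = cinner x y + cinner x z"
    and cinner_scaleC_right: "cinner x (c *\<^sub>C y) = c * cinner x y"
    and cinner_self: "cinner x x = complex_of_real ((norm x)\<^sup>2)"

lemma cinner_scaleC_left: "cinner (c *\<^sub>C x) y = cnj c * cinner x (y :: 'a::chilbert_space)"
  by (metis cinner_commute cinner_scaleC_right complex_cnj_mult)

lemma norm_scaleC: "norm (c *\<^sub>C (x :: 'a::chilbert_space)) = norm c * norm x"
proof -
  have "complex_of_real ((norm (c *\<^sub>C x))\<^sup>2) = (cnj c * c) * complex_of_real ((norm x)\<^sup>2)"
    by (simp only: cinner_self [symmetric] cinner_scaleC_left cinner_scaleC_right) simp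
  also have "\<dots> = complex_of_real ((norm c * norm x)\<^sup>2)"
    by (simp add: complex_norm_square power_mult_distrib mult.commute del: of_real_power)
  finally have "(norm (c *\<^sub>C x))\<^sup>2 = (norm c * norm x)\<^sup>2"
    by (simp only: of_real_eq_iff)
  then show ?thesis
    by (simp add: power2_eq_iff_nonneg)
qed

lemma bounded_linear_scaleC: "bounded_linear (\<lambda>x :: 'a::chilbert_space. c *\<^sub>C x)"
proof (rule bounded_linear_intro [where K = "norm c"])
  show "c *\<^sub>C (r *\<^sub>R x) = r *\<^sub>R (c *\<^sub>C x)" for r and x :: 'a
    by (simp add: scaleR_scaleC scaleC_scaleC mult.commute)
qed (simp_all add: scaleC_add_right norm_scaleC mult.commute)

instantiation complex :: complex_vector
begin
definition scaleC_complex :: "complex \<Rightarrow> complex \<Rightarrow> complex" where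
  "scaleC_complex c z = c * z"
instance
  by standard (simp_all add: scaleC_complex_def algebra_simps)
end

instantiation "fun" :: (type, complex_vector) complex_vector
begin
definition scaleC_fun :: "complex \<Rightarrow> ('a \<Rightarrow> 'b) \<Rightarrow> 'a \<Rightarrow> 'b" where
  "scaleC_fun c f = (\<lambda>x. c *\<^sub>C f x)"
instance
  by standard (simp_all add: scaleC_fun_def fun_eq_iff scaleC_add_right scaleC_add_left
      scaleC_scaleC scaleC_one)
end

instantiation blinfun :: (real_normed_vector, chilbert_space) complex_vector
begin
lift_definition scaleC_blinfun :: "complex \<Rightarrow> 'a \<Rightarrow>\<^sub>L 'b \<Rightarrow> 'a \<Rightarrow>\<^sub>L 'b" is "\<lambda>c f x. c *\<^sub>C f x"
  by (rule bounded_linear_compose [OF bounded_linear_scaleC])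
instance
  by standard (transfer, simp add: fun_eq_iff scaleC_add_right scaleC_add_left
      scaleC_scaleC scaleC_one)+
end

text \<open>The bounded operators \<open>\<B>(H)\<close>: the type \<open>'h \<Rightarrow>\<^sub>L 'h\<close> consists of real-linear maps.\<close>

definition bounded_ops :: "('h::chilbert_space \<Rightarrow>\<^sub>L 'h) set" where
  "bounded_ops = {T. \<forall>c x. blinfun_apply T (c *\<^sub>C x) = c *\<^sub>C blinfun_apply T x}"

definition cadjoint :: "('h::chilbert_space \<Rightarrow>\<^sub>L 'h) \<Rightarrow> 'h \<Rightarrow>\<^sub>L 'h" where
  "cadjoint T = (THE S. \<forall>x y. cinner (blinfun_apply S x) y = cinner x (blinfun_apply T y))"

section \<open>Operator systems\<close>

text \<open>
  Matrices over \<open>V\<close> are functions of two indices that vanish outside the \<open>k \<times> k\<close> block.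
  Hence sums, negatives and scalar multiples of matrices are the pointwise operations.
\<close>

definition mats :: "nat \<Rightarrow> 'v::zero set \<Rightarrow> (nat \<Rightarrow> nat \<Rightarrow> 'v) set" where
  "mats k V = {X. (\<forall>i<k. \<forall>j<k. X i j \<in> V) \<and> (\<forall>i j. k \<le> i \<or> k \<le> j \<longrightarrow> X i j = 0)}"

text \<open>\<open>compress k m \<alpha> X\<close> is \<open>\<alpha>\<^sup>* X \<alpha>\<close> for \<open>X \<in> M\<^sub>k(V)\<close> and a scalar \<open>k \<times> m\<close> matrix \<open>\<alpha>\<close>.\<close>

definition compress ::
  "nat \<Rightarrow> nat \<Rightarrow> (nat \<Rightarrow> nat \<Rightarrow> complex) \<Rightarrow> (nat \<Rightarrow> nat \<Rightarrow> 'v::complex_vector) \<Rightarrow> nat \<Rightarrow> nat \<Rightarrow> 'v" where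
  "compress k m \<alpha> X =
     (\<lambda>i j. if i < m \<and> j < m then (\<Sum>p<k. \<Sum>q<k. (cnj (\<alpha> p i) * \<alpha> q j) *\<^sub>C X p q) else 0)"

definition diag_mat :: "nat \<Rightarrow> 'v::zero \<Rightarrow> nat \<Rightarrow> nat \<Rightarrow> 'v" where
  "diag_mat k v = (\<lambda>i j. if i = j \<and> i < k then v else 0)"

record 'v opsys =
  carr :: "'v set"
  star :: "'v \<Rightarrow> 'v"
  ounit :: 'v
  pos :: "nat \<Rightarrow> (nat \<Rightarrow> nat \<Rightarrow> 'v) set"

definition herm_mats :: "'v::complex_vector opsys \<Rightarrow> nat \<Rightarrow> (nat \<Rightarrow> nat \<Rightarrow> 'v) set" where
  "herm_mats R k = {X \<in> mats k (carr R). \<forall>i<k. \<forall>j<k. star R (X j i) = X i j}"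

text \<open>
  Abstract operator systems in the sense of Choi and Effros: matrix-ordered *-vector spaces
  with an Archimedean matrix order unit.
\<close>

locale operator_system =
  fixes R :: "'v::complex_vector opsys"
  assumes carr_zero: "0 \<in> carr R"
    and carr_add: "\<lbrakk>x \<in> carr R; y \<in> carr R\<rbrakk> \<Longrightarrow> x + y \<in> carr R"
    and carr_scaleC: "x \<in> carr R \<Longrightarrow> c *\<^sub>C x \<in> carr R"
    and star_carr: "x \<in> carr R \<Longrightarrow> star R x \<in> carr R"
    and star_star: "x \<in> carr R \<Longrightarrow> star R (star R x) = x"
    and star_add: "\<lbrakk>x \<in> carr R; y \<in> carr R\<rbrakk> \<Longrightarrow> star R (x + y) = star R x + star R y"
    and star_scaleC: "x \<in> carr R \<Longrightarrow> star R (c *\<^sub>C x) = cnj c *\<^sub>C star R x"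
    and unit_carr: "ounit R \<in> carr R"
    and star_unit: "star R (ounit R) = ounit R"
    and pos_herm: "pos R k \<subseteq> herm_mats R k"
    and pos_add: "\<lbrakk>X \<in> pos R k; Y \<in> pos R k\<rbrakk> \<Longrightarrow> X + Y \<in> pos R k"
    and pos_scale: "\<lbrakk>X \<in> pos R k; 0 \<le> r\<rbrakk> \<Longrightarrow> complex_of_real r *\<^sub>C X \<in> pos R k"
    and pos_proper: "\<lbrakk>X \<in> pos R k; - X \<in> pos R k\<rbrakk> \<Longrightarrow> X = 0"
    and pos_compress: "X \<in> pos R k \<Longrightarrow> compress k m \<alpha> X \<in> pos R m"
    and order_unit: "X \<in> herm_mats R k \<Longrightarrow>
          \<exists>r>0. complex_of_real r *\<^sub>C diag_mat k (ounit R) + X \<in> pos R k"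
    and archimedean: "\<lbrakk>X \<in> herm_mats R k;
          \<And>r. 0 < r \<Longrightarrow> complex_of_real r *\<^sub>C diag_mat k (ounit R) + X \<in> pos R k\<rbrakk>
          \<Longrightarrow> X \<in> pos R k"

definition is_ucp ::
  "'v::complex_vector opsys \<Rightarrow> 'w::complex_vector opsys \<Rightarrow> ('v \<Rightarrow> 'w) \<Rightarrow> bool" where
  "is_ucp R S \<phi> \<longleftrightarrow>
     \<phi> ` carr R \<subseteq> carr S \<and>
     (\<forall>x\<in>carr R. \<forall>y\<in>carr R. \<phi> (x + y) = \<phi> x + \<phi> y) \<and>
     (\<forall>c. \<forall>x\<in>carr R. \<phi> (c *\<^sub>C x) = c *\<^sub>C \<phi> x) \<and>
     \<phi> (ounit R) = ounit S \<and>
     (\<forall>k. \<forall>X\<in>pos R k. (\<lambda>i j. \<phi> (X i j)) \<in> pos S k)"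

text \<open>The set of unital completely positive maps; these are functions on \<open>carr R\<close> only.\<close>

definition UCP ::
  "'v::complex_vector opsys \<Rightarrow> 'w::complex_vector opsys \<Rightarrow> ('v \<Rightarrow> 'w) set" where
  "UCP R S = {\<phi> \<in> extensional (carr R). is_ucp R S \<phi>}"

definition is_unital_complete_order_embedding ::
  "'v::complex_vector opsys \<Rightarrow> 'w::complex_vector opsys \<Rightarrow> ('v \<Rightarrow> 'w) \<Rightarrow> bool" where
  "is_unital_complete_order_embedding R S \<phi> \<longleftrightarrow>
     is_ucp R S \<phi> \<and> inj_on \<phi> (carr R) \<and>
     (\<forall>k. \<forall>X\<in>mats k (carr R). (\<lambda>i j. \<phi> (X i j)) \<in> pos S k \<longrightarrow> X \<in> pos R k)"

text \<open>
  A self-adjoint unital subspace \<open>M\<close> of \<open>\<B>(H)\<close>, ordered by \<open>M\<^sub>k(\<B>(H)) = \<B>(H\<^sup>k)\<close>.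
\<close>

definition op_opsys :: "('h::chilbert_space \<Rightarrow>\<^sub>L 'h) set \<Rightarrow> ('h \<Rightarrow>\<^sub>L 'h) opsys" where
  "op_opsys M =
     \<lparr>carr = M, star = cadjoint, ounit = id_blinfun,
      pos = (\<lambda>k. {X \<in> mats k M. \<forall>h :: nat \<Rightarrow> 'h.
               (\<Sum>i<k. \<Sum>j<k. cinner (h i) (blinfun_apply (X i j) (h j))) \<in> \<real>\<^sub>\<ge>\<^sub>0})\<rparr>"

text \<open>
  A space \<open>F\<close> of complex functions on \<open>\<Omega>\<close>, extended by \<open>0\<close>; a matrix of functions is positive
  iff it is pointwise a positive semidefinite matrix.
\<close>

definition fun_opsys :: "'o set \<Rightarrow> ('o \<Rightarrow> complex) set \<Rightarrow> ('o \<Rightarrow> complex) opsys" where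
  "fun_opsys \<Omega> F =
     \<lparr>carr = F, star = (\<lambda>f \<omega>. cnj (f \<omega>)), ounit = indicator \<Omega>,
      pos = (\<lambda>k. {X \<in> mats k F. \<forall>\<omega>\<in>\<Omega>. \<forall>c :: nat \<Rightarrow> complex.
               (\<Sum>i<k. \<Sum>j<k. cnj (c i) * X i j \<omega> * c j) \<in> \<real>\<^sub>\<ge>\<^sub>0})\<rparr>"

text \<open>
  The diagonal matrices \<open>\<D>\<^sub>U\<close>, a matrix being identified with the function \<open>U \<rightarrow> \<complex>\<close> of its
  diagonal entries; thus the basis vector \<open>\<delta>\<^sub>u\<close> is \<open>indicator {u}\<close>.
\<close>

definition diag_opsys :: "'u set \<Rightarrow> ('u \<Rightarrow> complex) opsys" where
  "diag_opsys U = fun_opsys U {f. \<forall>u. u \<notin> U \<longrightarrow> f u = 0}"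

definition cont_opsys :: "'o::topological_space set \<Rightarrow> ('o \<Rightarrow> complex) opsys" where
  "cont_opsys \<Omega> = fun_opsys \<Omega> {f. continuous_on \<Omega> f \<and> (\<forall>\<omega>. \<omega> \<notin> \<Omega> \<longrightarrow> f \<omega> = 0)}"

section \<open>Coproducts and inductive limits\<close>

text \<open>
  Universal properties can only be tested on the operator systems \<open>R\<close> carried by subspaces of a
  given type \<open>'v\<close>, the universe. The universe is required to contain a copy of the space of
  complex sequences, and hence of every complex vector space of dimension at most continuum; in
  particular it contains copies of \<open>\<B>(H)\<close> for separable \<open>H\<close> and of the coproducts and
  inductive limits below, so that these are determined up to isomorphism.
\<close>

definition large_universe :: "'v::complex_vector itself \<Rightarrow> bool" where
  "large_universe _ \<longleftrightarrow>
     (\<exists>emb :: (nat \<Rightarrow> complex) \<Rightarrow> 'v. inj emb \<and>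
        (\<forall>f g. emb (f + g) = emb f + emb g) \<and> (\<forall>c f. emb (c *\<^sub>C f) = c *\<^sub>C emb f))"

definition is_coproduct ::
  "'v::complex_vector itself \<Rightarrow> 's set \<Rightarrow> 'u set \<Rightarrow> 'c::complex_vector opsys
    \<Rightarrow> ('s \<Rightarrow> ('u \<Rightarrow> complex) \<Rightarrow> 'c) \<Rightarrow> bool" where
  "is_coproduct _ S U C \<iota> \<longleftrightarrow>
     operator_system C \<and>
     (\<forall>s\<in>S. is_unital_complete_order_embedding (diag_opsys U) C (\<iota> s)) \<and>
     (\<forall>(R :: 'v opsys) \<phi>. operator_system R \<and> (\<forall>s\<in>S. is_ucp (diag_opsys U) R (\<phi> s)) \<longrightarrow>
        (\<exists>!\<psi>. \<psi> \<in> UCP C R \<and> (\<forall>s\<in>S. \<forall>d\<in>carr (diag_opsys U). \<psi> (\<iota> s d) = \<phi> s d)))"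

text \<open>Sequences are indexed by \<open>n \<ge> 1\<close>; the values at \<open>0\<close> are irrelevant.\<close>

definition is_inductive_limit ::
  "'v::complex_vector itself \<Rightarrow> (nat \<Rightarrow> 'c::complex_vector opsys) \<Rightarrow> (nat \<Rightarrow> 'c \<Rightarrow> 'c)
    \<Rightarrow> 'l::complex_vector opsys \<Rightarrow> (nat \<Rightarrow> 'c \<Rightarrow> 'l) \<Rightarrow> bool" where
  "is_inductive_limit _ S \<gamma> L g \<longleftrightarrow>
     operator_system L \<and>
     (\<forall>n\<ge>1. is_ucp (S n) L (g n)) \<and>
     (\<forall>n\<ge>1. \<forall>x\<in>carr (S n). g (Suc n) (\<gamma> n x) = g n x) \<and>
     (\<forall>(R :: 'v opsys) \<rho>. operator_system R \<and> (\<forall>n\<ge>1. is_ucp (S n) R (\<rho> n)) \<and>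
          (\<forall>n\<ge>1. \<forall>x\<in>carr (S n). \<rho> (Suc n) (\<gamma> n x) = \<rho> n x) \<longrightarrow>
        (\<exists>!\<psi>. \<psi> \<in> UCP L R \<and> (\<forall>n\<ge>1. \<forall>x\<in>carr (S n). \<psi> (g n x) = \<rho> n x)))"

section \<open>Inductive families of sets\<close>

text \<open>
  The family with first set \<open>X\<^sub>1\<close> and \<open>X\<^sub>n\<^sub>+\<^sub>1 = X\<^sub>n \<times> [d\<^sub>n]\<close> is determined by \<open>X\<^sub>1\<close> and \<open>d\<close>. The element
  \<open>((x, i\<^sub>1), \<dots>, i\<^sub>n\<^sub>-\<^sub>1)\<close> of \<open>X\<^sub>n\<close> is encoded as \<open>(x, [i\<^sub>1, \<dots>, i\<^sub>n\<^sub>-\<^sub>1])\<close>.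
  The bijection \<open>b\<close> is the identification of \<open>X\<^sub>1\<close> with \<open>[d\<^sub>0]\<close> by which elements of \<open>X\<^sub>n\<close> become
  initial segments of points of the Cantor space.
\<close>

definition inductive_family :: "'x set \<Rightarrow> (nat \<Rightarrow> nat) \<Rightarrow> ('x \<Rightarrow> nat) \<Rightarrow> bool" where
  "inductive_family X1 d b \<longleftrightarrow>
     finite X1 \<and> X1 \<noteq> {} \<and> d 0 = card X1 \<and> (\<forall>n. 1 \<le> d n) \<and> bij_betw b X1 {1..d 0}"

definition level :: "'x set \<Rightarrow> (nat \<Rightarrow> nat) \<Rightarrow> nat \<Rightarrow> ('x \<times> nat list) set" where
  "level X1 d n =
     {(x, w). x \<in> X1 \<and> Suc (length w) = n \<and> (\<forall>k<length w. w ! k \<in> {1..d (Suc k)})}"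

definition append_index :: "'x \<times> nat list \<Rightarrow> nat \<Rightarrow> 'x \<times> nat list" where
  "append_index y i = (fst y, snd y @ [i])"

definition cantor :: "(nat \<Rightarrow> nat) \<Rightarrow> (nat \<Rightarrow> nat) set" where
  "cantor d = (\<Pi>\<^sub>E n\<in>UNIV. {1..d n})"

definition cantor_measure :: "(nat \<Rightarrow> nat) \<Rightarrow> (nat \<Rightarrow> nat) measure" where
  "cantor_measure d = (\<Pi>\<^sub>M n\<in>UNIV. uniform_count_measure {1..d n})"

definition cylinder :: "(nat \<Rightarrow> nat) \<Rightarrow> ('x \<Rightarrow> nat) \<Rightarrow> 'x \<times> nat list \<Rightarrow> (nat \<Rightarrow> nat) set" where
  "cylinder d b y =
     {\<omega> \<in> cantor d. \<omega> 0 = b (fst y) \<and> (\<forall>k<length (snd y). \<omega> (Suc k) = snd y ! k)}"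

section \<open>Square integrable functions and von Neumann algebra tensor products\<close>

definition sq_integrable :: "'o measure \<Rightarrow> ('o \<Rightarrow> complex) set" where
  "sq_integrable \<mu> = {f \<in> borel_measurable \<mu>. integrable \<mu> (\<lambda>\<omega>. (norm (f \<omega>))\<^sup>2)}"

text \<open>
  \<open>q\<close> presents the Hilbert space \<open>'l\<close> as \<open>L\<^sup>2(\<mu>)\<close>: it sends a square integrable function to its
  class modulo null functions.
\<close>

definition is_L2 :: "'o measure \<Rightarrow> (('o \<Rightarrow> complex) \<Rightarrow> 'l::chilbert_space) \<Rightarrow> bool" where
  "is_L2 \<mu> q \<longleftrightarrow>
     (\<forall>f\<in>sq_integrable \<mu>. \<forall>g\<in>sq_integrable \<mu>. q (f + g) = q f + q g) \<and>
     (\<forall>c. \<forall>f\<in>sq_integrable \<mu>. q (c *\<^sub>C f) = c *\<^sub>C q f) \<and>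
     (\<forall>f\<in>sq_integrable \<mu>. \<forall>g\<in>sq_integrable \<mu>.
        cinner (q f) (q g) = (\<integral>\<omega>. cnj (f \<omega>) * g \<omega> \<partial>\<mu>)) \<and>
     q ` sq_integrable \<mu> = UNIV"

text \<open>\<open>L\<^sup>\<infinity>(\<mu>)\<close> as the von Neumann algebra of multiplication operators on \<open>L\<^sup>2(\<mu>)\<close>.\<close>

definition Linf_ops ::
  "'o measure \<Rightarrow> (('o \<Rightarrow> complex) \<Rightarrow> 'l::chilbert_space) \<Rightarrow> ('l \<Rightarrow>\<^sub>L 'l) set" where
  "Linf_ops \<mu> q = {T \<in> bounded_ops. \<exists>f\<in>borel_measurable \<mu>.
     (\<exists>c. AE \<omega> in \<mu>. norm (f \<omega>) \<le> c) \<and>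
     (\<forall>g\<in>sq_integrable \<mu>. blinfun_apply T (q g) = q (\<lambda>\<omega>. f \<omega> * g \<omega>))}"

text \<open>
  \<open>t\<close> presents \<open>'k\<close> as the Hilbert space tensor product of \<open>'l\<close> and \<open>'h\<close>. The real span of the
  elementary tensors is their complex span, as \<open>c t(x, y) = t(c x, y)\<close>.
\<close>

definition is_hilbert_tensor ::
  "('l::chilbert_space \<Rightarrow> 'h::chilbert_space \<Rightarrow> 'k::chilbert_space) \<Rightarrow> bool" where
  "is_hilbert_tensor t \<longleftrightarrow>
     (\<forall>x x' y. t (x + x') y = t x y + t x' y) \<and>
     (\<forall>x y y'. t x (y + y') = t x y + t x y') \<and>
     (\<forall>c x y. t (c *\<^sub>C x) y = c *\<^sub>C t x y \<and> t x (c *\<^sub>C y) = c *\<^sub>C t x y) \<and>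
     (\<forall>x y x' y'. cinner (t x y) (t x' y') = cinner x x' * cinner y y') \<and>
     closure (span (range (\<lambda>(x, y). t x y))) = UNIV"

definition commutant :: "('k::chilbert_space \<Rightarrow>\<^sub>L 'k) set \<Rightarrow> ('k \<Rightarrow>\<^sub>L 'k) set" where
  "commutant M = {T \<in> bounded_ops. \<forall>S\<in>M. T o\<^sub>L S = S o\<^sub>L T}"

text \<open>
  The von Neumann algebra generated by the operators \<open>S \<otimes> T\<close> with \<open>S \<in> M\<close> and \<open>T \<in> N\<close>.
  The set of elementary tensors is self-adjoint, so that algebra is its double commutant.
\<close>

definition vn_tensor ::
  "('l::chilbert_space \<Rightarrow> 'h::chilbert_space \<Rightarrow> 'k::chilbert_space)
    \<Rightarrow> ('l \<Rightarrow>\<^sub>L 'l) set \<Rightarrow> ('h \<Rightarrow>\<^sub>L 'h) set \<Rightarrow> ('k \<Rightarrow>\<^sub>L 'k) set" where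
  "vn_tensor t M N = commutant (commutant {R \<in> bounded_ops. \<exists>S\<in>M. \<exists>T\<in>N.
     \<forall>x y. blinfun_apply R (t x y) = t (blinfun_apply S x) (blinfun_apply T y)})"

text \<open>
  The slice \<open>(\<omega>\<^sub>\<xi> \<otimes> id)(R) \<in> \<B>(H)\<close> along the vector functional \<open>\<omega>\<^sub>\<xi>(S) = \<langle>\<xi>, S \<xi>\<rangle>\<close>. On \<open>L\<^sup>\<infinity>(\<mu>)\<close>, for
  \<open>\<xi>\<close> the class of the indicator function of \<open>B\<close>, this functional is \<open>f \<mapsto> \<integral>\<^sub>B f d\<mu>\<close>.
\<close>

definition slice ::
  "('l::chilbert_space \<Rightarrow> 'h::chilbert_space \<Rightarrow> 'k::chilbert_space)
    \<Rightarrow> 'l \<Rightarrow> ('k \<Rightarrow>\<^sub>L 'k) \<Rightarrow> 'h \<Rightarrow>\<^sub>L 'h" where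
  "slice t \<xi> R =
     (THE E. \<forall>h k. cinner h (blinfun_apply E k) = cinner (t \<xi> h) (blinfun_apply R (t \<xi> k)))"

end

theory Submission
  imports Defs
begin

text \<open>
  Write \<open>[x]\<close> for the cylinder of \<open>x\<close>. By the two universal properties, \<open>\<Gamma>\<close> is the same as a compatible
  family of unital completely positive maps \<open>\<phi>\<^sub>n\<^sub>,\<^sub>x\<close> from the diagonal algebra over \<open>A\<^sub>n\<close> to \<open>\<B>(H)\<close>;
  compatibility says that these form an operator valued martingale on \<open>\<Omega>\<^sub>X\<close>. Given \<open>\<Phi>\<close>, the slices of \<open>\<Phi>\<close> along
  normalised indicator functions of \<open>[x]\<close> are such a family: an operator in \<open>L\<^sup>\<infinity> \<otimes> \<B>(H)\<close> has no matrix
  entries between disjoint cylinders, since it commutes with the multiplication operators. Conversely, given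
  the family and a continuous \<open>f\<close>, sample \<open>f\<close> at one point of each cylinder of level \<open>n\<close> to get \<open>f\<^sub>n\<close>, and let
  \<open>\<Phi>(f)\<close> be the weak limit of \<open>\<Sum>\<^sub>x 1\<^sub>x \<otimes> \<phi>\<^sub>n\<^sub>,\<^sub>x(f\<^sub>n)\<close>, where \<open>1\<^sub>x\<close> is the indicator function of \<open>[x]\<close>.
  It exists since the matrix entries between vectors of a fixed level form a Cauchy sequence, and it lies in the double commutant. Uniqueness holds since cylinder
  functions are dense in \<open>L\<^sup>2(\<Omega>\<^sub>X)\<close> and in \<open>C(\<Omega>\<^sub>A)\<close>.
\<close>

section \<open>Hilbert spaces\<close>

text \<open>The coproducts and the limit are known only through universal properties, and these are
  tested only on operator systems inside the type \<open>'v\<close>. This is why separability of H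
  matters: matrix entries along a countable dense sequence embed B(H) linearly into the complex
  sequences, hence into \<open>'v\<close>, and the universal properties are moved along that
  embedding. Sampling is preferred to an extension by continuity from cylinder functions because
  evaluation at finitely many points is itself unital and completely positive on all of
  C(\<Omega>_A), so that the weak limit inherits these properties. The price is that the sampled
  family of a general f is not a martingale. For a cylinder function it is one from some level on,
  so its matrix entries become constant; uniform approximation then handles every f. A Bessel
  inequality for the vectors of level n bounds the forms by sup |f| uniformly in n, so that the weak
  limit is an operator. The factor |X_n| in the correspondence is the inverse of the measure of a
  cylinder of level n; it makes the slices unital.\<close>

lemma cinner_add_left: "cinner (x + y) z = cinner x z + cinner y (z :: 'a::chilbert_space)"
  by (metis cinner_add_right cinner_commute complex_cnj_add)

lemma cinner_Cauchy_Schwarz: "norm (cinner x y) \<le> norm x * norm (y :: 'a::chilbert_space)"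
proof (cases "y = 0")
  case True
  have "cinner x (0 :: 'a) = 0"
    using cinner_add_right [of x 0 0] by simp
  with True show ?thesis by simp
next
  case False
  \<comment> \<open>With this \<open>c\<close> the vector \<open>x + c *\<^sub>C y\<close> is the
    component of \<open>x\<close> orthogonal to \<open>y\<close>.\<close>
  define c where "c = - cinner y x / complex_of_real ((norm y)\<^sup>2)"
  have ny: "complex_of_real ((norm y)\<^sup>2) \<noteq> 0" using False by simp
  have "complex_of_real ((norm (x + c *\<^sub>C y))\<^sup>2) =
      cinner x x + c * cinner x y + cnj c * cinner y x + cnj c * c * cinner y y"
    by (simp add: cinner_self [symmetric] cinner_add_left cinner_add_right cinner_scaleC_left
        cinner_scaleC_right algebra_simps del: of_real_power)
  also have "\<dots> = complex_of_real ((norm x)\<^sup>2) - cinner x y * cinner y x / complex_of_real ((norm y)\<^sup>2)"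
    using ny by (simp add: c_def cinner_self cinner_commute [of x y, symmetric] field_simps power2_eq_square del: of_real_power)
  also have "cinner x y * cinner y x = complex_of_real ((norm (cinner x y))\<^sup>2)"
    by (metis cinner_commute complex_norm_square)
  finally have "(norm (x + c *\<^sub>C y))\<^sup>2 = (norm x)\<^sup>2 - (norm (cinner x y))\<^sup>2 / (norm y)\<^sup>2"
    by (metis of_real_diff of_real_divide of_real_eq_iff)
  then have "(norm (cinner x y))\<^sup>2 / (norm y)\<^sup>2 \<le> (norm x)\<^sup>2"
    by (metis diff_ge_0_iff_ge zero_le_power2)
  then have "(norm (cinner x y))\<^sup>2 \<le> (norm x * norm y)\<^sup>2"
    using False by (simp add: field_simps power_mult_distrib)
  then show ?thesis
    by (rule power2_le_imp_le) simp
qed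

text \<open>Real bilinearity gives continuity, sums and differences at once; complex scalars are
  handled by \<open>cinner_scaleC_left\<close> and \<open>cinner_scaleC_right\<close>.\<close>

interpretation cinner: bounded_bilinear "cinner :: 'a::chilbert_space \<Rightarrow> 'a \<Rightarrow> complex"
proof
  show "cinner (r *\<^sub>R a) b = r *\<^sub>R cinner a b" for r and a b :: 'a
    by (simp add: scaleR_scaleC cinner_scaleC_left scaleR_conv_of_real)
  show "cinner a (r *\<^sub>R b) = r *\<^sub>R cinner a b" for r and a b :: 'a
    by (simp add: scaleR_scaleC cinner_scaleC_right scaleR_conv_of_real)
  show "\<exists>K. \<forall>a b :: 'a. norm (cinner a b) \<le> norm a * norm b * K"
    by (intro exI [of _ 1]) (simp add: cinner_Cauchy_Schwarz)
qed (rule cinner_add_left cinner_add_right)+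

lemma cinner_ext_right:
  fixes u v :: "'a::chilbert_space"
  assumes "\<And>w. cinner w u = cinner w v"
  shows "u = v"
proof -
  have "cinner (u - v) (u - v) = 0"
    by (subst cinner.diff_right) (simp add: assms)
  then show ?thesis by (simp add: cinner_self)
qed

lemma cinner_ext_left:
  fixes u v :: "'a::chilbert_space"
  assumes "\<And>w. cinner u w = cinner v w"
  shows "u = v"
  by (rule cinner_ext_right) (metis assms cinner_commute)

lemma norm_sq_add:
  fixes x y :: "'a::chilbert_space"
  shows "(norm (x + y))\<^sup>2 = (norm x)\<^sup>2 + 2 * Re (cinner x y) + (norm y)\<^sup>2"
proof -
  have "cinner (x + y) (x + y) = cinner x x + (cinner x y + cnj (cinner x y)) + cinner y y"
    by (simp add: cinner.add_left cinner.add_right cinner_commute [of y x])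
  from arg_cong [OF this, of Re] show ?thesis by (simp add: cinner_self)
qed

lemma parallelogram_law:
  fixes x y :: "'a::chilbert_space"
  shows "(norm (x - y))\<^sup>2 + (norm (x + y))\<^sup>2 = 2 * (norm x)\<^sup>2 + 2 * (norm y)\<^sup>2"
  using norm_sq_add [of x y] norm_sq_add [of x "- y"] by (simp add: cinner.minus_right)

section \<open>Orthogonal projection and representation of functionals\<close>

definition csubspace :: "'a::complex_vector set \<Rightarrow> bool" where
  "csubspace V \<longleftrightarrow> 0 \<in> V \<and> (\<forall>x\<in>V. \<forall>y\<in>V. x + y \<in> V) \<and> (\<forall>c. \<forall>x\<in>V. c *\<^sub>C x \<in> V)"

lemma csubspace_zero: "csubspace V \<Longrightarrow> 0 \<in> V"
  and csubspace_add: "csubspace V \<Longrightarrow> x \<in> V \<Longrightarrow> y \<in> V \<Longrightarrow> x + y \<in> V"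
  and csubspace_scaleC: "csubspace V \<Longrightarrow> x \<in> V \<Longrightarrow> c *\<^sub>C x \<in> V"
  by (auto simp: csubspace_def)

lemma csubspace_sum: "csubspace V \<Longrightarrow> (\<And>i. i \<in> I \<Longrightarrow> f i \<in> V) \<Longrightarrow> (\<Sum>i\<in>I. f i) \<in> V"
  by (induction I rule: infinite_finite_induct) (auto simp: csubspace_zero csubspace_add)

lemma scaleC_zero_right [simp]: "c *\<^sub>C (0 :: 'a::complex_vector) = 0"
  using scaleC_add_right [of c 0 0] by simp

lemma scaleC_zero_left [simp]: "0 *\<^sub>C (x :: 'a::complex_vector) = 0"
  using scaleC_add_left [of 0 0 x] by simp

lemma scaleC_minus_one: "(- 1) *\<^sub>C (x :: 'a::complex_vector) = - x"
  using scaleC_add_left [of "-1" 1 x] by (simp add: scaleC_one eq_neg_iff_add_eq_0)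

lemma scaleC_sum_right: "c *\<^sub>C (\<Sum>i\<in>I. f i) = (\<Sum>i\<in>I. c *\<^sub>C (f i :: 'a::complex_vector))"
  by (induction I rule: infinite_finite_induct) (simp_all add: scaleC_add_right)

text \<open>The minimiser \<open>z\<close> of \<open>\<parallel>x\<parallel>\<^sup>2 - 2 Re f(x)\<close> on \<open>V\<close> represents \<open>f\<close>. A minimising sequence is Cauchy by the parallelogram law.\<close>

lemma Riesz_on_subspace:
  fixes f :: "'a::chilbert_space \<Rightarrow> complex"
  assumes V: "csubspace V" "closed V"
    and add: "\<And>x y. f (x + y) = f x + f y"
    and scale: "\<And>c x. f (c *\<^sub>C x) = c * f x"
    and bound: "\<And>x. norm (f x) \<le> C * norm x"
  shows "\<exists>z\<in>V. \<forall>x\<in>V. cinner z x = f x"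
proof -
  have bl: "bounded_linear f"
    by (rule bounded_linear_intro [where K = C])
      (simp_all add: add scale scaleR_scaleC scaleR_conv_of_real bound mult.commute)
  define J where "J x = (norm x)\<^sup>2 - 2 * Re (f x)" for x
  have J_cont: "(\<lambda>n. J (s n)) \<longlonglongrightarrow> J z" if "s \<longlonglongrightarrow> z" for s z
    unfolding J_def by (intro tendsto_intros that bounded_linear.tendsto [OF bl])
  have J_lower: "- C\<^sup>2 \<le> J x" for x
  proof -
    have "Re (f x) \<le> C * norm x"
      using bound [of x] complex_Re_le_cmod [of "f x"] by linarith
    moreover have "0 \<le> (norm x - C)\<^sup>2" by simp
    ultimately show ?thesis by (simp add: J_def power2_diff mult.commute)
  qed
  have V_add: "x + y \<in> V" if "x \<in> V" "y \<in> V" for x y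
    using V that by (simp add: csubspace_def)
  have V_scale: "c *\<^sub>C x \<in> V" if "x \<in> V" for c x
    using V that by (simp add: csubspace_def)
  have V0: "0 \<in> V" using V by (simp add: csubspace_def)
  define m where "m = (INF x\<in>V. J x)"
  have bdd: "bdd_below (J ` V)"
    by (intro bdd_belowI2 [of _ "- C\<^sup>2"] J_lower)
  have m_le: "m \<le> J x" if "x \<in> V" for x
    unfolding m_def by (rule cINF_lower [OF bdd that])
  have "\<exists>x\<in>V. J x < m + inverse (real (Suc n))" for n
  proof -
    have "\<exists>y\<in>J ` V. y < m + inverse (real (Suc n))"
      unfolding m_def by (rule cInf_lessD) (use V0 in auto)
    then show ?thesis by auto
  qed
  then obtain s where sV: "\<And>n. s n \<in> V" and sJ: "\<And>n. J (s n) < m + inverse (real (Suc n))"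
    by metis
  have mid: "(norm (x - y))\<^sup>2 \<le> 2 * J x + 2 * J y - 4 * m" if "x \<in> V" "y \<in> V" for x y
  proof -
    \<comment> \<open>The midpoint of \<open>x\<close> and \<open>y\<close> lies in
      \<open>V\<close>, so \<open>J\<close> there is at least the infimum \<open>m\<close>; the
      parallelogram law turns this into a bound on the distance of \<open>x\<close> and
      \<open>y\<close>.\<close>
    let ?w = "complex_of_real (1/2) *\<^sub>C (x + y)"
    have "m \<le> J ?w" by (intro m_le V_scale V_add that)
    also have "J ?w = (norm (x + y))\<^sup>2 / 4 - Re (f x) - Re (f y)"
      by (simp add: J_def norm_scaleC scale add power_divide add_divide_distrib)
    finally show ?thesis
      using parallelogram_law [of x y] by (simp add: J_def)
  qed
  have "Cauchy s"
  proof (rule metric_CauchyI)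
    fix e :: real assume "e > 0"
    then obtain N where N: "inverse (real (Suc N)) < e\<^sup>2 / 4"
      using reals_Archimedean [of "e\<^sup>2 / 4"] by auto
    have "dist (s p) (s r) < e" if "p \<ge> N" "r \<ge> N" for p r
    proof -
      have le: "inverse (real (Suc p)) \<le> inverse (real (Suc N))"
        "inverse (real (Suc r)) \<le> inverse (real (Suc N))" using that by (auto intro!: le_imp_inverse_le)
      have "(norm (s p - s r))\<^sup>2 < e\<^sup>2"
        using mid [OF sV sV, of p r] sJ [of p] sJ [of r] le N by linarith
      then show ?thesis
        using \<open>e > 0\<close> by (auto simp: dist_norm intro: power2_less_imp_less)
    qed
    then show "\<exists>M. \<forall>p\<ge>M. \<forall>r\<ge>M. dist (s p) (s r) < e" by blast
  qed
  then obtain z where z: "s \<longlonglongrightarrow> z"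
    using Cauchy_convergent convergent_def by blast
  have zV: "z \<in> V" using closed_sequentially [OF V(2) sV z] .
  have "(\<lambda>n. m + inverse (real (Suc n))) \<longlonglongrightarrow> m"
    using tendsto_add [OF tendsto_const [of m] LIMSEQ_inverse_real_of_nat] by simp
  then have "J z \<le> m"
    using sJ by (intro LIMSEQ_le [OF J_cont [OF z]]) (auto intro: less_imp_le)
  then have Jz: "J z \<le> J x" if "x \<in> V" for x
    using m_le [OF that] by linarith
  \<comment> \<open>First variation: along the real line through \<open>z\<close> in direction
    \<open>x\<close>, \<open>J\<close> is a quadratic with its minimum at \<open>z\<close>, which
    forces the linear coefficient to vanish.\<close>
  have re: "Re (cinner z x) = Re (f x)" if x: "x \<in> V" for x
  proof -
    define b where "b = Re (cinner z x) - Re (f x)"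
    have ineq: "0 \<le> 2 * r * b + r\<^sup>2 * (norm x)\<^sup>2" for r
    proof -
      have "z + complex_of_real r *\<^sub>C x \<in> V" using zV x by (intro V_add V_scale)
      from Jz [OF this] show ?thesis
        by (simp add: J_def norm_sq_add add scale norm_scaleC cinner_scaleC_right b_def
            power_mult_distrib algebra_simps)
    qed
    have "b = 0"
    proof (rule ccontr)
      assume "b \<noteq> 0"
      \<comment> \<open>Adding 1 keeps \<open>N\<close> positive when \<open>x = 0\<close>; the
        parameter \<open>- b / N\<close> makes the quadratic negative unless
        \<open>b = 0\<close>.\<close>
      define N where "N = (norm x)\<^sup>2 + 1"
      have N: "N > 0" by (simp add: N_def add_nonneg_pos)
      have "0 \<le> 2 * (- b / N) * b + (- b / N)\<^sup>2 * (norm x)\<^sup>2" by (rule ineq)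
      also have "\<dots> \<le> 2 * (- b / N) * b + (- b / N)\<^sup>2 * N"
        by (intro add_left_mono mult_left_mono) (simp_all add: N_def)
      also have "\<dots> = - (b\<^sup>2 / N)"
        using N by (simp add: field_simps power2_eq_square)
      finally show False
        using N \<open>b \<noteq> 0\<close> by (simp add: field_simps)
    qed
    then show ?thesis by (simp add: b_def)
  qed
  have "cinner z x = f x" if x: "x \<in> V" for x
  proof (rule complex_eqI)
    show "Re (cinner z x) = Re (f x)" by (rule re [OF x])
    \<comment> \<open>The real part of \<open>-i w\<close> is the imaginary part of
      \<open>w\<close>, so the identity of real parts at \<open>-i x\<close> gives the one of
      imaginary parts at \<open>x\<close>.\<close>
    have "Re (cinner z (- \<i> *\<^sub>C x)) = Re (f (- \<i> *\<^sub>C x))"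
      by (rule re [OF V_scale [OF x]])
    then show "Im (cinner z x) = Im (f x)"
      by (simp only: scale cinner_scaleC_right) simp
  qed
  with zV show ?thesis by blast
qed

lemma Riesz_representation:
  fixes f :: "'a::chilbert_space \<Rightarrow> complex"
  assumes "\<And>x y. f (x + y) = f x + f y" "\<And>c x. f (c *\<^sub>C x) = c * f x"
    "\<And>x. norm (f x) \<le> C * norm x"
  shows "\<exists>z. \<forall>x. cinner z x = f x"
  using Riesz_on_subspace [of UNIV f C] assms by (auto simp: csubspace_def)

text \<open>The vector of \<open>V\<close> that represents the functional \<open>cinner u\<close> on
  \<open>V\<close> is the orthogonal projection of \<open>u\<close>; the remainder is orthogonal to
  \<open>V\<close>, hence zero.\<close>

lemma csubspace_dense:
  fixes V :: "'a::chilbert_space set"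
  assumes V: "csubspace V" "closed V" and orth: "\<And>u. (\<And>w. w \<in> V \<Longrightarrow> cinner u w = 0) \<Longrightarrow> u = 0"
  shows "V = UNIV"
proof -
  have "u \<in> V" for u
  proof -
    obtain z where z: "z \<in> V" "\<And>x. x \<in> V \<Longrightarrow> cinner z x = cinner u x"
      using Riesz_on_subspace [OF V cinner_add_right cinner_scaleC_right cinner_Cauchy_Schwarz, of u]
      by blast
    have "u - z = 0"
      by (rule orth) (simp add: cinner.diff_left z)
    with z show ?thesis by simp
  qed
  then show ?thesis by auto
qed

text \<open>A bounded functional is the pairing with some \<open>z\<close>, and here
  \<open>z\<close> is orthogonal to \<open>G\<close>. This is how identities are later extended from
  test vectors to all vectors: \<open>G\<close> is any total set, and no linear combinations have to
  be formed.\<close>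

lemma total_functional_zero:
  fixes f :: "'a::chilbert_space \<Rightarrow> complex"
  assumes total: "\<And>u. (\<And>w. w \<in> G \<Longrightarrow> cinner u w = 0) \<Longrightarrow> u = 0"
    and f: "\<And>x y. f (x + y) = f x + f y" "\<And>c x. f (c *\<^sub>C x) = c * f x" "\<And>x. norm (f x) \<le> C * norm x"
    and zero: "\<And>w. w \<in> G \<Longrightarrow> f w = 0"
  shows "f x = 0"
proof -
  obtain z where z: "\<And>x. cinner z x = f x" using Riesz_representation [OF f] by blast
  then have "z = 0" using zero by (intro total) simp
  then show ?thesis using z [of x] by (simp add: cinner.zero_left)
qed

text \<open>Riesz representation in the first variable, one \<open>y\<close> at a time; the form is
  antilinear in \<open>x\<close>, so it is conjugated first. Uniqueness of the representing vectors
  makes them linear in \<open>y\<close>.\<close>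

lemma bounded_ops_of_form:
  fixes B :: "'a::chilbert_space \<Rightarrow> 'a \<Rightarrow> complex"
  assumes add1: "\<And>x x' y. B (x + x') y = B x y + B x' y"
    and add2: "\<And>x y y'. B x (y + y') = B x y + B x y'"
    and sc1: "\<And>c x y. B (c *\<^sub>C x) y = cnj c * B x y"
    and sc2: "\<And>c x y. B x (c *\<^sub>C y) = c * B x y"
    and bd: "\<And>x y. norm (B x y) \<le> C * norm x * norm y"
  shows "\<exists>R\<in>bounded_ops. \<forall>x y. cinner x (blinfun_apply R y) = B x y"
proof -
  have "\<exists>z. \<forall>x. cinner z x = cnj (B x y)" for y
  proof (rule Riesz_representation [where C = "C * norm y"])
    show "norm (cnj (B x y)) \<le> C * norm y * norm x" for x
      using bd [of x y] by (simp add: mult_ac)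
  qed (simp_all add: add1 sc1)
  then obtain r where "\<And>x y. cinner (r y) x = cnj (B x y)" by metis
  then have r: "cinner x (r y) = B x y" for x y
    by (metis cinner_commute complex_cnj_cnj)
  have r_add: "r (y + y') = r y + r y'" for y y'
    by (rule cinner_ext_right) (simp add: r cinner_add_right add2)
  have r_sc: "r (c *\<^sub>C y) = c *\<^sub>C r y" for c y
    by (rule cinner_ext_right) (simp add: r cinner_scaleC_right sc2)
  have r_bd: "norm (r y) \<le> norm y * \<bar>C\<bar>" for y
  proof (cases "r y = 0")
    case False
    \<comment> \<open>Testing the form at \<open>x = r y\<close> and cancelling one factor
      \<open>norm (r y)\<close> gives the bound.\<close>
    have "(norm (r y))\<^sup>2 = norm (B (r y) y)"
      by (simp add: r [symmetric] cinner_self norm_power)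
    also have "\<dots> \<le> C * norm (r y) * norm y" by (rule bd)
    also have "\<dots> \<le> \<bar>C\<bar> * norm (r y) * norm y" by (intro mult_right_mono) auto
    finally show ?thesis using False by (simp add: power2_eq_square mult_ac)
  qed simp
  have bl: "bounded_linear r"
    by (rule bounded_linear_intro [where K = "\<bar>C\<bar>"]) (simp_all add: r_add r_sc r_bd scaleR_scaleC)
  show ?thesis
    by (intro bexI [of _ "Blinfun r"])
      (simp_all add: bounded_linear_Blinfun_apply bl r bounded_ops_def r_sc)
qed

lemma bounded_ops_ext:
  fixes R T :: "'a::chilbert_space \<Rightarrow>\<^sub>L 'a"
  assumes "\<And>u v. cinner u (blinfun_apply R v) = cinner u (blinfun_apply T v)"
  shows "R = T"
  by (rule blinfun_eqI, rule cinner_ext_right, rule assms)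

lemma bounded_opsD: "T \<in> bounded_ops \<Longrightarrow> blinfun_apply T (c *\<^sub>C x) = c *\<^sub>C blinfun_apply T x"
  by (simp add: bounded_ops_def)

lemma csubspace_bounded_ops: "csubspace bounded_ops"
  by (auto simp: csubspace_def bounded_ops_def blinfun.add_left blinfun.zero_left scaleC_blinfun.rep_eq
      scaleC_add_right scaleC_scaleC mult.commute)

lemma id_bounded_ops: "id_blinfun \<in> bounded_ops"
  by (simp add: bounded_ops_def)

lemma cinner_blinfun_bound:
  "norm (cinner x (blinfun_apply T y)) \<le> norm T * norm x * norm (y :: 'a::chilbert_space)"
proof -
  have "norm (cinner x (blinfun_apply T y)) \<le> norm x * norm (blinfun_apply T y)"
    by (rule cinner_Cauchy_Schwarz)
  also have "\<dots> \<le> norm x * (norm T * norm y)"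
    by (intro mult_left_mono norm_blinfun) simp
  finally show ?thesis by (simp add: mult_ac)
qed

section \<open>Adjoints\<close>

lemma adjoint_exists:
  fixes T :: "'a::chilbert_space \<Rightarrow>\<^sub>L 'a"
  assumes T: "T \<in> bounded_ops"
  shows "\<exists>S\<in>bounded_ops. \<forall>x y. cinner (blinfun_apply S x) y = cinner x (blinfun_apply T y)"
proof -
  have "\<exists>S\<in>bounded_ops. \<forall>x y. cinner x (blinfun_apply S y) = cinner (blinfun_apply T x) y"
  proof (rule bounded_ops_of_form [where C = "norm T"])
    show "norm (cinner (blinfun_apply T x) y) \<le> norm T * norm x * norm y" for x y
      using cinner_blinfun_bound [of y T x] by (subst cinner_commute) (simp add: mult_ac)
  qed (simp_all add: blinfun.add_right cinner_add_right cinner_add_left cinner_scaleC_left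
      cinner_scaleC_right bounded_opsD [OF T])
  then show ?thesis by (metis cinner_commute)
qed

text \<open>\<open>cadjoint\<close> is a definite description whose uniqueness comes from
  \<open>cinner_ext_left\<close>. Later adjoints are identified by exhibiting one operator with the
  adjoint relation.\<close>

lemma cadjoint_eqI:
  fixes S T :: "'a::chilbert_space \<Rightarrow>\<^sub>L 'a"
  assumes "\<And>x y. cinner (blinfun_apply S x) y = cinner x (blinfun_apply T y)"
  shows "cadjoint T = S"
  unfolding cadjoint_def
proof (rule the_equality)
  fix S' assume "\<forall>x y. cinner (blinfun_apply S' x) y = cinner x (blinfun_apply T y)"
  then show "S' = S"
    by (intro blinfun_eqI cinner_ext_left) (simp add: assms)
qed (simp add: assms)

lemma
  fixes T :: "'a::chilbert_space \<Rightarrow>\<^sub>L 'a"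
  assumes T: "T \<in> bounded_ops"
  shows cadjoint_bounded_ops: "cadjoint T \<in> bounded_ops"
    and cinner_cadjoint: "cinner (blinfun_apply (cadjoint T) x) y = cinner x (blinfun_apply T y)"
    and cinner_cadjoint': "cinner x (blinfun_apply (cadjoint T) y) = cinner (blinfun_apply T x) y"
proof -
  obtain S where S: "S \<in> bounded_ops"
      "\<And>x y. cinner (blinfun_apply S x) y = cinner x (blinfun_apply T y)"
    using adjoint_exists [OF T] by blast
  then have eq: "cadjoint T = S" by (intro cadjoint_eqI)
  show "cadjoint T \<in> bounded_ops"
    and *: "cinner (blinfun_apply (cadjoint T) x) y = cinner x (blinfun_apply T y)" for x y
    using S by (simp_all add: eq)
  then show "cinner x (blinfun_apply (cadjoint T) y) = cinner (blinfun_apply T x) y"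
    by (metis cinner_commute)
qed

section \<open>Weak limits of bounded forms\<close>

lemma closed_convergent:
  fixes f :: "nat \<Rightarrow> 'a::real_normed_vector \<Rightarrow> 'b::banach"
  assumes f: "\<And>n x x'. f n (x - x') = f n x - f n x'" and K: "\<And>n x. norm (f n x) \<le> K * norm x"
  shows "closed {x. convergent (\<lambda>n. f n x)}"
proof (rule closed_sequential_limits [THEN iffD2], intro allI impI, elim conjE, rule CollectI)
  fix s l assume s: "\<forall>n. s n \<in> {x. convergent (\<lambda>n. f n x)}" "s \<longlonglongrightarrow> l"
  show "convergent (\<lambda>n. f n l)"
  proof (rule Cauchy_convergent, rule metric_CauchyI)
    fix e :: real assume e: "e > 0"
    define K' where "K' = \<bar>K\<bar> + 1"
    have K'0: "K' > 0" by (simp add: K'_def)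
    have K': "norm (f n x) \<le> K' * norm x" for n x
    proof -
      have "K * norm x \<le> K' * norm x" by (intro mult_right_mono) (auto simp: K'_def)
      with K [of n x] show ?thesis by linarith
    qed
    have "0 < e / (3 * K')" using e K'0 by simp
    then obtain p where "dist (s p) l < e / (3 * K')"
      using s(2) unfolding lim_sequentially by blast
    then have p: "K' * norm (l - s p) < e / 3"
      using K'0 by (simp add: dist_norm norm_minus_commute field_simps)
    \<comment> \<open>The bound \<open>K'\<close> is common to all \<open>n\<close>, so one point
      \<open>s p\<close> close to \<open>l\<close> serves for all \<open>n\<close> at once.\<close>
    have small: "norm (f n l - f n (s p)) < e / 3" for n
      using K' [of n "l - s p"] p by (simp add: f)
    have "Cauchy (\<lambda>n. f n (s p))" using s(1) convergent_Cauchy by blast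
    then obtain M where M: "\<And>m n. m \<ge> M \<Longrightarrow> n \<ge> M \<Longrightarrow> dist (f m (s p)) (f n (s p)) < e / 3"
      using e unfolding Cauchy_def by (metis divide_pos_pos zero_less_numeral)
    have "dist (f m l) (f n l) < e" if "m \<ge> M" "n \<ge> M" for m n
    proof -
      have "norm ((f m l - f m (s p) + (f m (s p) - f n (s p))) - (f n l - f n (s p)))
          \<le> norm (f m l - f m (s p)) + norm (f m (s p) - f n (s p)) + norm (f n l - f n (s p))"
        using norm_triangle_ineq4 [of "(f m l - f m (s p)) + (f m (s p) - f n (s p))" "f n l - f n (s p)"]
          norm_triangle_ineq [of "f m l - f m (s p)" "f m (s p) - f n (s p)"] by linarith
      then show ?thesis using small [of m] small [of n] M [OF that] by (simp add: dist_norm)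
    qed
    then show "\<exists>M. \<forall>m\<ge>M. \<forall>n\<ge>M. dist (f m l) (f n l) < e" by blast
  qed
qed

text \<open>Convergence spreads from \<open>G\<close> to all vectors one variable at a time: for
  fixed \<open>y\<close> the set of good \<open>x\<close> is a subspace, closed by the uniform
  bound, and it contains the total set \<open>G\<close>. The limit form obeys the same bound, so it
  comes from an operator.\<close>

lemma weak_limit_operator:
  fixes B :: "nat \<Rightarrow> 'a::chilbert_space \<Rightarrow> 'a \<Rightarrow> complex"
  assumes add1: "\<And>n x x' y. B n (x + x') y = B n x y + B n x' y"
    and add2: "\<And>n x y y'. B n x (y + y') = B n x y + B n x y'"
    and sc1: "\<And>n c x y. B n (c *\<^sub>C x) y = cnj c * B n x y"
    and sc2: "\<And>n c x y. B n x (c *\<^sub>C y) = c * B n x y"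
    and bd: "\<And>n x y. norm (B n x y) \<le> C * norm x * norm y"
    and tot: "\<And>u. (\<And>w. w \<in> G \<Longrightarrow> cinner u w = 0) \<Longrightarrow> u = 0"
    and conv: "\<And>x y. x \<in> G \<Longrightarrow> y \<in> G \<Longrightarrow> convergent (\<lambda>n. B n x y)"
  shows "\<exists>R\<in>bounded_ops. \<forall>x y. (\<lambda>n. B n x y) \<longlonglongrightarrow> cinner x (blinfun_apply R y)"
proof -
  have B_diff1: "B n (x - x') y = B n x y - B n x' y" for n x x' y
    using add1 [of n x "(-1) *\<^sub>C x'" y] sc1 [of n "-1" x' y] by (simp add: scaleC_minus_one)
  have B_diff2: "B n x (y - y') = B n x y - B n x y'" for n x y y'
    using add2 [of n x y "(-1) *\<^sub>C y'"] sc2 [of n x "-1" y'] by (simp add: scaleC_minus_one)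
  have B0: "B n 0 y = 0" "B n x 0 = 0" for n x y
    using B_diff1 [of n 0 0 y] B_diff2 [of n x 0 0] by simp_all
  have conv1: "convergent (\<lambda>n. B n x y)" if y: "y \<in> G" for x y
  proof -
    have "{x. convergent (\<lambda>n. B n x y)} = UNIV"
    proof (rule csubspace_dense)
      show "csubspace {x. convergent (\<lambda>n. B n x y)}"
        by (auto simp: csubspace_def B0 add1 sc1 intro: convergent_add convergent_const convergent_mult)
      show "closed {x. convergent (\<lambda>n. B n x y)}"
      proof (rule closed_convergent [where K = "C * norm y"])
        show "norm (B n x y) \<le> C * norm y * norm x" for n x
          using bd [of n x y] by (simp add: mult_ac)
      qed (rule B_diff1)
    qed (use conv y tot in auto)
    then show ?thesis by auto
  qed
  have conv2: "convergent (\<lambda>n. B n x y)" for x y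
  proof -
    have "{y. convergent (\<lambda>n. B n x y)} = UNIV"
    proof (rule csubspace_dense)
      show "csubspace {y. convergent (\<lambda>n. B n x y)}"
        by (auto simp: csubspace_def B0 add2 sc2 intro: convergent_add convergent_const convergent_mult)
      show "closed {y. convergent (\<lambda>n. B n x y)}"
        by (rule closed_convergent [where K = "C * norm x"]) (simp_all add: B_diff2 bd)
    qed (use conv1 tot in auto)
    then show ?thesis by auto
  qed
  define L where "L x y = lim (\<lambda>n. B n x y)" for x y
  have L: "(\<lambda>n. B n x y) \<longlonglongrightarrow> L x y" for x y
    using conv2 unfolding L_def by (simp add: convergent_LIMSEQ_iff)
  have "\<exists>R\<in>bounded_ops. \<forall>x y. cinner x (blinfun_apply R y) = L x y"
  proof (rule bounded_ops_of_form)
    show "L (x + x') y = L x y + L x' y" for x x' y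
      using tendsto_add [OF L L, of x y x' y] L [of "x + x'" y] by (simp add: add1 LIMSEQ_unique)
    show "L x (y + y') = L x y + L x y'" for x y y'
      using tendsto_add [OF L L, of x y x y'] L [of x "y + y'"] by (simp add: add2 LIMSEQ_unique)
    show "L (c *\<^sub>C x) y = cnj c * L x y" for c x y
      using tendsto_mult_left [OF L, of "cnj c" x y] L [of "c *\<^sub>C x" y] by (simp add: sc1 LIMSEQ_unique)
    show "L x (c *\<^sub>C y) = c * L x y" for c x y
      using tendsto_mult_left [OF L, of c x y] L [of x "c *\<^sub>C y"] by (simp add: sc2 LIMSEQ_unique)
    show "norm (L x y) \<le> C * norm x * norm y" for x y
      by (rule LIMSEQ_le_const2 [OF tendsto_norm [OF L]]) (use bd in blast)
  qed
  then obtain R where "R \<in> bounded_ops" "\<And>x y. cinner x (blinfun_apply R y) = L x y" by blast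
  with L show ?thesis by (intro bexI [of _ R]) simp_all
qed

section \<open>Operator systems\<close>

text \<open>The sesquilinear form on H^k of the operator matrix \<open>X\<close>. Keeping the two
  vectors apart allows polarisation, which recovers the entries of \<open>X\<close> from its
  quadratic form.\<close>

definition mform :: "nat \<Rightarrow> (nat \<Rightarrow> nat \<Rightarrow> 'h::chilbert_space \<Rightarrow>\<^sub>L 'h) \<Rightarrow> (nat \<Rightarrow> 'h) \<Rightarrow> (nat \<Rightarrow> 'h) \<Rightarrow> complex" where
  "mform k X u v = (\<Sum>i<k. \<Sum>j<k. cinner (u i) (blinfun_apply (X i j) (v j)))"

lemma mform_add_left: "mform k X (u + u') v = mform k X u v + mform k X u' v"
  by (simp add: mform_def cinner_add_left sum.distrib)

lemma mform_add_right: "mform k X u (v + v') = mform k X u v + mform k X u v'"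
  by (simp add: mform_def blinfun.add_right cinner_add_right sum.distrib)

lemma mform_scaleC_left: "mform k X (c *\<^sub>C u) v = cnj c * mform k X u v"
  by (simp add: mform_def scaleC_fun_def cinner_scaleC_left sum_distrib_left)

lemma mform_scaleC_right:
  assumes "X \<in> mats k bounded_ops"
  shows "mform k X u (c *\<^sub>C v) = c * mform k X u v"
  using assms
  by (simp add: mform_def scaleC_fun_def cinner_scaleC_right sum_distrib_left mats_def bounded_opsD)

lemma mform_single:
  fixes x y :: "'h::chilbert_space"
  assumes "p < k" "r < k"
  shows "mform k X ((\<lambda>_. 0)(p := x)) ((\<lambda>_. 0)(r := y)) = cinner x (blinfun_apply (X p r) y)"
proof -
  let ?c = "cinner x (blinfun_apply (X p r) y)"
  have "mform k X ((\<lambda>_. 0)(p := x)) ((\<lambda>_. 0)(r := y)) =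
      (\<Sum>i<k. \<Sum>j<k. if j = r then if i = p then ?c else 0 else 0)"
    unfolding mform_def
    by (intro sum.cong refl) (simp add: cinner.zero_left cinner.zero_right blinfun.zero_right)
  with assms show ?thesis by simp
qed

text \<open>Polarisation: realness at \<open>u + v\<close> compares the imaginary parts, realness at
  \<open>u + \<i> *\<^sub>C v\<close> the real parts.\<close>

lemma mform_hermitian_of_real:
  assumes X: "X \<in> mats k bounded_ops" and real: "\<And>h. Im (mform k X h h) = 0"
  shows "mform k X u v = cnj (mform k X v u)"
proof -
  note e = mform_add_left mform_add_right mform_scaleC_left mform_scaleC_right [OF X]
  have 1: "Im (mform k X u v + mform k X v u) = 0"
    using real [of "u + v"] real [of u] real [of v] by (simp add: e)
  have 2: "Re (mform k X u v) = Re (mform k X v u)"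
    using real [of "u + \<i> *\<^sub>C v"] real [of u] real [of v] by (simp add: e)
  from 1 2 show ?thesis by (intro complex_eqI) simp_all
qed

lemma mform_eq_0:
  assumes X: "X \<in> mats k bounded_ops" and zero: "\<And>h. mform k X h h = 0"
  shows "mform k X u v = 0"
proof -
  note e = mform_add_left mform_add_right mform_scaleC_left mform_scaleC_right [OF X]
  have 1: "mform k X u v + mform k X v u = 0"
    using zero [of "u + v"] zero [of u] zero [of v] by (simp add: e add.commute)
  have 2: "\<i> * mform k X u v - \<i> * mform k X v u = 0"
    using zero [of "u + \<i> *\<^sub>C v"] zero [of u] zero [of v] by (simp add: e)
  then have "mform k X u v = mform k X v u" by simp
  with 1 show ?thesis by simp
qed

text \<open>Conditions on real and imaginary parts pass to limits of forms, which is how positivity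
  of the limit map is obtained at the end.\<close>

lemma op_pos_iff:
  "X \<in> pos (op_opsys M) k \<longleftrightarrow>
    X \<in> mats k M \<and> (\<forall>h. Im (mform k X h h) = 0 \<and> 0 \<le> Re (mform k X h h))"
  by (auto simp: op_opsys_def mform_def complex_nonneg_Reals_iff)

lemma op_opsys_simps [simp]:
  "carr (op_opsys M) = M" "star (op_opsys M) = cadjoint" "ounit (op_opsys M) = id_blinfun"
  by (simp_all add: op_opsys_def)

text \<open>A real quadratic form has a Hermitian sesquilinear form by polarisation, and vectors
  supported in one coordinate read off single entries.\<close>

lemma pos_op_hermitian:
  assumes X: "X \<in> pos (op_opsys M) k" and M: "M \<subseteq> bounded_ops" and "i < k" "j < k"
  shows "cinner x (blinfun_apply (X i j) y) = cinner (blinfun_apply (X j i) x) y"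
proof -
  have Xm: "X \<in> mats k bounded_ops" using X M by (auto simp: op_pos_iff mats_def)
  have "mform k X ((\<lambda>_. 0)(i := x)) ((\<lambda>_. 0)(j := y)) = cnj (mform k X ((\<lambda>_. 0)(j := y)) ((\<lambda>_. 0)(i := x)))"
    using X by (intro mform_hermitian_of_real [OF Xm]) (simp add: op_pos_iff)
  then show ?thesis
    using assms(3,4) by (simp add: mform_single cinner_commute [of "blinfun_apply _ _"])
qed

lemma mform_add_matrix: "mform k (X + Y) u v = mform k X u v + mform k Y u v"
  by (simp add: mform_def blinfun.add_left cinner_add_right sum.distrib)

lemma mform_scaleC_matrix: "mform k (c *\<^sub>C X) u v = c * mform k X u v"
  by (simp add: mform_def scaleC_fun_def scaleC_blinfun.rep_eq cinner_scaleC_right sum_distrib_left)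

lemma mform_uminus_matrix: "mform k (- X) u v = - mform k X u v"
  by (simp add: mform_def blinfun.minus_left cinner.minus_right sum_negf)

lemma mform_diag: "mform k (diag_mat k id_blinfun) u u = complex_of_real (\<Sum>i<k. (norm (u i))\<^sup>2)"
proof -
  have "mform k (diag_mat k id_blinfun) u u = (\<Sum>i<k. \<Sum>j<k. if j = i then cinner (u i) (u i) else 0)"
    unfolding mform_def diag_mat_def by (intro sum.cong refl) (auto simp: blinfun.zero_left cinner.zero_right)
  also have "\<dots> = (\<Sum>i<k. cinner (u i) (u i))" by simp
  finally show ?thesis by (simp add: cinner_self)
qed

text \<open>The scalar matrix \<alpha> moves from the operator matrix to the vectors, so positivity
  of compressions needs no further computation.\<close>

lemma mform_compress:
  assumes X: "X \<in> mats k bounded_ops"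
  shows "mform m (compress k m \<alpha> X) u v =
    mform k X (\<lambda>p. \<Sum>i<m. \<alpha> p i *\<^sub>C u i) (\<lambda>r. \<Sum>j<m. \<alpha> r j *\<^sub>C v j)"
proof -
  have Xl: "blinfun_apply (X p r) (c *\<^sub>C y) = c *\<^sub>C blinfun_apply (X p r) y" if "p < k" "r < k" for p r c y
    using X that by (simp add: mats_def bounded_opsD)
  have "mform m (compress k m \<alpha> X) u v =
      (\<Sum>i<m. \<Sum>j<m. \<Sum>p<k. \<Sum>r<k. cnj (\<alpha> p i) * \<alpha> r j * cinner (u i) (blinfun_apply (X p r) (v j)))"
    unfolding mform_def compress_def
    by (intro sum.cong refl)
      (simp add: blinfun.sum_left scaleC_blinfun.rep_eq cinner.sum_right cinner_scaleC_right)
  also have "\<dots> = (\<Sum>i<m. \<Sum>p<k. \<Sum>j<m. \<Sum>r<k. cnj (\<alpha> p i) * \<alpha> r j * cinner (u i) (blinfun_apply (X p r) (v j)))"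
    by (intro sum.cong refl sum.swap)
  also have "\<dots> = (\<Sum>p<k. \<Sum>i<m. \<Sum>j<m. \<Sum>r<k. cnj (\<alpha> p i) * \<alpha> r j * cinner (u i) (blinfun_apply (X p r) (v j)))"
    by (rule sum.swap)
  also have "\<dots> = (\<Sum>p<k. \<Sum>i<m. \<Sum>r<k. \<Sum>j<m. cnj (\<alpha> p i) * \<alpha> r j * cinner (u i) (blinfun_apply (X p r) (v j)))"
    by (intro sum.cong refl sum.swap)
  also have "\<dots> = (\<Sum>p<k. \<Sum>r<k. \<Sum>i<m. \<Sum>j<m. cnj (\<alpha> p i) * \<alpha> r j * cinner (u i) (blinfun_apply (X p r) (v j)))"
    by (intro sum.cong refl sum.swap)
  also have "\<dots> = mform k X (\<lambda>p. \<Sum>i<m. \<alpha> p i *\<^sub>C u i) (\<lambda>r. \<Sum>j<m. \<alpha> r j *\<^sub>C v j)"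
    unfolding mform_def
  proof (intro sum.cong refl)
    fix p r assume "p \<in> {..<k}" "r \<in> {..<k}"
    then have "blinfun_apply (X p r) (\<Sum>j<m. \<alpha> r j *\<^sub>C v j) = (\<Sum>j<m. \<alpha> r j *\<^sub>C blinfun_apply (X p r) (v j))"
      by (simp add: blinfun.sum_right Xl)
    then show "(\<Sum>i<m. \<Sum>j<m. cnj (\<alpha> p i) * \<alpha> r j * cinner (u i) (blinfun_apply (X p r) (v j))) =
        cinner (\<Sum>i<m. \<alpha> p i *\<^sub>C u i) (blinfun_apply (X p r) (\<Sum>j<m. \<alpha> r j *\<^sub>C v j))"
      by (simp add: cinner.sum_left) (simp add: cinner.sum_right cinner_scaleC_left cinner_scaleC_right sum_distrib_left mult_ac)
  qed
  finally show ?thesis .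
qed

lemma mats_bounded_ops_closed:
  "X \<in> mats k bounded_ops \<Longrightarrow> Y \<in> mats k bounded_ops \<Longrightarrow> X + Y \<in> mats k bounded_ops"
  "X \<in> mats k bounded_ops \<Longrightarrow> c *\<^sub>C X \<in> mats k bounded_ops"
  "diag_mat k id_blinfun \<in> mats k bounded_ops"
  by (auto simp: mats_def scaleC_fun_def diag_mat_def csubspace_add [OF csubspace_bounded_ops]
      csubspace_scaleC [OF csubspace_bounded_ops] csubspace_zero [OF csubspace_bounded_ops] id_bounded_ops)

lemma mform_bound:
  fixes u :: "nat \<Rightarrow> 'h::chilbert_space"
  shows "norm (mform k X u u) \<le> (\<Sum>i<k. \<Sum>j<k. norm (X i j)) * (\<Sum>i<k. (norm (u i))\<^sup>2)"
proof -
  have nn: "norm (u i) * norm (u j) \<le> (\<Sum>i<k. (norm (u i))\<^sup>2)" if "i < k" "j < k" for i j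
  proof -
    have a: "(norm (u l))\<^sup>2 \<le> (\<Sum>i<k. (norm (u i))\<^sup>2)" if "l < k" for l
      using that by (intro member_le_sum) auto
    have "0 \<le> (norm (u i) - norm (u j))\<^sup>2" by simp
    then have "2 * (norm (u i) * norm (u j)) \<le> (norm (u i))\<^sup>2 + (norm (u j))\<^sup>2"
      by (simp add: power2_diff)
    with a [OF that(1)] a [OF that(2)] show ?thesis by linarith
  qed
  have "norm (mform k X u u) \<le> (\<Sum>i<k. \<Sum>j<k. norm (cinner (u i) (blinfun_apply (X i j) (u j))))"
    unfolding mform_def by (intro order_trans [OF norm_sum] sum_mono order_trans [OF norm_sum] order_refl)
  also have "\<dots> \<le> (\<Sum>i<k. \<Sum>j<k. norm (X i j) * (\<Sum>i<k. (norm (u i))\<^sup>2))"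
  proof (intro sum_mono)
    fix i j assume "i \<in> {..<k}" "j \<in> {..<k}"
    then have "norm (X i j) * (norm (u i) * norm (u j)) \<le> norm (X i j) * (\<Sum>i<k. (norm (u i))\<^sup>2)"
      by (intro mult_left_mono nn) auto
    then show "norm (cinner (u i) (blinfun_apply (X i j) (u j))) \<le> norm (X i j) * (\<Sum>i<k. (norm (u i))\<^sup>2)"
      using cinner_blinfun_bound [of "u i" "X i j" "u j"] by (simp add: mult.assoc)
  qed
  finally show ?thesis by (simp add: sum_distrib_right)
qed

text \<open>The universal properties accept only operator systems as targets, so the axioms are
  verified for B(H). The order axioms reduce to statements on \<open>mform\<close>; for the order
  unit the entrywise estimate \<open>mform_bound\<close> is enough.\<close>

lemma operator_system_bounded_ops:
  "operator_system (op_opsys (bounded_ops :: ('h::chilbert_space \<Rightarrow>\<^sub>L 'h) set))"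
proof
  note cs = csubspace_bounded_ops [where 'a = 'h, unfolded csubspace_def]
  fix x y :: "'h \<Rightarrow>\<^sub>L 'h" and c :: complex
  assume x: "x \<in> carr (op_opsys bounded_ops)"
  then have xb: "x \<in> bounded_ops" by simp
  show "star (op_opsys bounded_ops) x \<in> carr (op_opsys bounded_ops)"
    using xb by (simp add: cadjoint_bounded_ops)
  show "star (op_opsys bounded_ops) (star (op_opsys bounded_ops) x) = x"
    using xb by (simp, intro cadjoint_eqI) (simp add: cinner_cadjoint')
  show "star (op_opsys bounded_ops) (c *\<^sub>C x) = cnj c *\<^sub>C star (op_opsys bounded_ops) x"
    using xb by (simp, intro cadjoint_eqI)
      (simp add: cinner_cadjoint scaleC_blinfun.rep_eq cinner_scaleC_left cinner_scaleC_right)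
  show "c *\<^sub>C x \<in> carr (op_opsys bounded_ops)"
    using xb cs by simp
  assume "y \<in> carr (op_opsys bounded_ops)"
  then have yb: "y \<in> bounded_ops" by simp
  show "x + y \<in> carr (op_opsys bounded_ops)"
    using xb yb cs by simp
  show "star (op_opsys bounded_ops) (x + y) = star (op_opsys bounded_ops) x + star (op_opsys bounded_ops) y"
    using xb yb by (simp, intro cadjoint_eqI)
      (simp add: cinner_cadjoint blinfun.add_left cinner_add_left cinner_add_right)
next
  note cs = csubspace_bounded_ops [where 'a = 'h, unfolded csubspace_def]
  show "0 \<in> carr (op_opsys (bounded_ops :: ('h \<Rightarrow>\<^sub>L 'h) set))" using cs by simp
  show "ounit (op_opsys (bounded_ops :: ('h \<Rightarrow>\<^sub>L 'h) set)) \<in> carr (op_opsys bounded_ops)"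
    by (simp add: id_bounded_ops)
  show "star (op_opsys (bounded_ops :: ('h \<Rightarrow>\<^sub>L 'h) set)) (ounit (op_opsys bounded_ops)) = ounit (op_opsys bounded_ops)"
    by (simp, intro cadjoint_eqI) simp
next
  fix k
  show "pos (op_opsys (bounded_ops :: ('h \<Rightarrow>\<^sub>L 'h) set)) k \<subseteq> herm_mats (op_opsys bounded_ops) k"
  proof
    fix X :: "nat \<Rightarrow> nat \<Rightarrow> 'h \<Rightarrow>\<^sub>L 'h" assume X: "X \<in> pos (op_opsys bounded_ops) k"
    have "cadjoint (X j i) = X i j" if "i < k" "j < k" for i j
      by (rule cadjoint_eqI) (rule pos_op_hermitian [OF X subset_refl that(2) that(1), symmetric])
    with X show "X \<in> herm_mats (op_opsys bounded_ops) k"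
      by (simp add: herm_mats_def op_pos_iff)
  qed
next
  fix X Y :: "nat \<Rightarrow> nat \<Rightarrow> 'h \<Rightarrow>\<^sub>L 'h" and k
  assume "X \<in> pos (op_opsys bounded_ops) k" "Y \<in> pos (op_opsys bounded_ops) k"
  then show "X + Y \<in> pos (op_opsys bounded_ops) k"
    by (simp add: op_pos_iff mats_bounded_ops_closed mform_add_matrix)
next
  fix X :: "nat \<Rightarrow> nat \<Rightarrow> 'h \<Rightarrow>\<^sub>L 'h" and k and r :: real
  assume "X \<in> pos (op_opsys bounded_ops) k" "0 \<le> r"
  then show "complex_of_real r *\<^sub>C X \<in> pos (op_opsys bounded_ops) k"
    by (simp add: op_pos_iff mats_bounded_ops_closed mform_scaleC_matrix)
next
  fix X :: "nat \<Rightarrow> nat \<Rightarrow> 'h \<Rightarrow>\<^sub>L 'h" and k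
  assume X: "X \<in> pos (op_opsys bounded_ops) k" "- X \<in> pos (op_opsys bounded_ops) k"
  then have Xm: "X \<in> mats k bounded_ops" by (simp add: op_pos_iff)
  have "mform k X h h = 0" for h
    using X by (intro complex_eqI) (simp_all add: op_pos_iff mform_uminus_matrix order_antisym)
  then have z: "mform k X u v = 0" for u v by (rule mform_eq_0 [OF Xm])
  have "X i j = 0" if ij: "i < k" "j < k" for i j
    using z [of "(\<lambda>_. 0)(i := _)" "(\<lambda>_. 0)(j := _)"]
    by (intro bounded_ops_ext) (simp add: mform_single [OF ij] cinner.zero_right blinfun.zero_left)
  moreover have "X i j = 0" if "k \<le> i \<or> k \<le> j" for i j
    using Xm that by (auto simp: mats_def)
  ultimately show "X = 0"
    by (intro ext) (metis not_le zero_fun_def)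
next
  fix X :: "nat \<Rightarrow> nat \<Rightarrow> 'h \<Rightarrow>\<^sub>L 'h" and k m \<alpha>
  assume X: "X \<in> pos (op_opsys bounded_ops) k"
  then have Xm: "X \<in> mats k bounded_ops" by (simp add: op_pos_iff)
  have "compress k m \<alpha> X \<in> mats m bounded_ops"
    using Xm by (auto simp: mats_def compress_def
        intro!: csubspace_sum csubspace_scaleC csubspace_bounded_ops)
  then show "compress k m \<alpha> X \<in> pos (op_opsys bounded_ops) m"
    using X by (simp add: op_pos_iff mform_compress [OF Xm])
next
  fix X :: "nat \<Rightarrow> nat \<Rightarrow> 'h \<Rightarrow>\<^sub>L 'h" and k
  assume X: "X \<in> herm_mats (op_opsys bounded_ops) k"
  then have Xm: "X \<in> mats k bounded_ops" by (simp add: herm_mats_def)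
  have im: "Im (mform k X u u) = 0" for u
  proof -
    have c: "cinner x (blinfun_apply (X i j) y) = cnj (cinner y (blinfun_apply (X j i) x))" if "i < k" "j < k" for i j x y
    proof -
      have "X j i \<in> bounded_ops" "cadjoint (X j i) = X i j"
        using X that by (auto simp: herm_mats_def mats_def)
      then show ?thesis by (metis cinner_cadjoint' cinner_commute)
    qed
    have "mform k X u u = (\<Sum>i<k. \<Sum>j<k. cnj (cinner (u j) (blinfun_apply (X j i) (u i))))"
      unfolding mform_def by (intro sum.cong refl) (simp add: c [symmetric])
    also have "\<dots> = (\<Sum>j<k. \<Sum>i<k. cnj (cinner (u j) (blinfun_apply (X j i) (u i))))"
      by (rule sum.swap)
    finally have "mform k X u u = cnj (mform k X u u)" by (simp add: mform_def)
    from arg_cong [OF this, of Im] show ?thesis by simp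
  qed
  \<comment> \<open>The sum of the norms of the entries dominates the form; below,
    \<open>s + 1\<close> is taken so that the constant is positive also when
    \<open>s = 0\<close>.\<close>
  define s where "s = (\<Sum>i<k. \<Sum>j<k. norm (X i j))"
  have s: "0 \<le> s" by (auto simp: s_def intro!: sum_nonneg)
  have shifted: "complex_of_real r *\<^sub>C diag_mat k (ounit (op_opsys bounded_ops)) + X \<in> mats k bounded_ops" for r
    by (auto intro!: mats_bounded_ops_closed Xm)
  have form: "mform k (complex_of_real r *\<^sub>C diag_mat k (ounit (op_opsys bounded_ops)) + X) u u
      = complex_of_real (r * (\<Sum>i<k. (norm (u i))\<^sup>2)) + mform k X u u" for r u
    by (simp add: mform_add_matrix mform_scaleC_matrix mform_diag)
  show "\<exists>r>0. complex_of_real r *\<^sub>C diag_mat k (ounit (op_opsys bounded_ops)) + X \<in> pos (op_opsys bounded_ops) k"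
  proof (intro exI [of _ "s + 1"] conjI)
    have "0 \<le> (s + 1) * (\<Sum>i<k. (norm (u i))\<^sup>2) + Re (mform k X u u)" for u
    proof -
      have "- Re (mform k X u u) \<le> s * (\<Sum>i<k. (norm (u i))\<^sup>2)"
        using mform_bound [of k X u] abs_Re_le_cmod [of "mform k X u u"] by (simp add: s_def)
      moreover have "0 \<le> (\<Sum>i<k. (norm (u i))\<^sup>2)" by (simp add: sum_nonneg)
      ultimately show ?thesis by (simp add: distrib_right)
    qed
    then show "complex_of_real (s + 1) *\<^sub>C diag_mat k (ounit (op_opsys bounded_ops)) + X \<in> pos (op_opsys bounded_ops) k"
      unfolding op_pos_iff by (intro conjI allI shifted) (simp_all only: form, simp_all add: im)
  qed (use s in simp)
  assume arch: "\<And>r. 0 < r \<Longrightarrow> complex_of_real r *\<^sub>C diag_mat k (ounit (op_opsys bounded_ops)) + X \<in> pos (op_opsys bounded_ops) k"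
  have "0 \<le> Re (mform k X u u)" for u
  proof (rule ccontr)
    assume neg: "\<not> 0 \<le> Re (mform k X u u)"
    define n where "n = (\<Sum>i<k. (norm (u i))\<^sup>2)"
    have n: "0 \<le> n" by (simp add: n_def sum_nonneg)
    have ge: "0 \<le> r * n + Re (mform k X u u)" if "0 < r" for r
      using arch [OF that] unfolding op_pos_iff form by (simp add: n_def)
    \<comment> \<open>Chosen so that \<open>r * (n + 1)\<close> is half of the supposed deficit; the
      1 avoids a zero denominator.\<close>
    define r where "r = - Re (mform k X u u) / (2 * (n + 1))"
    have r: "0 < r" using neg n by (simp add: r_def divide_neg_pos)
    have "r * n \<le> r * (n + 1)" using r by simp
    also have "\<dots> = - Re (mform k X u u) / 2" using n by (simp add: r_def field_simps)
    finally show False using ge [OF r] neg by linarith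
  qed
  then show "X \<in> pos (op_opsys bounded_ops) k"
    by (simp add: op_pos_iff Xm im)
qed

text \<open>If \<open>\<bar>f\<bar> \<le> r\<close>, then the matrix with rows \<open>(r, f)\<close> and \<open>(cnj f, r)\<close> is positive, and so is its image.\<close>

lemma is_ucp_norm_bound:
  fixes M :: "('h::chilbert_space \<Rightarrow>\<^sub>L 'h) set"
  assumes \<phi>: "is_ucp (fun_opsys \<Omega> F) (op_opsys M) \<phi>" and M: "M \<subseteq> bounded_ops"
    and F: "csubspace F" "indicator \<Omega> \<in> F"
    and f: "f \<in> F" "(\<lambda>\<omega>. cnj (f \<omega>)) \<in> F" and r: "0 \<le> r" "\<And>\<omega>. \<omega> \<in> \<Omega> \<Longrightarrow> norm (f \<omega>) \<le> r"
  shows "norm (\<phi> f) \<le> r"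
proof -
  define I where "I = complex_of_real r *\<^sub>C (indicator \<Omega> :: _ \<Rightarrow> complex)"
  define X where "X = (\<lambda>(i :: nat) (j :: nat). if i = 0 \<and> j = 0 \<or> i = 1 \<and> j = 1 then I else if i = 0 \<and> j = 1 then f
      else if i = 1 \<and> j = 0 then (\<lambda>\<omega>. cnj (f \<omega>)) else 0)"
  have sum2: "(\<Sum>i<2. g i) = g 0 + g 1" for g :: "nat \<Rightarrow> complex"
    by (simp add: numeral_2_eq_2)
  have IF: "I \<in> F" using F by (simp add: csubspace_def I_def)
  have "X \<in> pos (fun_opsys \<Omega> F) 2"
  proof -
    have m: "X \<in> mats 2 F" using IF f by (auto simp: mats_def X_def less_2_cases_iff)
    have "(\<Sum>i<2. \<Sum>j<2. cnj (c i) * X i j \<omega> * c j) \<in> \<real>\<^sub>\<ge>\<^sub>0" if \<omega>: "\<omega> \<in> \<Omega>" for \<omega> and c :: "nat \<Rightarrow> complex"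
    proof -
      define z where "z = cnj (c 0) * f \<omega> * c 1"
      have "(\<Sum>i<2. \<Sum>j<2. cnj (c i) * X i j \<omega> * c j) =
          complex_of_real r * (c 0 * cnj (c 0)) + complex_of_real r * (c 1 * cnj (c 1)) + (z + cnj z)"
        using \<omega> by (simp add: sum2 X_def I_def scaleC_fun_def scaleC_complex_def z_def algebra_simps)
      also have "\<dots> = complex_of_real (r * (norm (c 0))\<^sup>2 + r * (norm (c 1))\<^sup>2 + 2 * Re z)"
        by (simp add: complex_add_cnj complex_norm_square [symmetric])
      finally have eq: "(\<Sum>i<2. \<Sum>j<2. cnj (c i) * X i j \<omega> * c j) = \<dots>" .
      have "- Re z \<le> norm z" using abs_Re_le_cmod [of z] by linarith
      also have "norm z \<le> r * (norm (c 0) * norm (c 1))"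
        using mult_right_mono [OF r(2) [OF \<omega>], of "norm (c 0) * norm (c 1)"]
        by (simp add: z_def norm_mult mult_ac)
      finally have "- Re z \<le> r * (norm (c 0) * norm (c 1))" .
      moreover have "0 \<le> r * (norm (c 0) - norm (c 1))\<^sup>2" using r by simp
      ultimately have "0 \<le> r * (norm (c 0))\<^sup>2 + r * (norm (c 1))\<^sup>2 + 2 * Re z"
        by (simp add: power2_diff algebra_simps)
      then show ?thesis unfolding eq by (simp add: complex_nonneg_Reals_iff)
    qed
    with m show ?thesis by (simp add: fun_opsys_def)
  qed
  then have pos: "(\<lambda>i j. \<phi> (X i j)) \<in> pos (op_opsys M) 2" (is "?Y \<in> _")
    using \<phi> by (simp add: is_ucp_def)
  have \<phi>I: "\<phi> I = complex_of_real r *\<^sub>C id_blinfun"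
    using \<phi> F by (simp add: is_ucp_def fun_opsys_def I_def)
  \<comment> \<open>Preservation of adjoints is not a clause of \<open>is_ucp\<close>; it is read
    off the off-diagonal entries of the positive image.\<close>
  have adj: "cinner h (blinfun_apply (\<phi> f) k) = cinner (blinfun_apply (\<phi> (\<lambda>\<omega>. cnj (f \<omega>))) h) k" for h k
    using pos_op_hermitian [OF pos M, of 0 1 h k] by (simp add: X_def)
  have key: "0 \<le> r * (norm h)\<^sup>2 + r * (norm k)\<^sup>2 + 2 * Re (cinner h (blinfun_apply (\<phi> f) k))" for h k
  proof -
    have "0 \<le> Re (mform 2 ?Y (\<lambda>i. if i = 0 then h else k) (\<lambda>i. if i = 0 then h else k))"
      using pos by (simp add: op_pos_iff)
    also have "mform 2 ?Y (\<lambda>i. if i = 0 then h else k) (\<lambda>i. if i = 0 then h else k) =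
        complex_of_real r * cinner h h + complex_of_real r * cinner k k + cinner h (blinfun_apply (\<phi> f) k)
          + cnj (cinner h (blinfun_apply (\<phi> f) k))"
      by (simp add: mform_def sum2 X_def \<phi>I scaleC_blinfun.rep_eq cinner_scaleC_right adj
          cinner_commute [of k "blinfun_apply (\<phi> (\<lambda>\<omega>. cnj (f \<omega>))) h"])
    finally show ?thesis by (simp add: cinner_self)
  qed
  show ?thesis
  proof (rule norm_blinfun_bound [OF r(1)])
    fix k
    let ?T = "blinfun_apply (\<phi> f) k"
    \<comment> \<open>Evaluate \<open>key\<close> at \<open>h\<close> equal to \<open>- s\<close>
      times \<open>?T\<close>. The result is a quadratic in \<open>s\<close>, used at
      \<open>s = 1\<close> if \<open>r = 0\<close> and at its minimum \<open>s = 1 / r\<close>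
      otherwise.\<close>
    have s: "0 \<le> r * (s\<^sup>2 * (norm ?T)\<^sup>2) + r * (norm k)\<^sup>2 - 2 * s * (norm ?T)\<^sup>2" for s
    proof -
      have "Re (cinner (complex_of_real (- s) *\<^sub>C ?T) ?T) = - s * (norm ?T)\<^sup>2"
        by (simp only: cinner_scaleC_left cinner_self) simp
      then show ?thesis
        using key [of "complex_of_real (- s) *\<^sub>C ?T" k] by (simp add: norm_scaleC power_mult_distrib)
    qed
    show "norm ?T \<le> r * norm k"
    proof (cases "r = 0")
      case True
      then show ?thesis using s [of 1] by simp
    next
      case False
      then have "r > 0" using r by simp
      have "(norm ?T)\<^sup>2 \<le> (r * norm k)\<^sup>2"
        using s [of "1 / r"] \<open>r > 0\<close> by (simp add: field_simps power2_eq_square)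
      then show ?thesis using r by (intro power2_le_imp_le [of "norm ?T"]) auto
    qed
  qed
qed

section \<open>Generalities on unital completely positive maps\<close>

lemma is_ucp_carr: "is_ucp R S \<phi> \<Longrightarrow> x \<in> carr R \<Longrightarrow> \<phi> x \<in> carr S"
  by (auto simp: is_ucp_def)

lemma is_ucp_comp: "is_ucp R S \<phi> \<Longrightarrow> is_ucp S T \<psi> \<Longrightarrow> is_ucp R T (\<lambda>x. \<psi> (\<phi> x))"
  by (fastforce simp: is_ucp_def image_subset_iff)

lemma (in operator_system) pos_entry: "X \<in> pos R k \<Longrightarrow> X i j \<in> carr R"
proof -
  assume "X \<in> pos R k"
  then have "X \<in> mats k (carr R)" using pos_herm [of k] by (auto simp: herm_mats_def)
  then show "X i j \<in> carr R"
    using carr_zero by (cases "i < k \<and> j < k") (auto simp: mats_def not_less)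
qed

text \<open>Entries of positive matrices lie in the carrier, also outside the block where they are
  \<open>0\<close>, so only values on the carrier matter. This permits passing to
  \<open>restrict\<close>.\<close>

lemma (in operator_system) is_ucp_cong:
  assumes "\<And>x. x \<in> carr R \<Longrightarrow> \<phi> x = \<psi> x"
  shows "is_ucp R S \<phi> = is_ucp R S \<psi>"
proof -
  have "(\<lambda>i j. \<phi> (X i j)) = (\<lambda>i j. \<psi> (X i j))" if "X \<in> pos R k" for X k
    using assms pos_entry [OF that] by auto
  then show ?thesis
    using assms by (simp add: is_ucp_def image_subset_iff carr_add carr_scaleC unit_carr)
qed

lemma is_ucp_add: "is_ucp R S \<phi> \<Longrightarrow> x \<in> carr R \<Longrightarrow> y \<in> carr R \<Longrightarrow> \<phi> (x + y) = \<phi> x + \<phi> y"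
  and is_ucp_scaleC: "is_ucp R S \<phi> \<Longrightarrow> x \<in> carr R \<Longrightarrow> \<phi> (c *\<^sub>C x) = c *\<^sub>C \<phi> x"
  and is_ucp_unit: "is_ucp R S \<phi> \<Longrightarrow> \<phi> (ounit R) = ounit S"
  and is_ucp_pos: "is_ucp R S \<phi> \<Longrightarrow> X \<in> pos R k \<Longrightarrow> (\<lambda>i j. \<phi> (X i j)) \<in> pos S k"
  by (auto simp: is_ucp_def)

lemma is_ucp_zero: "is_ucp R S \<phi> \<Longrightarrow> csubspace (carr R) \<Longrightarrow> \<phi> 0 = 0"
  using is_ucp_scaleC [of R S \<phi> 0 0] by (simp add: csubspace_zero)

lemma is_ucp_sum:
  assumes \<phi>: "is_ucp R S \<phi>" and R: "csubspace (carr R)" and f: "\<And>i. i \<in> I \<Longrightarrow> f i \<in> carr R"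
  shows "\<phi> (\<Sum>i\<in>I. f i) = (\<Sum>i\<in>I. \<phi> (f i))"
  using f
proof (induction I rule: infinite_finite_induct)
  case (insert i I)
  then show ?case using csubspace_sum [OF R, of I f] by (simp add: is_ucp_add [OF \<phi>])
qed (simp_all add: is_ucp_zero [OF \<phi> R])

lemma (in operator_system) csubspace_carr: "csubspace (carr R)"
  using carr_zero carr_add carr_scaleC by (simp add: csubspace_def)

section \<open>Copies of operator systems along linear embeddings\<close>

definition transport :: "('w \<Rightarrow> 'v) \<Rightarrow> 'w opsys \<Rightarrow> 'v opsys" where
  "transport j R =
    \<lparr>carr = j ` carr R, star = (\<lambda>v. j (star R (inv j v))), ounit = j (ounit R),
     pos = (\<lambda>k. (\<lambda>X i l. j (X i l)) ` pos R k)\<rparr>"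

text \<open>Universal properties quantify over operator systems in one fixed type, while the bounded
  operators live in another. \<open>transport j R\<close> is the copy of \<open>R\<close> on the
  range of \<open>j\<close>; its star leads back through \<open>inv j\<close>, which is meaningful
  on that range.\<close>

locale linear_embedding =
  fixes j :: "'w::complex_vector \<Rightarrow> 'v::complex_vector"
  assumes inj: "inj j" and add: "j (x + y) = j x + j y" and scale: "j (c *\<^sub>C x) = c *\<^sub>C j x"
begin

lemma zero: "j 0 = 0"
  using add [of 0 0] by simp

lemma sum: "j (\<Sum>i\<in>I. f i) = (\<Sum>i\<in>I. j (f i))"
  by (induction I rule: infinite_finite_induct) (simp_all add: zero add)

lemma uminus: "j (- x) = - j x"
  using scale [of "-1" x] by (simp add: scaleC_minus_one)

lemma inv_apply [simp]: "inv j (j x) = x"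
  by (simp add: inj)

lemma transport_compress: "compress k m \<alpha> (\<lambda>i l. j (X i l)) = (\<lambda>i l. j (compress k m \<alpha> X i l))"
  by (intro ext) (simp add: compress_def sum scale zero)

text \<open>The axioms \<open>order_unit\<close> and \<open>archimedean\<close> quantify over
  Hermitian matrices, so each such matrix over the copy must be pulled back to one over
  \<open>R\<close>. Entries outside the block cause no trouble, as \<open>0\<close> is in the range
  of \<open>j\<close>.\<close>

lemma herm_transport: "herm_mats (transport j R) k = (\<lambda>X i l. j (X i l)) ` herm_mats R k"
proof (intro equalityI subsetI)
  fix Y assume Y: "Y \<in> herm_mats (transport j R) k"
  define X where "X i l = inv j (Y i l)" for i l
  have ex: "\<exists>x. Y i l = j x \<and> (i < k \<and> l < k \<longrightarrow> x \<in> carr R)" for i l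
  proof (cases "i < k \<and> l < k")
    case True
    then have "Y i l \<in> j ` carr R" using Y by (simp add: herm_mats_def mats_def transport_def)
    then show ?thesis by auto
  next
    case False
    then have "Y i l = 0" using Y by (auto simp: herm_mats_def mats_def not_less)
    with False zero show ?thesis by metis
  qed
  have jX: "j (X i l) = Y i l" for i l using ex [of i l] by (auto simp: X_def)
  have Xc: "X i l \<in> carr R" if "i < k" "l < k" for i l
    using ex [of i l] that by (auto simp: X_def)
  have X0: "X i l = 0" if "k \<le> i \<or> k \<le> l" for i l
    using Y that inv_apply [of 0] by (auto simp: X_def herm_mats_def mats_def zero)
  have "star R (X l i) = X i l" if "i < k" "l < k" for i l
  proof -
    have "j (star R (inv j (Y l i))) = Y i l"
      using Y that by (simp add: herm_mats_def transport_def)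
    then show ?thesis by (metis X_def inv_apply)
  qed
  with Xc X0 have "X \<in> herm_mats R k" by (auto simp: herm_mats_def mats_def)
  moreover have "Y = (\<lambda>i l. j (X i l))" by (simp add: jX)
  ultimately show "Y \<in> (\<lambda>X i l. j (X i l)) ` herm_mats R k" by blast
qed (auto simp: herm_mats_def mats_def transport_def zero)

lemma matrix_inj: "(\<lambda>i l. j (X i l)) = (\<lambda>i l. j (Y i l)) \<longleftrightarrow> X = Y"
  by (auto simp: fun_eq_iff inj_eq [OF inj])

lemma operator_system_transport:
  assumes "operator_system R"
  shows "operator_system (transport j R)"
proof -
  interpret operator_system R by fact
  have tc [simp]: "carr (transport j R) = j ` carr R" "ounit (transport j R) = j (ounit R)"
    "star (transport j R) (j x) = j (star R x)" "pos (transport j R) k = (\<lambda>X i l. j (X i l)) ` pos R k" for x k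
    by (simp_all add: transport_def)
  have shift: "complex_of_real r *\<^sub>C diag_mat k (j (ounit R)) + (\<lambda>i l. j (X i l)) =
      (\<lambda>i l. j ((complex_of_real r *\<^sub>C diag_mat k (ounit R) + X) i l))" for r k X
    by (intro ext) (simp add: scaleC_fun_def diag_mat_def add scale zero)
  show ?thesis
  proof
    show "0 \<in> carr (transport j R)"
      using carr_zero zero by (metis image_eqI tc(1))
    fix x y assume "x \<in> carr (transport j R)"
    then obtain x' where x: "x = j x'" "x' \<in> carr R" by auto
    show "c *\<^sub>C x \<in> carr (transport j R)" for c
      by (simp add: x scale [symmetric] carr_scaleC)
    show "star (transport j R) x \<in> carr (transport j R)"
      by (simp add: x star_carr)
    show "star (transport j R) (star (transport j R) x) = x"
      by (simp add: x star_star)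
    show "star (transport j R) (c *\<^sub>C x) = cnj c *\<^sub>C star (transport j R) x" for c
      by (simp add: x star_scaleC scale [symmetric])
    assume "y \<in> carr (transport j R)"
    then obtain y' where y: "y = j y'" "y' \<in> carr R" by auto
    show "x + y \<in> carr (transport j R)"
      by (simp add: x y add [symmetric] carr_add)
    show "star (transport j R) (x + y) = star (transport j R) x + star (transport j R) y"
      by (simp add: x y star_add add [symmetric])
  next
    show "ounit (transport j R) \<in> carr (transport j R)" by (simp add: unit_carr)
    show "star (transport j R) (ounit (transport j R)) = ounit (transport j R)"
      by (simp add: star_unit)
    show "pos (transport j R) k \<subseteq> herm_mats (transport j R) k" for k
      using pos_herm by (auto simp: herm_transport)
  next
    fix X Y k assume "X \<in> pos (transport j R) k"
    then obtain X' where X: "X = (\<lambda>i l. j (X' i l))" "X' \<in> pos R k" by auto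
    show "complex_of_real r *\<^sub>C X \<in> pos (transport j R) k" if "0 \<le> r" for r
    proof -
      have "complex_of_real r *\<^sub>C X = (\<lambda>i l. j ((complex_of_real r *\<^sub>C X') i l))"
        by (intro ext) (simp add: X scaleC_fun_def scale)
      then show ?thesis using pos_scale [OF X(2) that] by auto
    qed
    show "compress k m \<alpha> X \<in> pos (transport j R) m" for m \<alpha>
      using pos_compress [OF X(2)] by (auto simp: X transport_compress)
    show "X = 0" if mX: "- X \<in> pos (transport j R) k"
    proof -
      obtain Z where Z: "- X = (\<lambda>i l. j (Z i l))" "Z \<in> pos R k" using mX by auto
      have "(\<lambda>i l. j (Z i l)) = (\<lambda>i l. j ((- X') i l))"
        by (simp add: Z(1) [symmetric]) (simp add: X fun_eq_iff uminus)
      then have "Z = - X'" by (simp only: matrix_inj)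
      then have "X' = 0" using pos_proper [OF X(2)] Z(2) by simp
      then show ?thesis by (simp add: X zero zero_fun_def)
    qed
    assume "Y \<in> pos (transport j R) k"
    then obtain Y' where Y: "Y = (\<lambda>i l. j (Y' i l))" "Y' \<in> pos R k" by auto
    have "X + Y = (\<lambda>i l. j ((X' + Y') i l))"
      by (intro ext) (simp add: X Y add)
    then show "X + Y \<in> pos (transport j R) k"
      using pos_add [OF X(2) Y(2)] unfolding tc by (rule image_eqI)
  next
    fix X k assume "X \<in> herm_mats (transport j R) k"
    then obtain X' where X: "X = (\<lambda>i l. j (X' i l))" "X' \<in> herm_mats R k" by (auto simp: herm_transport)
    \<comment> \<open>\<open>j\<close> is injective on matrices, so the shifted matrix is positive
      in the copy exactly if its preimage is positive in \<open>R\<close>; both order unit axioms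
      become literal translations.\<close>
    have sh: "complex_of_real r *\<^sub>C diag_mat k (ounit (transport j R)) + X \<in> pos (transport j R) k \<longleftrightarrow>
        complex_of_real r *\<^sub>C diag_mat k (ounit R) + X' \<in> pos R k" for r
      by (simp only: tc X(1) shift) (simp only: image_iff matrix_inj, blast)
    show "\<exists>r>0. complex_of_real r *\<^sub>C diag_mat k (ounit (transport j R)) + X \<in> pos (transport j R) k"
      unfolding sh by (rule order_unit [OF X(2)])
    assume "\<And>r. 0 < r \<Longrightarrow> complex_of_real r *\<^sub>C diag_mat k (ounit (transport j R)) + X \<in> pos (transport j R) k"
    then have "X' \<in> pos R k" unfolding sh by (rule archimedean [OF X(2)])
    then show "X \<in> pos (transport j R) k" by (simp add: X(1) image_iff) blast
  qed
qed

lemma is_ucp_into_transport: "is_ucp C (transport j R) (\<lambda>x. j (\<phi> x)) \<longleftrightarrow> is_ucp C R \<phi>"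
proof -
  have "(\<lambda>i l. j (\<phi> (X i l))) \<in> (\<lambda>X i l. j (X i l)) ` P \<longleftrightarrow> (\<lambda>i l. \<phi> (X i l)) \<in> P" for X and P :: "(nat \<Rightarrow> nat \<Rightarrow> 'w) set"
    using matrix_inj [of "\<lambda>i l. \<phi> (X i l)"] by (auto simp: image_iff)
  then show ?thesis
    by (simp add: is_ucp_def transport_def image_subset_iff image_iff inj_eq [OF inj]
        add [symmetric] scale [symmetric])
qed

text \<open>On \<open>carr C\<close> the values lie in the range of \<open>j\<close>, so they can be
  read back through \<open>inv j\<close>; \<open>restrict\<close> restores extensionality.\<close>

lemma UCP_transportE:
  assumes "operator_system C" "\<psi> \<in> UCP C (transport j R)"
  obtains \<phi> where "\<phi> \<in> UCP C R" "\<And>x. x \<in> carr C \<Longrightarrow> \<psi> x = j (\<phi> x)"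
proof -
  interpret operator_system C by fact
  have u: "is_ucp C (transport j R) \<psi>" using assms by (simp add: UCP_def)
  define \<phi> where "\<phi> = restrict (\<lambda>x. inv j (\<psi> x)) (carr C)"
  have *: "\<psi> x = j (\<phi> x)" if "x \<in> carr C" for x
  proof -
    have "\<psi> x \<in> j ` carr R" using u that by (auto simp: is_ucp_def transport_def)
    then show ?thesis using that by (auto simp: \<phi>_def)
  qed
  have "is_ucp C R \<phi>"
    using u is_ucp_cong [OF *] by (simp add: is_ucp_into_transport)
  with * show ?thesis by (intro that [of \<phi>]) (auto simp: UCP_def \<phi>_def)
qed

text \<open>The common core of both universal properties: maps on \<open>C\<close> are prescribed at
  the points \<open>p i\<close>. For a coproduct \<open>i\<close> is a pair of an index and a
  diagonal matrix, for an inductive limit a pair of a level and an element there. Existence and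
  uniqueness for the copy are carried back to \<open>R\<close>.\<close>

lemma
  assumes C: "operator_system C" and p: "\<And>i. i \<in> I \<Longrightarrow> p i \<in> carr C"
    and ex1: "\<exists>!\<theta>. \<theta> \<in> UCP C (transport j R) \<and> (\<forall>i\<in>I. \<theta> (p i) = j (f i))"
  shows universal_lift: "\<exists>\<psi>\<in>UCP C R. \<forall>i\<in>I. \<psi> (p i) = f i"
    and universal_unique: "\<lbrakk>is_ucp C R \<psi>; is_ucp C R \<psi>'; \<And>i. i \<in> I \<Longrightarrow> \<psi> (p i) = f i;
      \<And>i. i \<in> I \<Longrightarrow> \<psi>' (p i) = f i; x \<in> carr C\<rbrakk> \<Longrightarrow> \<psi> x = \<psi>' x"
proof -
  obtain \<theta> where \<theta>: "\<theta> \<in> UCP C (transport j R)" "\<And>i. i \<in> I \<Longrightarrow> \<theta> (p i) = j (f i)"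
    using ex1 by blast
  obtain \<phi> where \<phi>: "\<phi> \<in> UCP C R" "\<And>x. x \<in> carr C \<Longrightarrow> \<theta> x = j (\<phi> x)"
    using UCP_transportE [OF C \<theta>(1)] by blast
  have "\<phi> (p i) = f i" if "i \<in> I" for i
    using \<theta>(2) [OF that] \<phi>(2) [OF p [OF that]] by (simp add: inj_eq [OF inj])
  then show "\<exists>\<psi>\<in>UCP C R. \<forall>i\<in>I. \<psi> (p i) = f i" using \<phi>(1) by blast
  assume \<psi>: "is_ucp C R \<psi>" "is_ucp C R \<psi>'"
    and eq: "\<And>i. i \<in> I \<Longrightarrow> \<psi> (p i) = f i" "\<And>i. i \<in> I \<Longrightarrow> \<psi>' (p i) = f i" and x: "x \<in> carr C"
  let ?r = "\<lambda>\<psi>. restrict (\<lambda>x. j (\<psi> x)) (carr C)"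
  have U: "?r \<psi> \<in> UCP C (transport j R)" if "is_ucp C R \<psi>" for \<psi>
  proof -
    have "is_ucp C (transport j R) (?r \<psi>)"
      using that by (subst operator_system.is_ucp_cong [OF C, of _ "\<lambda>x. j (\<psi> x)"])
        (auto simp: is_ucp_into_transport)
    then show ?thesis by (simp add: UCP_def)
  qed
  have "?r \<psi> = ?r \<psi>'"
  proof (rule ex1E [OF ex1])
    fix \<theta> assume u: "\<forall>y. y \<in> UCP C (transport j R) \<and> (\<forall>i\<in>I. y (p i) = j (f i)) \<longrightarrow> y = \<theta>"
    have "?r \<psi> = \<theta>" "?r \<psi>' = \<theta>"
      by (rule u [THEN spec, THEN mp], use U [OF \<psi>(1)] U [OF \<psi>(2)] in \<open>simp add: p eq\<close>)+
    then show ?thesis by simp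
  qed
  then have "?r \<psi> x = ?r \<psi>' x" by simp
  then show "\<psi> x = \<psi>' x" using x by (simp add: inj_eq [OF inj])
qed

end

text \<open>An operator is determined by its matrix entries between members of a dense sequence,
  since the inner product is continuous; pairs of indices are coded by \<open>prod_decode\<close>.
  The entries depend linearly on the operator, so they form a linear injection into the complex
  sequences.\<close>

lemma bounded_ops_embedding:
  assumes sep: "separable_space (euclidean :: 'h::chilbert_space topology)"
    and univ: "large_universe TYPE('v::complex_vector)"
  shows "\<exists>j :: ('h \<Rightarrow>\<^sub>L 'h) \<Rightarrow> 'v. linear_embedding j"
proof -
  obtain D :: "'h set" where D: "countable D" "closure D = UNIV"
    using sep by (auto simp: separable_space_def)
  have ne: "D \<noteq> {}" using D by auto
  obtain emb :: "(nat \<Rightarrow> complex) \<Rightarrow> 'v" where emb: "inj emb"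
      "\<And>f g. emb (f + g) = emb f + emb g" "\<And>c f. emb (c *\<^sub>C f) = c *\<^sub>C emb f"
    using univ by (auto simp: large_universe_def)
  define d where "d = from_nat_into D"
  have d: "range d = D" unfolding d_def by (rule range_from_nat_into [OF ne D(1)])
  define c :: "('h \<Rightarrow>\<^sub>L 'h) \<Rightarrow> nat \<Rightarrow> complex" where
    "c T n = cinner (d (fst (prod_decode n))) (blinfun_apply T (d (snd (prod_decode n))))" for T n
  have "inj c"
  proof (rule injI)
    fix S T assume "c S = c T"
    then have eq: "cinner (d m) (blinfun_apply S (d n)) = cinner (d m) (blinfun_apply T (d n))" for m n
      by (metis c_def fst_conv prod_encode_inverse snd_conv)
    have all: "{x. p x = r x} = UNIV" if "\<And>n. p (d n) = r (d n)" "continuous_on UNIV p" "continuous_on UNIV r"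
      for p r :: "'h \<Rightarrow> complex"
    proof -
      have "closure D \<subseteq> {x. p x = r x}"
        by (rule closure_minimal) (use d that in \<open>auto intro!: closed_Collect_eq\<close>)
      then show ?thesis using D by auto
    qed
    have cont: "continuous_on UNIV (\<lambda>y. cinner x (blinfun_apply W y))"
      "continuous_on UNIV (\<lambda>x. cinner x y)" for x y and W :: "'h \<Rightarrow>\<^sub>L 'h"
      by (intro cinner.continuous_on bounded_linear.continuous_on [OF blinfun.bounded_linear_right] continuous_intros)+
    have 1: "cinner (d m) (blinfun_apply S y) = cinner (d m) (blinfun_apply T y)" for m y
      using all [of "\<lambda>y. cinner (d m) (blinfun_apply S y)" "\<lambda>y. cinner (d m) (blinfun_apply T y)", OF eq cont(1) cont(1)]
      by auto
    have "cinner x (blinfun_apply S y) = cinner x (blinfun_apply T y)" for x y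
      using all [of "\<lambda>x. cinner x (blinfun_apply S y)" "\<lambda>x. cinner x (blinfun_apply T y)", OF 1 cont(2) cont(2)]
      by auto
    then show "S = T" by (rule bounded_ops_ext)
  qed
  moreover have "c (S + T) = c S + c T" for S T
    by (simp add: c_def fun_eq_iff blinfun.add_left cinner_add_right)
  moreover have "c (a *\<^sub>C S) = a *\<^sub>C c S" for a S
    by (simp add: c_def fun_eq_iff scaleC_fun_def scaleC_complex_def scaleC_blinfun.rep_eq cinner_scaleC_right)
  ultimately have "linear_embedding (emb \<circ> c)"
    by unfold_locales (simp_all add: emb inj_compose)
  then show ?thesis by blast
qed

section \<open>Universal properties with targets outside the universe\<close>

lemma coproduct_inclusion_ucp:
  "is_coproduct TYPE('v::complex_vector) S U C \<iota> \<Longrightarrow> s \<in> S \<Longrightarrow> is_ucp (diag_opsys U) C (\<iota> s)"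
  by (simp add: is_coproduct_def is_unital_complete_order_embedding_def)

context
  fixes j :: "'w::complex_vector \<Rightarrow> 'v::complex_vector" and R :: "'w opsys"
  assumes j: "linear_embedding j" and R: "operator_system R"
begin

interpretation linear_embedding j by (rule j)

lemma
  assumes cop: "is_coproduct TYPE('v) S U C \<iota>"
  shows coproduct_universal: "(\<And>s. s \<in> S \<Longrightarrow> is_ucp (diag_opsys U) R (\<phi> s)) \<Longrightarrow>
      \<exists>\<psi>\<in>UCP C R. \<forall>s\<in>S. \<forall>d\<in>carr (diag_opsys U). \<psi> (\<iota> s d) = \<phi> s d"
    and coproduct_unique: "\<lbrakk>is_ucp C R \<psi>; is_ucp C R \<psi>';
      \<And>s d. s \<in> S \<Longrightarrow> d \<in> carr (diag_opsys U) \<Longrightarrow> \<psi> (\<iota> s d) = \<psi>' (\<iota> s d); x \<in> carr C\<rbrakk>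
      \<Longrightarrow> \<psi> x = \<psi>' x"
proof -
  let ?I = "S \<times> carr (diag_opsys U)"
  have C: "operator_system C" using cop by (simp add: is_coproduct_def)
  have p: "case_prod \<iota> i \<in> carr C" if "i \<in> ?I" for i
    using that by (auto simp: is_ucp_carr [OF coproduct_inclusion_ucp [OF cop]])
  have ex1: "\<exists>!\<theta>. \<theta> \<in> UCP C (transport j R) \<and> (\<forall>i\<in>?I. \<theta> (case_prod \<iota> i) = j (case_prod \<phi> i))"
    if "\<And>s. s \<in> S \<Longrightarrow> is_ucp (diag_opsys U) R (\<phi> s)" for \<phi>
  proof -
    have "\<exists>!\<theta>. \<theta> \<in> UCP C (transport j R) \<and> (\<forall>s\<in>S. \<forall>d\<in>carr (diag_opsys U). \<theta> (\<iota> s d) = j (\<phi> s d))"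
      by (rule cop [unfolded is_coproduct_def, THEN conjunct2, THEN conjunct2, THEN spec, THEN spec, THEN mp])
        (simp add: is_ucp_into_transport operator_system_transport [OF R] that)
    then show ?thesis by simp
  qed
  show "\<exists>\<psi>\<in>UCP C R. \<forall>s\<in>S. \<forall>d\<in>carr (diag_opsys U). \<psi> (\<iota> s d) = \<phi> s d"
    if "\<And>s. s \<in> S \<Longrightarrow> is_ucp (diag_opsys U) R (\<phi> s)"
    using universal_lift [OF C p ex1 [OF that]] by simp
  assume \<psi>: "is_ucp C R \<psi>" "is_ucp C R \<psi>'"
    and eq: "\<And>s d. s \<in> S \<Longrightarrow> d \<in> carr (diag_opsys U) \<Longrightarrow> \<psi> (\<iota> s d) = \<psi>' (\<iota> s d)"
    and x: "x \<in> carr C"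
  \<comment> \<open>The restrictions of \<open>\<psi>\<close> to the summands serve as the
    prescribed family; \<open>\<psi>'\<close> then solves the same problem.\<close>
  have \<phi>: "is_ucp (diag_opsys U) R (\<lambda>d. \<psi> (\<iota> s d))" if "s \<in> S" for s
    by (rule is_ucp_comp [OF coproduct_inclusion_ucp [OF cop that] \<psi>(1)])
  show "\<psi> x = \<psi>' x"
    by (rule universal_unique [OF C p ex1 [OF \<phi>] \<psi> _ _ x]) (auto simp: eq)
qed

lemma
  assumes lim: "is_inductive_limit TYPE('v) S \<gamma> L g"
  shows inductive_limit_universal: "\<lbrakk>\<And>n. n \<ge> 1 \<Longrightarrow> is_ucp (S n) R (\<rho> n);
      \<And>n x. n \<ge> 1 \<Longrightarrow> x \<in> carr (S n) \<Longrightarrow> \<rho> (Suc n) (\<gamma> n x) = \<rho> n x\<rbrakk> \<Longrightarrow>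
      \<exists>\<psi>\<in>UCP L R. \<forall>n\<ge>1. \<forall>x\<in>carr (S n). \<psi> (g n x) = \<rho> n x"
    and inductive_limit_unique: "\<lbrakk>is_ucp L R \<psi>; is_ucp L R \<psi>';
      \<And>n x. n \<ge> 1 \<Longrightarrow> x \<in> carr (S n) \<Longrightarrow> \<psi> (g n x) = \<psi>' (g n x); y \<in> carr L\<rbrakk>
      \<Longrightarrow> \<psi> y = \<psi>' y"
proof -
  let ?I = "Sigma {1..} (\<lambda>n. carr (S n))"
  have L: "operator_system L" using lim by (simp add: is_inductive_limit_def)
  have g: "is_ucp (S n) L (g n)" "x \<in> carr (S n) \<Longrightarrow> g (Suc n) (\<gamma> n x) = g n x" if "n \<ge> 1" for n x
    using lim that by (auto simp: is_inductive_limit_def)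
  have p: "case_prod g i \<in> carr L" if "i \<in> ?I" for i
    using that by (auto simp: is_ucp_carr [OF g(1)])
  have ex1: "\<exists>!\<theta>. \<theta> \<in> UCP L (transport j R) \<and> (\<forall>i\<in>?I. \<theta> (case_prod g i) = j (case_prod \<rho> i))"
    if "\<And>n. n \<ge> 1 \<Longrightarrow> is_ucp (S n) R (\<rho> n)"
      "\<And>n x. n \<ge> 1 \<Longrightarrow> x \<in> carr (S n) \<Longrightarrow> \<rho> (Suc n) (\<gamma> n x) = \<rho> n x" for \<rho>
  proof -
    have "\<exists>!\<theta>. \<theta> \<in> UCP L (transport j R) \<and> (\<forall>n\<ge>1. \<forall>x\<in>carr (S n). \<theta> (g n x) = j (\<rho> n x))"
      by (rule lim [unfolded is_inductive_limit_def, THEN conjunct2, THEN conjunct2, THEN conjunct2,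
            THEN spec, THEN spec, THEN mp])
        (simp add: is_ucp_into_transport operator_system_transport [OF R] that)
    moreover have "(\<forall>i\<in>?I. \<theta> (case_prod g i) = j (case_prod \<rho> i)) \<longleftrightarrow>
        (\<forall>n\<ge>1. \<forall>x\<in>carr (S n). \<theta> (g n x) = j (\<rho> n x))" for \<theta> by auto
    ultimately show ?thesis by simp
  qed
  show "\<exists>\<psi>\<in>UCP L R. \<forall>n\<ge>1. \<forall>x\<in>carr (S n). \<psi> (g n x) = \<rho> n x"
    if \<rho>: "\<And>n. n \<ge> 1 \<Longrightarrow> is_ucp (S n) R (\<rho> n)"
      "\<And>n x. n \<ge> 1 \<Longrightarrow> x \<in> carr (S n) \<Longrightarrow> \<rho> (Suc n) (\<gamma> n x) = \<rho> n x"
  proof -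
    obtain \<psi> where "\<psi> \<in> UCP L R" "\<forall>i\<in>?I. \<psi> (case_prod g i) = case_prod \<rho> i"
      using universal_lift [OF L p ex1 [OF \<rho>]] by blast
    then show ?thesis by (intro bexI [of _ \<psi>]) auto
  qed
  assume \<psi>: "is_ucp L R \<psi>" "is_ucp L R \<psi>'"
    and eq: "\<And>n x. n \<ge> 1 \<Longrightarrow> x \<in> carr (S n) \<Longrightarrow> \<psi> (g n x) = \<psi>' (g n x)" and y: "y \<in> carr L"
  \<comment> \<open>Composing \<open>\<psi>\<close> with the maps \<open>g n\<close> gives the
    cocone; it is compatible because \<open>g\<close> is.\<close>
  have \<rho>: "is_ucp (S n) R (\<lambda>x. \<psi> (g n x))" if "n \<ge> 1" for n
    by (rule is_ucp_comp [OF g(1) [OF that] \<psi>(1)])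
  show "\<psi> y = \<psi>' y"
    by (rule universal_unique [OF L p ex1 [OF \<rho>] \<psi> _ _ y]) (auto simp: eq g)
qed

end

section \<open>Inductive families and Cantor spaces\<close>

lemma sum_apply_point: "(\<Sum>i\<in>I. f i) x = (\<Sum>i\<in>I. f i x)"
  by (induction I rule: infinite_finite_induct) simp_all

locale set_family =
  fixes X1 :: "'x set" and d :: "nat \<Rightarrow> nat" and b :: "'x \<Rightarrow> nat"
  assumes family: "inductive_family X1 d b"
begin

text \<open>The ancestor of \<open>y\<close> at level \<open>n\<close>. The first component alone is
  an element of level 1, so the list is cut to \<open>n - 1\<close> entries.\<close>

definition trunc :: "nat \<Rightarrow> 'x \<times> nat list \<Rightarrow> 'x \<times> nat list" where
  "trunc n y = (fst y, take (n - 1) (snd y))"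

text \<open>The projection of the Cantor space onto level \<open>n\<close>; its fibres are the
  cylinders.\<close>

definition initial :: "nat \<Rightarrow> (nat \<Rightarrow> nat) \<Rightarrow> 'x \<times> nat list" where
  "initial n \<omega> = (inv_into X1 b (\<omega> 0), map (\<lambda>k. \<omega> (Suc k)) [0..<n - 1])"

text \<open>The sample point of the cylinder of \<open>y\<close>: beyond the prescribed coordinates
  it takes the value 1, admissible everywhere as each \<open>d n\<close> is at least 1.\<close>

definition point :: "'x \<times> nat list \<Rightarrow> nat \<Rightarrow> nat" where
  "point y k = (if k = 0 then b (fst y) else if k - 1 < length (snd y) then snd y ! (k - 1) else 1)"

lemma finite_X1: "finite X1" and X1_ne: "X1 \<noteq> {}" and d_0: "d 0 = card X1" and d_ge_1: "1 \<le> d n"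
  and bij_b: "bij_betw b X1 {1..d 0}"
  using family by (auto simp: inductive_family_def)

lemma cantor_iff: "\<omega> \<in> cantor d \<longleftrightarrow> (\<forall>n. \<omega> n \<in> {1..d n})"
  by (auto simp: cantor_def PiE_def Pi_def)

lemma level_iff: "y \<in> level X1 d n \<longleftrightarrow>
    fst y \<in> X1 \<and> Suc (length (snd y)) = n \<and> (\<forall>k<length (snd y). snd y ! k \<in> {1..d (Suc k)})"
  by (cases y) (auto simp: level_def)

lemma initial_in_level: "1 \<le> n \<Longrightarrow> \<omega> \<in> cantor d \<Longrightarrow> initial n \<omega> \<in> level X1 d n"
  using bij_b by (auto simp: level_iff initial_def cantor_iff bij_betw_def intro!: inv_into_into)

text \<open>As fibres of \<open>initial n\<close>, cylinders get disjointness and refinement from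
  the compatibility of \<open>initial\<close> with \<open>trunc\<close>.\<close>

lemma cylinder_eq:
  assumes "y \<in> level X1 d n"
  shows "cylinder d b y = {\<omega> \<in> cantor d. initial n \<omega> = y}"
proof -
  have "\<omega> 0 = b (fst y) \<longleftrightarrow> inv_into X1 b (\<omega> 0) = fst y" if "\<omega> \<in> cantor d" for \<omega>
    using bij_b that assms
    by (metis bij_betw_def bij_betw_inv_into_left cantor_iff f_inv_into_f level_iff)
  moreover have "(\<forall>k<length (snd y). \<omega> (Suc k) = snd y ! k) \<longleftrightarrow> map (\<lambda>k. \<omega> (Suc k)) [0..<n - 1] = snd y" for \<omega>
    using assms by (auto simp: level_iff list_eq_iff_nth_eq)
  ultimately show ?thesis
    by (auto simp: cylinder_def initial_def prod_eq_iff)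
qed

lemma point_in_cantor: "y \<in> level X1 d n \<Longrightarrow> point y \<in> cantor d"
  using bij_b d_ge_1 by (auto simp: cantor_iff point_def level_iff bij_betw_def)

lemma initial_point: "y \<in> level X1 d n \<Longrightarrow> initial n (point y) = y"
  using bij_b by (auto simp: initial_def point_def level_iff bij_betw_def prod_eq_iff intro!: nth_equalityI)

lemma trunc_in_level: "1 \<le> n \<Longrightarrow> n \<le> m \<Longrightarrow> y \<in> level X1 d m \<Longrightarrow> trunc n y \<in> level X1 d n"
  by (auto simp: trunc_def level_iff)

lemma trunc_initial: "n \<le> m \<Longrightarrow> trunc n (initial m \<omega>) = initial n \<omega>"
  by (auto simp: trunc_def initial_def take_map)

lemma trunc_self: "y \<in> level X1 d n \<Longrightarrow> trunc n y = y"
  by (auto simp: trunc_def level_iff prod_eq_iff)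

lemma trunc_trunc: "n \<le> m \<Longrightarrow> trunc n (trunc m y) = trunc n y"
  by (auto simp: trunc_def min_def)

lemma trunc_append: "x \<in> level X1 d n \<Longrightarrow> m \<le> n \<Longrightarrow> trunc m (append_index x i) = trunc m x"
  by (auto simp: trunc_def append_index_def level_iff)

lemma level_1: "level X1 d 1 = X1 \<times> {[]}"
  by (auto simp: level_iff)

lemma level_Suc: "1 \<le> n \<Longrightarrow> bij_betw (\<lambda>(x, i). append_index x i) (level X1 d n \<times> {1..d n}) (level X1 d (Suc n))"
proof (rule bij_betwI [where g = "\<lambda>y. ((fst y, butlast (snd y)), last (snd y))"])
  assume n: "1 \<le> n"
  show "(\<lambda>(x, i). append_index x i) \<in> level X1 d n \<times> {1..d n} \<rightarrow> level X1 d (Suc n)"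
    by (auto simp: append_index_def level_iff nth_append less_Suc_eq)
  show "(\<lambda>y. ((fst y, butlast (snd y)), last (snd y))) \<in> level X1 d (Suc n) \<rightarrow> level X1 d n \<times> {1..d n}"
  proof
    fix y assume y: "y \<in> level X1 d (Suc n)"
    obtain w i where w: "snd y = w @ [i]"
      using y n by (cases "snd y" rule: rev_cases) (auto simp: level_iff)
    have "\<forall>k<Suc (length w). (w @ [i]) ! k \<in> {1..d (Suc k)}" "Suc (length w) = n"
      using y w by (auto simp: level_iff)
    then have "\<forall>k<length w. w ! k \<in> {1..d (Suc k)}" "i \<in> {1..d n}"
      by (metis less_SucI nth_append) (metis \<open>\<forall>k<Suc (length w). _\<close> \<open>Suc (length w) = n\<close> lessI nth_append_length)
    then show "((fst y, butlast (snd y)), last (snd y)) \<in> level X1 d n \<times> {1..d n}"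
      using y w by (auto simp: level_iff)
  qed
qed (auto simp: append_index_def level_iff intro!: append_butlast_last_id)

lemma sum_level_Suc:
  "1 \<le> n \<Longrightarrow> (\<Sum>y\<in>level X1 d (Suc n). f y) = (\<Sum>x\<in>level X1 d n. \<Sum>i=1..d n. f (append_index x i))"
  by (subst sum.reindex_bij_betw [OF level_Suc, symmetric]) (auto simp: sum.cartesian_product split_def)

lemma finite_level: "finite (level X1 d n)" and card_level: "1 \<le> n \<Longrightarrow> card (level X1 d n) = (\<Prod>k<n. d k)"
proof -
  have *: "finite (level X1 d (Suc n)) \<and> card (level X1 d (Suc n)) = (\<Prod>k<Suc n. d k)" for n
  proof (induction n)
    case 0
    then show ?case using level_1 finite_X1 d_0 by (simp add: card_cartesian_product)
  next
    case (Suc n)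
    then show ?case
      using bij_betw_finite [OF level_Suc [of "Suc n"]] bij_betw_same_card [OF level_Suc [of "Suc n"]]
      by (simp add: card_cartesian_product)
  qed
  \<comment> \<open>\<open>Suc (length w) = 0\<close> has no solution; the empty product would give
    1, hence the assumption \<open>1 \<le> n\<close> in the cardinality.\<close>
  have "level X1 d 0 = {}" by (auto simp: level_iff)
  then show "finite (level X1 d n)" using * by (cases n) auto
  show "1 \<le> n \<Longrightarrow> card (level X1 d n) = (\<Prod>k<n. d k)" using * [of "n - 1"] by simp
qed

lemma card_level_pos: "1 \<le> n \<Longrightarrow> 0 < card (level X1 d n)"
proof -
  have "0 < d k" for k using d_ge_1 [of k] by linarith
  then show "1 \<le> n \<Longrightarrow> 0 < card (level X1 d n)" by (simp add: card_level prod_pos)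
qed

text \<open>The hypothesis on children says that each value is the mean over its children. Induction
  over levels gives the same for descendants, and the quotient of the two cardinalities is their
  number.\<close>

lemma sum_descendants:
  fixes f :: "nat \<Rightarrow> 'x \<times> nat list \<Rightarrow> 'v::complex_vector"
  assumes n: "1 \<le> n" "n \<le> m" and x: "x \<in> level X1 d n"
    and step: "\<And>m y. n \<le> m \<Longrightarrow> y \<in> level X1 d m \<Longrightarrow>
      (\<Sum>i=1..d m. f (Suc m) (append_index y i)) = of_nat (d m) *\<^sub>C f m y"
  shows "(\<Sum>y\<in>{y \<in> level X1 d m. trunc n y = x}. f m y) =
    (of_nat (card (level X1 d m)) / of_nat (card (level X1 d n))) *\<^sub>C f n x"
  using n(2)
proof (induction rule: dec_induct)
  case base
  have "{y \<in> level X1 d n. trunc n y = x} = {x}" using x trunc_self by auto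
  then show ?case using card_level_pos [OF n(1)] by (simp add: scaleC_one)
next
  case (step m)
  then have m: "1 \<le> m" using n by simp
  have "(\<Sum>y\<in>{y \<in> level X1 d (Suc m). trunc n y = x}. f (Suc m) y) =
      (\<Sum>y\<in>level X1 d (Suc m). if trunc n y = x then f (Suc m) y else 0)"
    by (simp add: sum.If_cases finite_level Int_def)
  also have "\<dots> = (\<Sum>y\<in>level X1 d m. \<Sum>i=1..d m. if trunc n (append_index y i) = x then f (Suc m) (append_index y i) else 0)"
    by (rule sum_level_Suc [OF m])
  also have "\<dots> = (\<Sum>y\<in>level X1 d m. if trunc n y = x then of_nat (d m) *\<^sub>C f m y else 0)"
  proof (intro sum.cong refl)
    fix y assume y: "y \<in> level X1 d m"
    show "(\<Sum>i=1..d m. if trunc n (append_index y i) = x then f (Suc m) (append_index y i) else 0) =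
        (if trunc n y = x then of_nat (d m) *\<^sub>C f m y else 0)"
      using assms(4) [OF step(1) y] by (simp add: trunc_append [OF y step(1)])
  qed
  also have "\<dots> = of_nat (d m) *\<^sub>C (\<Sum>y\<in>{y \<in> level X1 d m. trunc n y = x}. f m y)"
    by (simp add: sum.If_cases finite_level Int_def scaleC_sum_right)
  finally show ?case
    using step.IH m by (simp add: scaleC_scaleC card_level mult_ac)
qed

section \<open>The product measure and its cylinders\<close>

sublocale product_prob_space "\<lambda>n. uniform_count_measure {1..d n}" UNIV
  rewrites "Pi\<^sub>M UNIV (\<lambda>n. uniform_count_measure {1..d n}) = cantor_measure d"
proof -
  have "prob_space (uniform_count_measure {1..d n})" for n
    using d_ge_1 [of n] by (intro prob_space_uniform_count_measure) auto
  then show "product_prob_space (\<lambda>n. uniform_count_measure {1..d n})"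
    unfolding product_prob_space_def product_sigma_finite_def product_prob_space_axioms_def
    by (auto intro: prob_space_imp_sigma_finite)
qed (simp add: cantor_measure_def)

lemma space_cantor_measure: "space (cantor_measure d) = cantor d"
  by (simp add: cantor_measure_def cantor_def space_PiM space_uniform_count_measure)

lemma sets_coordinate: "{\<omega> \<in> cantor d. \<omega> i \<in> A} \<in> sets (cantor_measure d)"
proof -
  \<comment> \<open>Every subset of the finite coordinate space is measurable, so an arbitrary
    \<open>A\<close> is cut down to it.\<close>
  have "{\<omega> \<in> space (cantor_measure d). \<omega> i \<in> A} = {\<omega> \<in> space (cantor_measure d). \<omega> i \<in> A \<inter> {1..d i}}"
    by (auto simp: space_cantor_measure cantor_iff)
  also have "\<dots> \<in> sets (cantor_measure d)"
    unfolding cantor_measure_def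
    by (intro sets_Collect_single) (auto simp: sets_uniform_count_measure)
  finally show ?thesis by (simp add: space_cantor_measure)
qed

lemma cylinder_eq_point:
  "y \<in> level X1 d n \<Longrightarrow> cylinder d b y = {\<omega> \<in> cantor d. \<forall>k\<in>{..<n}. \<omega> k \<in> {point y k}}"
  by (auto simp: cylinder_def point_def level_iff less_Suc_eq_0_disj)

lemma measure_cylinder:
  assumes "y \<in> level X1 d n"
  shows "measure (cantor_measure d) (cylinder d b y) = 1 / real (card (level X1 d n))"
proof -
  have n: "1 \<le> n" using assms by (auto simp: level_iff)
  have pt: "point y k \<in> {1..d k}" for k
    using point_in_cantor [OF assms] by (auto simp: cantor_iff)
  have "emeasure (cantor_measure d) (cylinder d b y) =
      (\<Prod>k<n. emeasure (uniform_count_measure {1..d k}) {point y k})"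
    using emeasure_PiM_Collect [of "{..<n}" "\<lambda>k. {point y k}"] pt
    by (simp add: cylinder_eq_point [OF assms] space_cantor_measure sets_uniform_count_measure)
  also have "\<dots> = (\<Prod>k<n. ennreal (1 / real (d k)))"
    using pt by (intro prod.cong refl) (simp add: emeasure_uniform_count_measure)
  also have "\<dots> = ennreal (1 / real (card (level X1 d n)))"
    by (simp add: prod_ennreal card_level [OF n] prod_dividef)
  finally show ?thesis by (simp add: measure_def)
qed

lemma sets_cylinder: "y \<in> level X1 d n \<Longrightarrow> cylinder d b y \<in> sets (cantor_measure d)"
proof -
  assume y: "y \<in> level X1 d n"
  then have n: "{..<n} \<noteq> {}" by (auto simp: level_iff)
  have "cylinder d b y = (\<Inter>k\<in>{..<n}. {\<omega> \<in> cantor d. \<omega> k \<in> {point y k}})"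
    using n by (auto simp: cylinder_eq_point [OF y])
  also have "\<dots> \<in> sets (cantor_measure d)"
    using n by (intro sets.finite_INT sets_coordinate) auto
  finally show ?thesis .
qed

lemma cylinder_disjoint: "x \<in> level X1 d n \<Longrightarrow> y \<in> level X1 d n \<Longrightarrow> x \<noteq> y \<Longrightarrow> cylinder d b x \<inter> cylinder d b y = {}"
  by (auto simp: cylinder_eq)

lemma cylinder_descendants:
  assumes "1 \<le> n" "n \<le> m" "x \<in> level X1 d n"
  shows "cylinder d b x = (\<Union>y\<in>{y \<in> level X1 d m. trunc n y = x}. cylinder d b y)"
proof (intro equalityI subsetI)
  fix \<omega> assume "\<omega> \<in> cylinder d b x"
  then have "\<omega> \<in> cantor d" "initial n \<omega> = x" using assms by (auto simp: cylinder_eq)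
  then show "\<omega> \<in> (\<Union>y\<in>{y \<in> level X1 d m. trunc n y = x}. cylinder d b y)"
    using assms initial_in_level [of m \<omega>]
    by (intro UN_I [of "initial m \<omega>"]) (auto simp: cylinder_eq trunc_initial)
next
  fix \<omega> assume "\<omega> \<in> (\<Union>y\<in>{y \<in> level X1 d m. trunc n y = x}. cylinder d b y)"
  then obtain y where "y \<in> level X1 d m" "trunc n y = x" "\<omega> \<in> cylinder d b y" by blast
  then have "\<omega> \<in> cantor d" "trunc n (initial m \<omega>) = x" by (auto simp: cylinder_eq)
  then show "\<omega> \<in> cylinder d b x" using assms by (simp add: cylinder_eq trunc_initial)
qed

lemma indicator_cylinder_descendants:
  assumes n: "1 \<le> n" "n \<le> m" and x: "x \<in> level X1 d n"
  shows "indicator (cylinder d b x) =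
    (\<Sum>y\<in>{y \<in> level X1 d m. trunc n y = x}. (indicator (cylinder d b y) :: _ \<Rightarrow> complex))"
proof -
  have "(indicator (cylinder d b x) :: _ \<Rightarrow> complex) \<omega> =
      (\<Sum>y\<in>{y \<in> level X1 d m. trunc n y = x}. indicator (cylinder d b y) \<omega>)" for \<omega>
    unfolding cylinder_descendants [OF assms]
    by (rule indicator_UN_disjoint) (auto simp: finite_level disjoint_family_on_def dest: cylinder_disjoint)
  then show ?thesis by (auto simp: fun_eq_iff sum_apply_point)
qed

lemma indicator_cantor:
  assumes "1 \<le> n"
  shows "indicator (cantor d) = (\<Sum>y\<in>level X1 d n. (indicator (cylinder d b y) :: _ \<Rightarrow> complex))"
proof -
  have "cantor d = (\<Union>y\<in>level X1 d n. cylinder d b y)"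
    using assms by (auto simp: cylinder_eq initial_in_level)
  then have "(indicator (cantor d) :: _ \<Rightarrow> complex) \<omega> = (\<Sum>y\<in>level X1 d n. indicator (cylinder d b y) \<omega>)" for \<omega>
    using indicator_UN_disjoint [of "level X1 d n" "cylinder d b" \<omega>]
    by (auto simp: finite_level disjoint_family_on_def dest: cylinder_disjoint)
  then show ?thesis by (auto simp: fun_eq_iff sum_apply_point)
qed

text \<open>A condition on coordinate \<open>i\<close> is a finite union of cylinders of level
  \<open>Suc i\<close>, so cylinders generate. The empty set is added because it arises as an
  intersection of cylinders.\<close>

lemma sets_cantor_measure_eq:
  "sets (cantor_measure d) = sigma_sets (cantor d) (insert {} {cylinder d b y | y n. y \<in> level X1 d n})"
    (is "_ = sigma_sets _ ?G")
proof
  have sub: "?G \<subseteq> Pow (cantor d)" by (auto simp: cylinder_def)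
  show "sigma_sets (cantor d) ?G \<subseteq> sets (cantor_measure d)"
  proof -
    have "?G \<subseteq> sets (cantor_measure d)" using sets_cylinder by auto
    from sets.sigma_sets_subset [OF this] show ?thesis by (simp only: space_cantor_measure)
  qed
  interpret G: sigma_algebra "cantor d" "sigma_sets (cantor d) ?G"
    by (rule sigma_algebra_sigma_sets [OF sub])
  have "{\<omega> \<in> cantor d. \<omega> i \<in> A} \<in> sigma_sets (cantor d) ?G" for i A
  proof -
    have "{\<omega> \<in> cantor d. \<omega> i \<in> A} = (\<Union>y\<in>{y \<in> level X1 d (Suc i). point y i \<in> A}. cylinder d b y)"
    proof (intro equalityI subsetI)
      fix \<omega> assume \<omega>: "\<omega> \<in> {\<omega> \<in> cantor d. \<omega> i \<in> A}"
      let ?y = "initial (Suc i) \<omega>"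
      have y: "?y \<in> level X1 d (Suc i)" using \<omega> by (intro initial_in_level) auto
      have mem: "\<omega> \<in> cylinder d b ?y" using \<omega> by (auto simp: cylinder_eq [OF y])
      then have "\<omega> i = point ?y i" unfolding cylinder_eq_point [OF y] by auto
      with y mem \<omega> show "\<omega> \<in> (\<Union>y\<in>{y \<in> level X1 d (Suc i). point y i \<in> A}. cylinder d b y)"
        by (intro UN_I [of ?y]) auto
    next
      fix \<omega> assume "\<omega> \<in> (\<Union>y\<in>{y \<in> level X1 d (Suc i). point y i \<in> A}. cylinder d b y)"
      then obtain y where y: "y \<in> level X1 d (Suc i)" "point y i \<in> A" "\<omega> \<in> cylinder d b y" by auto
      then show "\<omega> \<in> {\<omega> \<in> cantor d. \<omega> i \<in> A}" by (auto simp: cylinder_eq_point [OF y(1)])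
    qed
    also have "\<dots> \<in> sigma_sets (cantor d) ?G"
      by (intro G.finite_UN) (auto simp: finite_level simp del: split_paired_Ex split_paired_All intro!: sigma_sets.Basic)
    finally show ?thesis .
  qed
  then have sub': "{{\<omega> \<in> cantor d. \<omega> i \<in> A} | i A. i \<in> UNIV \<and> A \<in> sets (uniform_count_measure {1..d i})}
      \<subseteq> sigma_sets (cantor d) ?G" by blast
  have "sets (cantor_measure d) =
      sigma_sets (cantor d) {{\<omega> \<in> cantor d. \<omega> i \<in> A} | i A. i \<in> UNIV \<and> A \<in> sets (uniform_count_measure {1..d i})}"
    by (simp add: cantor_measure_def sets_PiM_single space_uniform_count_measure cantor_def)
  with sigma_sets_mono [OF sub'] show "sets (cantor_measure d) \<subseteq> sigma_sets (cantor d) ?G" by simp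
qed

lemma cylinder_trunc:
  assumes "y \<in> level X1 d m" "x \<in> level X1 d n" "n \<le> m"
  shows "cylinder d b x \<inter> cylinder d b y = (if trunc n y = x then cylinder d b y else {})"
  using assms trunc_initial by (auto simp: cylinder_eq)

text \<open>Dynkin's argument: cylinders together with the empty set generate and are stable under
  intersection, so the integral vanishes over every measurable set, and \<open>density_zero\<close>
  applies.\<close>

lemma AE_zero_of_cylinders:
  fixes f :: "(nat \<Rightarrow> nat) \<Rightarrow> complex"
  assumes f: "integrable (cantor_measure d) f"
    and zero: "\<And>n y. 1 \<le> n \<Longrightarrow> y \<in> level X1 d n \<Longrightarrow> set_lebesgue_integral (cantor_measure d) (cylinder d b y) f = 0"
  shows "AE \<omega> in cantor_measure d. f \<omega> = 0"
proof (rule density_zero [OF f])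
  let ?G = "insert {} {cylinder d b y | y n. y \<in> level X1 d n}"
  have si: "set_integrable (cantor_measure d) A f" if "A \<in> sets (cantor_measure d)" for A
    unfolding set_integrable_def by (rule integrable_mult_indicator [OF that f])
  have "Int_stable ?G"
  proof (rule Int_stableI)
    have lem: "cylinder d b x \<inter> cylinder d b y \<in> ?G" if "x \<in> level X1 d n" "y \<in> level X1 d m" "n \<le> m" for x y n m
      unfolding cylinder_trunc [OF that(2,1,3)] using that(2) by (auto simp del: split_paired_Ex split_paired_All)
    fix A B assume "A \<in> ?G" "B \<in> ?G"
    then consider "A = {} \<or> B = {}" | x n y m where "A = cylinder d b x" "B = cylinder d b y"
      "x \<in> level X1 d n" "y \<in> level X1 d m" by blast
    then show "A \<inter> B \<in> ?G"
    proof cases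
      case 2
      show ?thesis
      proof (cases "n \<le> m")
        case True
        show ?thesis unfolding 2(1,2) by (rule lem [OF 2(3,4) True])
      next
        case False
        show ?thesis unfolding 2(1,2) by (subst Int_commute, rule lem [OF 2(4,3)]) (use False in simp)
      qed
    qed auto
  qed
  moreover have "?G \<subseteq> Pow (cantor d)" by (auto simp: cylinder_def)
  moreover fix A assume "A \<in> sets (cantor_measure d)"
  then have "A \<in> sigma_sets (cantor d) ?G" by (simp add: sets_cantor_measure_eq)
  ultimately show "set_lebesgue_integral (cantor_measure d) A f = 0"
  proof (induction rule: sigma_sets_induct_disjoint)
    case (basic A)
    then show ?case using zero by (auto simp: level_iff set_lebesgue_integral_def)
  next
    case empty
    show ?case by (simp add: set_lebesgue_integral_def)
  next
    case (compl A)
    then have A: "A \<in> sets (cantor_measure d)" by (simp add: sets_cantor_measure_eq)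
    \<comment> \<open>Complements need the integral over the whole space to vanish; the space is the
      disjoint union of the cylinders of level 1.\<close>
    have "indicator (cantor d) \<omega> *\<^sub>R f \<omega> = (\<Sum>y\<in>level X1 d 1. indicator (cylinder d b y) \<omega> *\<^sub>R f \<omega>)" for \<omega>
    proof -
      have "(indicator (cantor d) \<omega> :: complex) = (\<Sum>y\<in>level X1 d 1. indicator (cylinder d b y) \<omega>)"
        using fun_cong [OF indicator_cantor [of 1], of \<omega>] by (simp add: sum_apply_point)
      moreover have "indicator A \<omega> *\<^sub>R f \<omega> = (indicator A \<omega> :: complex) * f \<omega>" for A
        by (simp add: indicator_def)
      ultimately show ?thesis by (simp add: sum_distrib_right)
    qed
    then have tot: "set_lebesgue_integral (cantor_measure d) (cantor d) f = 0"
      using zero [of 1] si [unfolded set_integrable_def, OF sets_cylinder]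
      by (simp add: set_lebesgue_integral_def Bochner_Integration.integral_sum)
    have "set_lebesgue_integral (cantor_measure d) (A \<union> (cantor d - A)) f =
        set_lebesgue_integral (cantor_measure d) A f + set_lebesgue_integral (cantor_measure d) (cantor d - A) f"
      using A by (intro set_integral_Un si) (auto simp: space_cantor_measure [symmetric])
    moreover have "A \<union> (cantor d - A) = cantor d"
      using sets.sets_into_space [OF A] by (auto simp: space_cantor_measure)
    ultimately show ?case using compl tot by simp
  next
    case (union A)
    then have A: "A i \<in> sets (cantor_measure d)" for i by (auto simp: sets_cantor_measure_eq)
    have "set_lebesgue_integral (cantor_measure d) (\<Union>i. A i) f = (\<Sum>i. set_lebesgue_integral (cantor_measure d) (A i) f)"
      using union(1) A by (intro lebesgue_integral_countable_add si) (auto simp: disjoint_family_on_def)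
    then show ?case using union by simp
  qed
qed

text \<open>A Lebesgue number argument with \<open>initial N\<close> in place of a metric: by
  compactness finitely many neighbourhoods of the form \<open>U \<omega> (n \<omega>)\<close>
  suffice, and \<open>N\<close> bounds their depths.\<close>

lemma cantor_uniformly_continuous:
  fixes f :: "(nat \<Rightarrow> nat) \<Rightarrow> complex"
  assumes f: "continuous_on (cantor d) f" and e: "0 < e"
  shows "\<exists>N\<ge>1. \<forall>\<omega>\<in>cantor d. \<forall>\<omega>'\<in>cantor d. initial N \<omega> = initial N \<omega>' \<longrightarrow> norm (f \<omega> - f \<omega>') < e"
proof -
  have "compactin (product_topology (\<lambda>_. euclidean) UNIV) (PiE UNIV (\<lambda>n. {1..d n}))"
    by (subst compactin_PiE) (simp add: finite_imp_compact)
  then have compact: "compact (cantor d)"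
    by (simp add: cantor_def euclidean_product_topology)
  define U where "U \<omega> N = {\<omega>'. \<forall>k<N. \<omega>' k = \<omega> k}" for \<omega> :: "nat \<Rightarrow> nat" and N
  have open_U: "open (U \<omega> N)" for \<omega> N
  proof -
    have "U \<omega> N = (\<Inter>k\<in>{..<N}. (\<lambda>\<omega>'. \<omega>' k) -` {\<omega> k})" by (auto simp: U_def)
    also have "open \<dots>"
      by (intro open_INT ballI open_vimage continuous_on_product_coordinates) (simp_all add: discrete_topology_class.open_discrete)
    finally show ?thesis .
  qed
  have "\<exists>N. \<forall>\<omega>'\<in>cantor d. \<omega>' \<in> U \<omega> N \<longrightarrow> norm (f \<omega>' - f \<omega>) < e / 2" if \<omega>: "\<omega> \<in> cantor d" for \<omega>
  proof -
    obtain V where V: "open V" "\<omega> \<in> V" "\<And>\<omega>'. \<omega>' \<in> cantor d \<Longrightarrow> \<omega>' \<in> V \<Longrightarrow> f \<omega>' \<in> ball (f \<omega>) (e / 2)"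
      using f \<omega> e unfolding continuous_on_topological
      by (metis centre_in_ball half_gt_zero open_ball)
    then have "openin (product_topology (\<lambda>_. euclidean) UNIV) V" by (simp add: open_fun_def)
    from product_topology_open_contains_basis [OF this V(2)]
    obtain X where X: "\<omega> \<in> PiE UNIV X" "finite {i. X i \<noteq> UNIV}" "PiE UNIV X \<subseteq> V"
      by auto
    \<comment> \<open>A basic open set restricts finitely many coordinates. \<open>N\<close> exceeds
      all of them, and \<open>insert 0\<close> keeps \<open>Max\<close> meaningful if there are
      none.\<close>
    define N where "N = Suc (Max (insert 0 {i. X i \<noteq> UNIV}))"
    have less: "i < N" if "X i \<noteq> UNIV" for i
      using that X(2) by (auto simp: N_def less_Suc_eq_le intro!: Max_ge)
    have "\<omega>' i \<in> X i" if "\<omega>' \<in> U \<omega> N" for \<omega>' i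
    proof (cases "X i = UNIV")
      case False
      then have "\<omega>' i = \<omega> i" using less that by (simp add: U_def)
      then show ?thesis using X(1) by (simp add: PiE_iff)
    qed simp
    then have "U \<omega> N \<subseteq> PiE UNIV X" by (auto simp: PiE_iff)
    with X(3) have "U \<omega> N \<subseteq> V" by blast
    then show ?thesis
      using V(3) by (intro exI [of _ N] ballI impI) (metis dist_norm mem_ball norm_minus_commute subsetD)
  qed
  then obtain n where n: "\<And>\<omega> \<omega>'. \<omega> \<in> cantor d \<Longrightarrow> \<omega>' \<in> cantor d \<Longrightarrow> \<omega>' \<in> U \<omega> (n \<omega>) \<Longrightarrow> norm (f \<omega>' - f \<omega>) < e / 2"
    by metis
  have "cantor d \<subseteq> (\<Union>\<omega>\<in>cantor d. U \<omega> (n \<omega>))" by (auto simp: U_def)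
  then obtain F where F: "F \<subseteq> cantor d" "finite F" "cantor d \<subseteq> (\<Union>\<omega>\<in>F. U \<omega> (n \<omega>))"
    using compactE_image [OF compact, of "cantor d" "\<lambda>\<omega>. U \<omega> (n \<omega>)"] open_U by blast
  define N where "N = Suc (Max (insert 0 (n ` F)))"
  have nN: "n \<omega> \<le> N" if "\<omega> \<in> F" for \<omega>
    using that F(2) by (auto simp: N_def intro!: le_SucI Max_ge)
  have "norm (f x - f y) < e" if xy: "x \<in> cantor d" "y \<in> cantor d" "initial N x = initial N y" for x y
  proof -
    have lvl: "initial N x \<in> level X1 d N" using xy by (intro initial_in_level) (auto simp: N_def)
    have "x \<in> cylinder d b (initial N x)" "y \<in> cylinder d b (initial N x)"
      unfolding cylinder_eq [OF lvl] using xy by auto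
    then have eq: "x k = y k" if "k < N" for k
      using that by (auto simp: cylinder_eq_point [OF lvl])
    obtain \<omega> where \<omega>: "\<omega> \<in> F" "x \<in> U \<omega> (n \<omega>)" using F(3) xy(1) by auto
    then have "y \<in> U \<omega> (n \<omega>)" using eq nN [OF \<omega>(1)] by (auto simp: U_def)
    then have "norm (f x - f \<omega>) < e / 2" "norm (f y - f \<omega>) < e / 2"
      using n \<omega> xy F(1) by blast+
    then show ?thesis
      using dist_triangle_half_l [of "f x" "f \<omega>" e "f y"] by (simp add: dist_norm norm_minus_commute)
  qed
  then show ?thesis by (intro exI [of _ N]) (auto simp: N_def)
qed

text \<open>\<open>initial n\<close> depends on finitely many coordinates with discrete values, so
  every function of it is locally constant.\<close>

lemma continuous_on_initial:
  fixes c :: "'x \<times> nat list \<Rightarrow> complex"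
  shows "continuous_on (cantor d) (\<lambda>\<omega>. c (initial n \<omega>))"
  unfolding continuous_on_def
proof (intro ballI tendsto_eventually)
  fix \<omega> :: "nat \<Rightarrow> nat"
  have "eventually (\<lambda>\<omega>'. \<omega>' k = \<omega> k) (at \<omega> within cantor d)" for k
  proof -
    have "continuous_on UNIV (\<lambda>\<omega>' :: nat \<Rightarrow> nat. \<omega>' k)" by (rule continuous_on_product_coordinates)
    then have "((\<lambda>\<omega>'. \<omega>' k) \<longlongrightarrow> \<omega> k) (at \<omega> within cantor d)"
      using continuous_on_subset [of UNIV _ "insert \<omega> (cantor d)"]
      by (metis UNIV_I continuous_on_def tendsto_within_subset top_greatest)
    then show ?thesis by (simp add: tendsto_discrete)
  qed
  then have "eventually (\<lambda>\<omega>'. \<forall>k\<in>{..n}. \<omega>' k = \<omega> k) (at \<omega> within cantor d)"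
    by (intro eventually_ball_finite) auto
  then show "eventually (\<lambda>\<omega>'. c (initial n \<omega>') = c (initial n \<omega>)) (at \<omega> within cantor d)"
  proof (rule eventually_mono)
    fix \<omega>' assume "\<forall>k\<in>{..n}. \<omega>' k = \<omega> k"
    then have "initial n \<omega>' = initial n \<omega>" by (simp add: initial_def)
    then show "c (initial n \<omega>') = c (initial n \<omega>)" by simp
  qed
qed

lemma sum_children:
  assumes x: "x \<in> level X1 d n"
  shows "(\<Sum>y\<in>{y \<in> level X1 d (Suc n). trunc n y = x}. f y) = (\<Sum>i=1..d n. f (append_index x i))"
proof -
  have n: "1 \<le> n" using x by (auto simp: level_iff)
  have "(\<Sum>y\<in>{y \<in> level X1 d (Suc n). trunc n y = x}. f y) =
      (\<Sum>y\<in>level X1 d (Suc n). if trunc n y = x then f y else 0)"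
    by (simp add: sum.If_cases finite_level Int_def)
  also have "\<dots> = (\<Sum>y\<in>level X1 d n. \<Sum>i=1..d n. if trunc n (append_index y i) = x then f (append_index y i) else 0)"
    by (rule sum_level_Suc [OF n])
  also have "\<dots> = (\<Sum>y\<in>level X1 d n. if y = x then \<Sum>i=1..d n. f (append_index x i) else 0)"
    by (intro sum.cong refl) (simp add: trunc_append trunc_self)
  also have "\<dots> = (\<Sum>i=1..d n. f (append_index x i))"
    using x by (simp add: finite_level)
  finally show ?thesis .
qed

end

section \<open>Operators on the tensor product\<close>

locale cantor_tensor = set_family X1 d b
  for X1 :: "'x set" and d :: "nat \<Rightarrow> nat" and b :: "'x \<Rightarrow> nat" +
  fixes q :: "((nat \<Rightarrow> nat) \<Rightarrow> complex) \<Rightarrow> 'l::chilbert_space"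
    and t :: "'l \<Rightarrow> 'h::chilbert_space \<Rightarrow> 'k::chilbert_space"
  assumes L2: "is_L2 (cantor_measure d) q" and tensor: "is_hilbert_tensor t"
begin

abbreviation "\<mu> \<equiv> cantor_measure d"
abbreviation "L \<equiv> level X1 d"
abbreviation "N n \<equiv> card (level X1 d n)"

text \<open>Not normalised: for \<open>x\<close> of level \<open>n\<close> the squared norm of
  \<open>e x\<close> is \<open>1 / N n\<close>, the measure of the cylinder. The factors
  \<open>N n\<close> below compensate for this.\<close>

definition e :: "'x \<times> nat list \<Rightarrow> 'l" where
  "e x = q (indicator (cylinder d b x))"

lemma level_ge_1: "x \<in> L n \<Longrightarrow> 1 \<le> n"
  by (auto simp: level_iff)

lemma N_pos: "x \<in> L n \<Longrightarrow> 0 < N n"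
  using card_level_pos level_ge_1 by blast

lemma q_add: "f \<in> sq_integrable \<mu> \<Longrightarrow> g \<in> sq_integrable \<mu> \<Longrightarrow> q (f + g) = q f + q g"
  and q_scaleC: "f \<in> sq_integrable \<mu> \<Longrightarrow> q (c *\<^sub>C f) = c *\<^sub>C q f"
  and q_inner: "f \<in> sq_integrable \<mu> \<Longrightarrow> g \<in> sq_integrable \<mu> \<Longrightarrow>
    cinner (q f) (q g) = (\<integral>\<omega>. cnj (f \<omega>) * g \<omega> \<partial>\<mu>)"
  and q_surj: "\<exists>f\<in>sq_integrable \<mu>. q f = \<xi>"
proof -
  have "\<xi> \<in> q ` sq_integrable \<mu>" using L2 by (simp add: is_L2_def)
  then show "\<exists>f\<in>sq_integrable \<mu>. q f = \<xi>" by auto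
qed (use L2 in \<open>simp_all add: is_L2_def\<close>)

lemma sq_measurable: "f \<in> sq_integrable \<mu> \<Longrightarrow> f \<in> borel_measurable \<mu>"
  and sq_integrable_norm: "f \<in> sq_integrable \<mu> \<Longrightarrow> integrable \<mu> (\<lambda>\<omega>. (norm (f \<omega>))\<^sup>2)"
  by (auto simp: sq_integrable_def)

lemma sq_bounded_mult:
  assumes f: "f \<in> sq_integrable \<mu>" and g: "g \<in> borel_measurable \<mu>" "\<And>\<omega>. norm (g \<omega>) \<le> 1"
  shows "(\<lambda>\<omega>. g \<omega> * f \<omega>) \<in> sq_integrable \<mu>"
proof -
  have m: "f \<in> borel_measurable \<mu>" by (rule sq_measurable [OF f])
  have "integrable \<mu> (\<lambda>\<omega>. (norm (g \<omega> * f \<omega>))\<^sup>2)"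
  proof (rule Bochner_Integration.integrable_bound [OF sq_integrable_norm [OF f]])
    show "(\<lambda>\<omega>. (norm (g \<omega> * f \<omega>))\<^sup>2) \<in> borel_measurable \<mu>" using m g by measurable
    have "(norm (g \<omega> * f \<omega>))\<^sup>2 \<le> (norm (f \<omega>))\<^sup>2" for \<omega>
      using g(2) [of \<omega>] by (intro power_mono) (auto simp: norm_mult mult_left_le_one_le)
    then show "AE \<omega> in \<mu>. norm ((norm (g \<omega> * f \<omega>))\<^sup>2) \<le> norm ((norm (f \<omega>))\<^sup>2)" by simp
  qed
  with m g show ?thesis by (auto simp: sq_integrable_def)
qed

lemma sq_add: "f \<in> sq_integrable \<mu> \<Longrightarrow> g \<in> sq_integrable \<mu> \<Longrightarrow> f + g \<in> sq_integrable \<mu>"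
proof -
  assume f: "f \<in> sq_integrable \<mu>" and g: "g \<in> sq_integrable \<mu>"
  note m = sq_measurable [OF f] sq_measurable [OF g]
  have "integrable \<mu> (\<lambda>\<omega>. (norm (f \<omega> + g \<omega>))\<^sup>2)"
  proof (rule Bochner_Integration.integrable_bound)
    show "integrable \<mu> (\<lambda>\<omega>. 2 * (norm (f \<omega>))\<^sup>2 + 2 * (norm (g \<omega>))\<^sup>2)"
      using sq_integrable_norm [OF f] sq_integrable_norm [OF g] by simp
    show "(\<lambda>\<omega>. (norm (f \<omega> + g \<omega>))\<^sup>2) \<in> borel_measurable \<mu>" using m by measurable
    have "(norm (f \<omega> + g \<omega>))\<^sup>2 \<le> 2 * (norm (f \<omega>))\<^sup>2 + 2 * (norm (g \<omega>))\<^sup>2" for \<omega>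
    proof -
      have "(norm (f \<omega> + g \<omega>))\<^sup>2 \<le> (norm (f \<omega>) + norm (g \<omega>))\<^sup>2"
        by (intro power_mono norm_triangle_ineq) simp
      moreover have "0 \<le> (norm (f \<omega>) - norm (g \<omega>))\<^sup>2" by simp
      ultimately show ?thesis by (simp add: power2_sum power2_diff)
    qed
    then show "AE \<omega> in \<mu>. norm ((norm (f \<omega> + g \<omega>))\<^sup>2) \<le> norm (2 * (norm (f \<omega>))\<^sup>2 + 2 * (norm (g \<omega>))\<^sup>2)"
      by (intro AE_I2) simp
  qed
  with m show ?thesis by (auto simp: sq_integrable_def plus_fun_def)
qed

lemma sq_scaleC: "f \<in> sq_integrable \<mu> \<Longrightarrow> c *\<^sub>C f \<in> sq_integrable \<mu>"
  by (auto simp: sq_integrable_def scaleC_fun_def scaleC_complex_def norm_mult power_mult_distrib)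

lemma sq_const: "(\<lambda>_. 1) \<in> sq_integrable \<mu>"
  by (auto simp: sq_integrable_def)

lemma sq_indicator: "A \<in> sets \<mu> \<Longrightarrow> indicator A \<in> sq_integrable \<mu>"
proof -
  assume "A \<in> sets \<mu>"
  then have "(\<lambda>\<omega>. indicator A \<omega> * 1) \<in> sq_integrable \<mu>"
    by (intro sq_bounded_mult sq_const) (auto simp: indicator_def)
  then show ?thesis by simp
qed

lemma sq_imp_integrable: "f \<in> sq_integrable \<mu> \<Longrightarrow> integrable \<mu> f"
proof -
  assume f: "f \<in> sq_integrable \<mu>"
  show ?thesis
  proof (rule Bochner_Integration.integrable_bound)
    show "integrable \<mu> (\<lambda>\<omega>. 1 + (norm (f \<omega>))\<^sup>2)" using sq_integrable_norm [OF f] by simp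
    show "f \<in> borel_measurable \<mu>" by (rule sq_measurable [OF f])
    have "norm (f \<omega>) \<le> 1 + (norm (f \<omega>))\<^sup>2" for \<omega>
    proof -
      have "0 \<le> (norm (f \<omega>) - 1)\<^sup>2" by simp
      then have "2 * norm (f \<omega>) \<le> 1 + (norm (f \<omega>))\<^sup>2" by (simp add: power2_diff)
      then show ?thesis using norm_ge_zero [of "f \<omega>"] by linarith
    qed
    then show "AE \<omega> in \<mu>. norm (f \<omega>) \<le> norm (1 + (norm (f \<omega>))\<^sup>2)" by (intro AE_I2) simp
  qed
qed

lemma q_zero: "q 0 = 0"
  using q_scaleC [OF sq_const, of 0] by simp

lemma q_sum: "(\<And>i. i \<in> I \<Longrightarrow> f i \<in> sq_integrable \<mu>) \<Longrightarrow>
    (\<Sum>i\<in>I. f i) \<in> sq_integrable \<mu> \<and> q (\<Sum>i\<in>I. f i) = (\<Sum>i\<in>I. q (f i))"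
proof (induction I rule: infinite_finite_induct)
  case (insert i I)
  then have i: "f i \<in> sq_integrable \<mu>" and I: "sum f I \<in> sq_integrable \<mu>" "q (sum f I) = (\<Sum>i\<in>I. q (f i))"
    by auto
  show ?case
    unfolding sum.insert [OF insert(1,2)]
    using sq_add [OF i I(1)] q_add [OF i I(1)] I(2) by (simp only: simp_thms)
qed (use sq_scaleC [OF sq_const, of 0] in \<open>simp_all add: q_zero\<close>)

lemma sq_cylinder: "x \<in> L n \<Longrightarrow> indicator (cylinder d b x) \<in> sq_integrable \<mu>"
  by (rule sq_indicator [OF sets_cylinder])

lemma inner_e:
  assumes x: "x \<in> L i" and y: "y \<in> L n" and i: "i \<le> n"
  shows "cinner (e x) (e y) = (if trunc i y = x then 1 / of_nat (N n) else 0)"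
proof -
  have "cinner (e x) (e y) = (\<integral>\<omega>. indicator (cylinder d b x \<inter> cylinder d b y) \<omega> \<partial>\<mu>)"
    unfolding e_def q_inner [OF sq_cylinder [OF x] sq_cylinder [OF y]]
    by (intro Bochner_Integration.integral_cong refl) (simp add: indicator_def)
  also have "\<dots> = complex_of_real (measure \<mu> (cylinder d b x \<inter> cylinder d b y))"
  proof -
    let ?B = "cylinder d b x \<inter> cylinder d b y"
    have B: "?B \<inter> space \<mu> = ?B" by (auto simp: cylinder_def space_cantor_measure)
    have "(\<integral>\<omega>. indicator ?B \<omega> \<partial>\<mu>) = (\<integral>\<omega>. complex_of_real (indicator ?B \<omega>) \<partial>\<mu>)"
      by (intro Bochner_Integration.integral_cong refl) (simp add: indicator_def)
    also have "\<dots> = complex_of_real (\<integral>\<omega>. indicator ?B \<omega> \<partial>\<mu>)"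
      by (rule integral_complex_of_real)
    finally show ?thesis by (simp add: B)
  qed
  also have "\<dots> = (if trunc i y = x then 1 / of_nat (N n) else 0)"
    using y by (simp add: cylinder_trunc [OF y x i] measure_cylinder)
  finally show ?thesis .
qed

lemma inner_e': "x \<in> L i \<Longrightarrow> y \<in> L n \<Longrightarrow> i \<le> n \<Longrightarrow>
    cinner (e y) (e x) = (if trunc i y = x then 1 / of_nat (N n) else 0)"
  by (subst cinner_commute) (simp add: inner_e)

lemma e_descendants:
  assumes "1 \<le> n" "n \<le> m" "x \<in> L n"
  shows "e x = (\<Sum>y\<in>{y \<in> L m. trunc n y = x}. e y)"
  unfolding e_def indicator_cylinder_descendants [OF assms]
  by (subst conjunct2 [OF q_sum]) (auto simp: sq_cylinder)

text \<open>Pairings of \<xi> with \<open>e x\<close> are integrals over cylinders of the conjugate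
  of a representative, so \<open>AE_zero_of_cylinders\<close> applies. Levels below \<open>m\<close>
  follow from deeper ones, since \<open>e x\<close> is the sum over its descendants; later proofs
  can therefore test only where a martingale has become exact.\<close>

lemma total_e:
  assumes orth: "\<And>n x. m \<le> n \<Longrightarrow> x \<in> L n \<Longrightarrow> cinner \<xi> (e x) = 0"
  shows "\<xi> = 0"
proof -
  have orth': "cinner \<xi> (e x) = 0" if "x \<in> L n" for n x
  proof -
    have "e x = (\<Sum>y\<in>{y \<in> L (max m n). trunc n y = x}. e y)"
      by (rule e_descendants [OF level_ge_1 [OF that] _ that]) simp
    then have "cinner \<xi> (e x) = (\<Sum>y\<in>{y \<in> L (max m n). trunc n y = x}. cinner \<xi> (e y))"
      by (simp only: cinner.sum_right)
    also have "\<dots> = 0"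
      by (intro sum.neutral ballI orth [of "max m n"]) simp_all
    finally show ?thesis .
  qed
  obtain f where f: "f \<in> sq_integrable \<mu>" "q f = \<xi>" using q_surj by blast
  have "AE \<omega> in \<mu>. cnj (f \<omega>) = 0"
  proof (rule AE_zero_of_cylinders)
    show "integrable \<mu> (\<lambda>\<omega>. cnj (f \<omega>))"
      using sq_imp_integrable [OF f(1)] by simp
    fix n y assume y: "y \<in> L n"
    have "set_lebesgue_integral \<mu> (cylinder d b y) (\<lambda>\<omega>. cnj (f \<omega>)) =
        (\<integral>\<omega>. cnj (f \<omega>) * indicator (cylinder d b y) \<omega> \<partial>\<mu>)"
      unfolding set_lebesgue_integral_def
      by (intro Bochner_Integration.integral_cong refl) (simp add: indicator_def)
    also have "\<dots> = cinner \<xi> (e y)"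
      by (simp add: e_def f(2) [symmetric] q_inner [OF f(1) sq_cylinder [OF y]])
    finally show "set_lebesgue_integral \<mu> (cylinder d b y) (\<lambda>\<omega>. cnj (f \<omega>)) = 0"
      by (simp add: orth' [OF y])
  qed
  then have "(\<integral>\<omega>. complex_of_real ((norm (f \<omega>))\<^sup>2) \<partial>\<mu>) = (\<integral>\<omega>. 0 \<partial>\<mu>)"
    using sq_measurable [OF f(1)] by (intro integral_cong_AE) auto
  then have "cinner \<xi> \<xi> = 0"
    unfolding f(2) [symmetric] q_inner [OF f(1) f(1)] by (simp add: complex_norm_square mult.commute del: of_real_power)
  then show ?thesis by (simp add: cinner_self)
qed

section \<open>Test vectors and contractions in the tensor product\<close>

lemma t_add_left: "t (\<xi> + \<eta>) h = t \<xi> h + t \<eta> h"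
  and t_add_right: "t \<xi> (h + k) = t \<xi> h + t \<xi> k"
  and t_scaleC_left: "t (c *\<^sub>C \<xi>) h = c *\<^sub>C t \<xi> h"
  and t_scaleC_right: "t \<xi> (c *\<^sub>C h) = c *\<^sub>C t \<xi> h"
  and t_inner: "cinner (t \<xi> h) (t \<eta> k) = cinner \<xi> \<eta> * cinner h k"
  and t_span: "closure (span (range (\<lambda>(x, y). t x y))) = UNIV"
  using tensor unfolding is_hilbert_tensor_def by blast+

lemma t_norm: "norm (t \<xi> h) = norm \<xi> * norm h"
proof -
  have "complex_of_real ((norm (t \<xi> h))\<^sup>2) = complex_of_real ((norm \<xi> * norm h)\<^sup>2)"
    using t_inner [of \<xi> h \<xi> h] by (simp add: cinner_self power_mult_distrib)
  then have "(norm (t \<xi> h))\<^sup>2 = (norm \<xi> * norm h)\<^sup>2" by (simp only: of_real_eq_iff)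
  then show ?thesis by (simp add: power2_eq_iff_nonneg)
qed

lemma t_bilinear: "bounded_bilinear t"
proof
  show "\<exists>K. \<forall>a b. norm (t a b) \<le> norm a * norm b * K" by (intro exI [of _ 1]) (simp add: t_norm)
qed (simp_all add: t_add_left t_add_right scaleR_scaleC t_scaleC_left t_scaleC_right)

interpretation t: bounded_bilinear t by (rule t_bilinear)

lemma total_t:
  assumes orth: "\<And>\<xi> h. cinner u (t \<xi> h) = 0"
  shows "u = 0"
proof -
  have "closure (span (range (\<lambda>(x, y). t x y))) \<subseteq> {w. cinner u w = 0}"
  proof (rule closure_minimal)
    show "closed {w. cinner u w = 0}"
      by (intro closed_Collect_eq cinner.continuous_on continuous_intros)
    show "span (range (\<lambda>(x, y). t x y)) \<subseteq> {w. cinner u w = 0}"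
      by (rule span_minimal) (auto simp: orth subspace_def cinner.add_right cinner.zero_right cinner.scaleR_right)
  qed
  then have "cinner u u = 0" by (auto simp: t_span)
  then show ?thesis by (simp add: cinner_self)
qed

definition G :: "nat \<Rightarrow> 'k set" where
  "G m = {t (e x) h | x h n. m \<le> n \<and> x \<in> L n}"

lemma G_I: "x \<in> L n \<Longrightarrow> m \<le> n \<Longrightarrow> t (e x) h \<in> G m"
  by (auto simp: G_def simp del: split_paired_Ex)

text \<open>For fixed \<open>h\<close>, pairing \<open>u\<close> with \<open>t \<eta> h\<close> is a
  bounded functional of \<open>\<eta>\<close>; the vector that represents it is orthogonal to all
  \<open>e x\<close> of level at least \<open>m\<close>, hence zero.\<close>

lemma total_G:
  assumes orth: "\<And>w. w \<in> G m \<Longrightarrow> cinner u w = 0"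
  shows "u = 0"
proof (rule total_t)
  fix \<xi> h
  obtain \<zeta> where \<zeta>: "\<And>\<eta>. cinner \<zeta> \<eta> = cinner u (t \<eta> h)"
  proof -
    have "\<exists>\<zeta>. \<forall>\<eta>. cinner \<zeta> \<eta> = cinner u (t \<eta> h)"
    proof (rule Riesz_representation [where C = "norm u * norm h"])
      show "norm (cinner u (t \<eta> h)) \<le> norm u * norm h * norm \<eta>" for \<eta>
        using cinner_Cauchy_Schwarz [of u "t \<eta> h"] by (simp add: t_norm mult_ac)
    qed (simp_all add: t_add_left t_scaleC_left cinner_add_right cinner_scaleC_right)
    then show ?thesis using that by blast
  qed
  have "\<zeta> = 0"
    by (rule total_e [of m]) (simp add: \<zeta> orth [OF G_I])
  then show "cinner u (t \<xi> h) = 0"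
    using \<zeta> [of \<xi>] by (simp add: cinner.zero_left)
qed

text \<open>Totality is used twice: \<open>R\<close> and \<open>R'\<close> agree on
  \<open>G m\<close> by testing on the left, and then everywhere because the entry of the difference
  is a bounded functional of \<open>v\<close>.\<close>

lemma op_ext_G:
  assumes R: "R \<in> bounded_ops" "R' \<in> bounded_ops"
    and eq: "\<And>u v. u \<in> G m \<Longrightarrow> v \<in> G m \<Longrightarrow> cinner u (blinfun_apply R v) = cinner u (blinfun_apply R' v)"
  shows "R = R'"
proof (rule bounded_ops_ext)
  have 1: "blinfun_apply R v = blinfun_apply R' v" if v: "v \<in> G m" for v
  proof -
    have "blinfun_apply R v - blinfun_apply R' v = 0"
      by (rule total_G [of m], subst cinner_commute) (simp add: eq [OF _ v] cinner.diff_right)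
    then show ?thesis by simp
  qed
  fix u v
  let ?f = "\<lambda>v. cinner u (blinfun_apply (R - R') v)"
  have "?f v = 0"
  proof (rule total_functional_zero [where G = "G m" and f = ?f and C = "norm (R - R') * norm u"])
    show "cinner u (blinfun_apply (R - R') (c *\<^sub>C x)) = c * cinner u (blinfun_apply (R - R') x)" for c x
      using R by (simp add: blinfun.diff_left bounded_opsD cinner.diff_right cinner_scaleC_right right_diff_distrib)
    show "norm (cinner u (blinfun_apply (R - R') x)) \<le> norm (R - R') * norm u * norm x" for x
      by (rule cinner_blinfun_bound)
    show "cinner u (blinfun_apply (R - R') w) = 0" if "w \<in> G m" for w
      by (simp add: 1 [OF that] blinfun.diff_left cinner.zero_right)
  qed (auto intro: total_G simp: blinfun.add_right cinner.add_right)
  then show "cinner u (blinfun_apply R v) = cinner u (blinfun_apply R' v)"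
    by (simp add: blinfun.diff_left cinner.diff_right)
qed

lemma op_ext_t:
  assumes R: "R \<in> bounded_ops" "R' \<in> bounded_ops"
    and eq: "\<And>\<xi> h. blinfun_apply R (t \<xi> h) = blinfun_apply R' (t \<xi> h)"
  shows "R = R'"
  by (rule op_ext_G [OF R, of 0]) (auto simp: G_def eq)

text \<open>The adjoint of the map \<open>t \<xi>\<close>, that is, the contraction of
  \<open>u\<close> against \<open>\<xi>\<close> in the first tensor factor.\<close>

definition tadj :: "'l \<Rightarrow> 'k \<Rightarrow> 'h" where
  "tadj \<xi> u = (SOME h. \<forall>k. cinner h k = cinner u (t \<xi> k))"

lemma cinner_tadj: "cinner (tadj \<xi> u) k = cinner u (t \<xi> k)"
proof -
  have "\<exists>h. \<forall>k. cinner h k = cinner u (t \<xi> k)"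
  proof (rule Riesz_representation [where C = "norm u * norm \<xi>"])
    show "norm (cinner u (t \<xi> k)) \<le> norm u * norm \<xi> * norm k" for k
      using cinner_Cauchy_Schwarz [of u "t \<xi> k"] by (simp add: t_norm mult_ac)
  qed (simp_all add: t_add_right t_scaleC_right cinner_add_right cinner_scaleC_right)
  then show ?thesis unfolding tadj_def by (rule someI2_ex) blast
qed

lemma cinner_tadj': "cinner k (tadj \<xi> u) = cinner (t \<xi> k) u"
  by (metis cinner_commute cinner_tadj)

lemma tadj_add: "tadj \<xi> (u + v) = tadj \<xi> u + tadj \<xi> v"
  by (rule cinner_ext_left) (simp add: cinner_tadj cinner_add_left)

lemma tadj_scaleC: "tadj \<xi> (c *\<^sub>C u) = c *\<^sub>C tadj \<xi> u"
  by (rule cinner_ext_left) (simp add: cinner_tadj cinner_scaleC_left)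

lemma tadj_t: "tadj \<xi> (t \<eta> h) = cinner \<xi> \<eta> *\<^sub>C h"
  by (rule cinner_ext_right) (simp add: cinner_tadj' t_inner cinner_scaleC_right)

lemma Bessel: "(\<Sum>x\<in>L n. real (N n) * (norm (tadj (e x) u))\<^sup>2) \<le> (norm u)\<^sup>2"
proof -
  \<comment> \<open>The orthogonal projection of \<open>u\<close> onto the sum of the spaces of
    vectors \<open>t (e x) h\<close> with \<open>x\<close> of level \<open>n\<close>; the factor
    \<open>N n\<close> normalises \<open>e x\<close>.\<close>
  define w where "w = (\<Sum>x\<in>L n. of_nat (N n) *\<^sub>C t (e x) (tadj (e x) u))"
  define s where "s = (\<Sum>x\<in>L n. real (N n) * (norm (tadj (e x) u))\<^sup>2)"
  have "cinner w u = (\<Sum>x\<in>L n. of_nat (N n) * cinner (tadj (e x) u) (tadj (e x) u))"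
    by (simp add: w_def cinner.sum_left cinner_scaleC_left cinner_tadj')
  also have "\<dots> = complex_of_real s" by (simp add: s_def cinner_self)
  finally have wu: "cinner w u = complex_of_real s" .
  have "cinner w w = (\<Sum>x\<in>L n. \<Sum>y\<in>L n. if y = x then of_nat (N n) * cinner (tadj (e x) u) (tadj (e x) u) else 0)"
  proof -
    have "cinner w w = (\<Sum>x\<in>L n. cinner (of_nat (N n) *\<^sub>C t (e x) (tadj (e x) u)) w)"
      unfolding w_def by (rule cinner.sum_left)
    also have "\<dots> = (\<Sum>x\<in>L n. \<Sum>y\<in>L n. cinner (of_nat (N n) *\<^sub>C t (e x) (tadj (e x) u)) (of_nat (N n) *\<^sub>C t (e y) (tadj (e y) u)))"
      unfolding w_def by (intro sum.cong refl cinner.sum_right)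
    also have "\<dots> = (\<Sum>x\<in>L n. \<Sum>y\<in>L n. if y = x then of_nat (N n) * cinner (tadj (e x) u) (tadj (e x) u) else 0)"
    proof (intro sum.cong refl)
      fix x y assume xy: "x \<in> L n" "y \<in> L n"
      show "cinner (of_nat (N n) *\<^sub>C t (e x) (tadj (e x) u)) (of_nat (N n) *\<^sub>C t (e y) (tadj (e y) u)) =
          (if y = x then of_nat (N n) * cinner (tadj (e x) u) (tadj (e x) u) else 0)"
        using N_pos [OF xy(1)]
        by (simp add: cinner_scaleC_left cinner_scaleC_right t_inner inner_e [OF xy order_refl] trunc_self [OF xy(2)])
    qed
    finally show ?thesis .
  qed
  also have "\<dots> = complex_of_real s" by (simp add: finite_level s_def cinner_self)
  finally have ww: "(norm w)\<^sup>2 = s" by (simp only: cinner_self of_real_eq_iff)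
  have "0 \<le> (norm (u - w))\<^sup>2" by simp
  also have "(norm (u - w))\<^sup>2 = (norm u)\<^sup>2 - 2 * Re (cinner w u) + (norm w)\<^sup>2"
    using norm_sq_add [of u "- w"] cinner_commute [of u w] by (simp add: cinner.minus_right)
  finally show ?thesis by (simp add: wu ww s_def)
qed

text \<open>\<open>form n P\<close> is the form of the operator \<open>\<Sum>\<^sub>x 1\<^sub>x \<otimes> P x\<close>, where \<open>1\<^sub>x\<close> is the multiplication by the indicator
  function of the cylinder of \<open>x\<close>, compressed to the vectors of level \<open>n\<close>.\<close>

definition form :: "nat \<Rightarrow> ('x \<times> nat list \<Rightarrow> 'h \<Rightarrow>\<^sub>L 'h) \<Rightarrow> 'k \<Rightarrow> 'k \<Rightarrow> complex" where
  "form n P u v = (\<Sum>x\<in>L n. of_nat (N n) * cinner (tadj (e x) u) (blinfun_apply (P x) (tadj (e x) v)))"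

text \<open>Cauchy-Schwarz for the sum over \<open>x\<close>, with \<open>N n\<close> split evenly
  between the two sides, and then \<open>Bessel\<close> for each side. The bound does not depend on
  \<open>n\<close>, as \<open>weak_limit_operator\<close> requires.\<close>

lemma form_bound:
  assumes P: "\<And>x. x \<in> L n \<Longrightarrow> norm (P x) \<le> C" and C: "0 \<le> C"
  shows "norm (form n P u v) \<le> C * norm u * norm v"
proof -
  define a where "a u x = sqrt (real (N n)) * norm (tadj (e x) u)" for u x
  have a2: "(\<Sum>x\<in>L n. (a u x)\<^sup>2) \<le> (norm u)\<^sup>2" for u
    using Bessel [of n u] by (simp add: a_def power_mult_distrib)
  have "norm (form n P u v) \<le> (\<Sum>x\<in>L n. norm (of_nat (N n) * cinner (tadj (e x) u) (blinfun_apply (P x) (tadj (e x) v))))"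
    unfolding form_def by (rule norm_sum)
  also have "\<dots> \<le> (\<Sum>x\<in>L n. C * (a u x * a v x))"
  proof (rule sum_mono)
    fix x assume x: "x \<in> L n"
    have "norm (cinner (tadj (e x) u) (blinfun_apply (P x) (tadj (e x) v))) \<le> norm (P x) * norm (tadj (e x) u) * norm (tadj (e x) v)"
      by (rule cinner_blinfun_bound)
    also have "\<dots> \<le> C * norm (tadj (e x) u) * norm (tadj (e x) v)"
      by (intro mult_right_mono P x) auto
    finally have "real (N n) * norm (cinner (tadj (e x) u) (blinfun_apply (P x) (tadj (e x) v))) \<le>
        real (N n) * (C * norm (tadj (e x) u) * norm (tadj (e x) v))"
      by (intro mult_left_mono) auto
    also have "\<dots> = C * (a u x * a v x)"
      by (simp add: a_def)
    finally show "norm (of_nat (N n) * cinner (tadj (e x) u) (blinfun_apply (P x) (tadj (e x) v))) \<le> C * (a u x * a v x)"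
      by (simp add: norm_mult)
  qed
  also have "\<dots> = C * (\<Sum>x\<in>L n. a u x * a v x)" by (simp add: sum_distrib_left)
  also have "\<dots> \<le> C * (norm u * norm v)"
  proof (intro mult_left_mono C)
    have "(\<Sum>x\<in>L n. a u x * a v x)\<^sup>2 \<le> (\<Sum>x\<in>L n. (a u x)\<^sup>2) * (\<Sum>x\<in>L n. (a v x)\<^sup>2)"
      by (rule Cauchy_Schwarz_ineq_sum)
    also have "\<dots> \<le> (norm u)\<^sup>2 * (norm v)\<^sup>2"
      by (intro mult_mono a2) (auto intro: sum_nonneg)
    finally have "(\<Sum>x\<in>L n. a u x * a v x)\<^sup>2 \<le> (norm u * norm v)\<^sup>2" by (simp add: power_mult_distrib)
    then show "(\<Sum>x\<in>L n. a u x * a v x) \<le> norm u * norm v"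
      by (rule power2_le_imp_le) simp
  qed
  finally show ?thesis by (simp add: mult.assoc)
qed

lemma form_linear:
  assumes P: "\<And>x. x \<in> L n \<Longrightarrow> P x \<in> bounded_ops"
  shows "form n P (u + u') v = form n P u v + form n P u' v"
    "form n P u (v + v') = form n P u v + form n P u v'"
    "form n P (c *\<^sub>C u) v = cnj c * form n P u v"
    "form n P u (c *\<^sub>C v) = c * form n P u v"
  using P by (simp_all add: form_def tadj_add tadj_scaleC blinfun.add_right cinner_add_left cinner_add_right
      cinner_scaleC_left cinner_scaleC_right bounded_opsD sum.distrib sum_distrib_left distrib_left mult.left_commute)

text \<open>Contracting \<open>t (e x) h\<close> against \<open>e z\<close> leaves
  \<open>h / N n\<close> if \<open>z\<close> lies below \<open>x\<close> and 0 otherwise. With two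
  contractions and the factor in \<open>form\<close>, one \<open>N n\<close> remains in the
  denominator.\<close>

lemma form_G:
  assumes x: "x \<in> L i" "i \<le> n" and y: "y \<in> L j" "j \<le> n" and P: "\<And>z. z \<in> L n \<Longrightarrow> P z \<in> bounded_ops"
  shows "form n P (t (e x) h) (t (e y) k) =
    (\<Sum>z\<in>{z \<in> L n. trunc i z = x \<and> trunc j z = y}. cinner h (blinfun_apply (P z) k)) / of_nat (N n)"
proof -
  have "form n P (t (e x) h) (t (e y) k) =
      (\<Sum>z\<in>L n. if trunc i z = x \<and> trunc j z = y then cinner h (blinfun_apply (P z) k) / of_nat (N n) else 0)"
    unfolding form_def
  proof (intro sum.cong refl)
    fix z assume z: "z \<in> L n"
    show "of_nat (N n) * cinner (tadj (e z) (t (e x) h)) (blinfun_apply (P z) (tadj (e z) (t (e y) k))) =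
        (if trunc i z = x \<and> trunc j z = y then cinner h (blinfun_apply (P z) k) / of_nat (N n) else 0)"
      using N_pos [OF z]
      by (simp add: tadj_t inner_e' [OF x(1) z x(2)] inner_e' [OF y(1) z y(2)] bounded_opsD [OF P [OF z]]
          cinner_scaleC_left cinner_scaleC_right)
  qed
  then show ?thesis by (simp add: sum.If_cases finite_level Int_def sum_divide_distrib)
qed

text \<open>The integral over the cylinder of \<open>y\<close> of the step function with value
  \<open>cinner h (P z k)\<close> on the cylinder of \<open>z\<close>. It is divided by
  \<open>N n\<close>, not by the number of descendants of \<open>y\<close>.\<close>

definition average :: "nat \<Rightarrow> ('x \<times> nat list \<Rightarrow> 'h \<Rightarrow>\<^sub>L 'h) \<Rightarrow> nat \<Rightarrow> 'x \<times> nat list \<Rightarrow> 'h \<Rightarrow> 'h \<Rightarrow> complex" where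
  "average n P j y h k = (\<Sum>z\<in>{z \<in> L n. trunc j z = y}. cinner h (blinfun_apply (P z) k)) / of_nat (N n)"

text \<open>Cylinders are nested or disjoint, so two test vectors meet either in the cylinder of the
  finer one or not at all. The finer one may stand on either side.\<close>

lemma form_average:
  assumes x: "x \<in> L i" and y: "y \<in> L j" and ij: "i \<le> j" "j \<le> n" and P: "\<And>z. z \<in> L n \<Longrightarrow> P z \<in> bounded_ops"
  shows "form n P (t (e x) h) (t (e y) k) = (if trunc i y = x then average n P j y h k else 0)"
    and "form n P (t (e y) h) (t (e x) k) = (if trunc i y = x then average n P j y h k else 0)"
proof -
  have "trunc i z = trunc i y" if "trunc j z = y" for z
    using trunc_trunc [OF ij(1), of z] that by simp
  then have eq: "{z \<in> L n. trunc i z = x \<and> trunc j z = y} = (if trunc i y = x then {z \<in> L n. trunc j z = y} else {})"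
    "{z \<in> L n. trunc j z = y \<and> trunc i z = x} = (if trunc i y = x then {z \<in> L n. trunc j z = y} else {})"
    by auto
  have i: "i \<le> n" using ij by simp
  show "form n P (t (e x) h) (t (e y) k) = (if trunc i y = x then average n P j y h k else 0)"
    by (simp add: form_G [OF x i y ij(2) P] eq average_def)
  show "form n P (t (e y) h) (t (e x) k) = (if trunc i y = x then average n P j y h k else 0)"
    by (simp add: form_G [OF y ij(2) x i P] eq average_def)
qed

text \<open>Weak operator convergence of the operators behind \<open>form n (P n)\<close>. With a
  relation between \<open>R\<close> and \<open>P\<close>, sums, multiples and the unit are handled
  on the side of \<open>P\<close>, and \<open>represents_unique\<close> carries them to
  \<open>R\<close>.\<close>

definition represents :: "('k \<Rightarrow>\<^sub>L 'k) \<Rightarrow> (nat \<Rightarrow> 'x \<times> nat list \<Rightarrow> 'h \<Rightarrow>\<^sub>L 'h) \<Rightarrow> bool" where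
  "represents R P \<longleftrightarrow> R \<in> bounded_ops \<and> (\<forall>u v. (\<lambda>n. form n (P n) u v) \<longlonglongrightarrow> cinner u (blinfun_apply R v))"

text \<open>On test vectors \<open>form\<close> reduces to a single \<open>average\<close> once
  \<open>n\<close> is beyond their levels; the uniform bound extends convergence to all
  vectors.\<close>

lemma represents_exists:
  assumes P: "\<And>n x. x \<in> L n \<Longrightarrow> P n x \<in> bounded_ops" "\<And>n x. x \<in> L n \<Longrightarrow> norm (P n x) \<le> C" and C: "0 \<le> C"
    and conv: "\<And>j y h k. y \<in> L j \<Longrightarrow> convergent (\<lambda>n. average n (P n) j y h k)"
  shows "\<exists>R. represents R P"
proof -
  have "\<exists>R\<in>bounded_ops. \<forall>u v. (\<lambda>n. form n (P n) u v) \<longlonglongrightarrow> cinner u (blinfun_apply R v)"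
  proof (rule weak_limit_operator [where C = C and G = "G 0"])
    fix u v assume "u \<in> G 0" "v \<in> G 0"
    then obtain x i h y j k where u: "u = t (e x) h" "x \<in> L i" and v: "v = t (e y) k" "y \<in> L j"
      by (auto simp: G_def)
    have lem: "convergent (\<lambda>n. form n (P n) (t (e x) h) (t (e y) k)) \<and> convergent (\<lambda>n. form n (P n) (t (e y) h) (t (e x) k))"
      if "x \<in> L i" "y \<in> L j" "i \<le> j" for x y i j h k
    proof -
      let ?a = "\<lambda>n. if trunc i y = x then average n (P n) j y h k else 0"
      have c: "convergent ?a" using conv [OF that(2)] by (cases "trunc i y = x") (simp_all add: convergent_const)
      have ev: "eventually (\<lambda>n. ?a n = form n (P n) (t (e x) h) (t (e y) k)) sequentially"
        "eventually (\<lambda>n. ?a n = form n (P n) (t (e y) h) (t (e x) k)) sequentially"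
        using eventually_ge_at_top [of j]
        by (eventually_elim, simp add: form_average [OF that] P)+
      show ?thesis using c convergent_cong [OF ev(1)] convergent_cong [OF ev(2)] by iprover
    qed
    show "convergent (\<lambda>n. form n (P n) u v)"
      using lem [OF u(2) v(2)] lem [OF v(2) u(2)] nle_le [of i j] by (auto simp: u(1) v(1))
  qed (use P C total_G [of 0] form_bound in \<open>auto simp: form_linear\<close>)
  then show ?thesis by (auto simp: represents_def)
qed

lemma represents_bound:
  assumes R: "represents R P" and P: "\<And>n x. x \<in> L n \<Longrightarrow> norm (P n x) \<le> C" and C: "0 \<le> C"
  shows "norm (cinner u (blinfun_apply R v)) \<le> C * norm u * norm v"
proof (rule LIMSEQ_le_const2)
  show "(\<lambda>n. norm (form n (P n) u v)) \<longlonglongrightarrow> norm (cinner u (blinfun_apply R v))"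
    using R by (auto simp: represents_def intro: tendsto_norm)
qed (intro exI allI impI form_bound P C)

lemma represents_unique: "represents R P \<Longrightarrow> represents R' P \<Longrightarrow> R = R'"
proof (rule bounded_ops_ext)
  fix u v
  assume "represents R P" "represents R' P"
  then have "(\<lambda>n. form n (P n) u v) \<longlonglongrightarrow> cinner u (blinfun_apply R v)"
    "(\<lambda>n. form n (P n) u v) \<longlonglongrightarrow> cinner u (blinfun_apply R' v)" by (simp_all add: represents_def)
  then show "cinner u (blinfun_apply R v) = cinner u (blinfun_apply R' v)" by (rule LIMSEQ_unique)
qed

lemma represents_cong:
  assumes "\<And>n x. m \<le> n \<Longrightarrow> x \<in> L n \<Longrightarrow> P n x = P' n x"
  shows "represents R P \<longleftrightarrow> represents R P'"
proof -
  have "eventually (\<lambda>n. form n (P n) u v = form n (P' n) u v) sequentially" for u v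
    using eventually_ge_at_top [of m] by eventually_elim (simp add: form_def assms)
  from tendsto_cong [OF this] show ?thesis unfolding represents_def by simp
qed

lemma represents_add: "represents R P \<Longrightarrow> represents R' P' \<Longrightarrow> represents (R + R') (\<lambda>n x. P n x + P' n x)"
  unfolding represents_def
proof (intro conjI allI; elim conjE)
  assume "R \<in> bounded_ops" "R' \<in> bounded_ops"
  then show "R + R' \<in> bounded_ops" by (intro csubspace_add csubspace_bounded_ops)
  fix u v
  assume "\<forall>u v. (\<lambda>n. form n (P n) u v) \<longlonglongrightarrow> cinner u (blinfun_apply R v)"
    "\<forall>u v. (\<lambda>n. form n (P' n) u v) \<longlonglongrightarrow> cinner u (blinfun_apply R' v)"
  then have "(\<lambda>n. form n (P n) u v + form n (P' n) u v) \<longlonglongrightarrow>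
      cinner u (blinfun_apply R v) + cinner u (blinfun_apply R' v)"
    by (intro tendsto_add) auto
  then show "(\<lambda>n. form n (\<lambda>x. P n x + P' n x) u v) \<longlonglongrightarrow> cinner u (blinfun_apply (R + R') v)"
    by (simp add: form_def blinfun.add_left cinner_add_right distrib_left sum.distrib)
qed

lemma represents_scaleC: "represents R P \<Longrightarrow> represents (c *\<^sub>C R) (\<lambda>n x. c *\<^sub>C P n x)"
  unfolding represents_def
proof (intro conjI allI; elim conjE)
  assume "R \<in> bounded_ops"
  then show "c *\<^sub>C R \<in> bounded_ops" by (intro csubspace_scaleC csubspace_bounded_ops)
  fix u v
  assume "\<forall>u v. (\<lambda>n. form n (P n) u v) \<longlonglongrightarrow> cinner u (blinfun_apply R v)"
  then have "(\<lambda>n. c * form n (P n) u v) \<longlonglongrightarrow> c * cinner u (blinfun_apply R v)"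
    by (intro tendsto_mult_left) auto
  then show "(\<lambda>n. form n (\<lambda>x. c *\<^sub>C P n x) u v) \<longlonglongrightarrow> cinner u (blinfun_apply (c *\<^sub>C R) v)"
    by (simp add: form_def scaleC_blinfun.rep_eq cinner_scaleC_right sum_distrib_left mult.left_commute)
qed

lemma represents_zero: "represents 0 (\<lambda>_ _. 0)"
  by (auto simp: represents_def form_def csubspace_zero [OF csubspace_bounded_ops] cinner.zero_right)

lemma represents_sum:
  assumes "\<And>i. i \<in> I \<Longrightarrow> represents (R i) (P i)"
  shows "represents (\<Sum>i\<in>I. R i) (\<lambda>n x. \<Sum>i\<in>I. P i n x)"
  using assms
proof (induction I rule: infinite_finite_induct)
  case (insert i I)
  then show ?case unfolding sum.insert [OF insert(1,2)] by (intro represents_add) auto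
qed (simp_all add: represents_zero)

text \<open>By \<open>sum_descendants\<close> the integral of a martingale over the cylinder of
  \<open>y\<close> does not depend on \<open>n\<close>; \<open>1 / N j\<close> is the measure of
  that cylinder.\<close>

lemma average_martingale:
  assumes y: "y \<in> L j" and j: "m \<le> j" "j \<le> n"
    and mart: "\<And>n x. m \<le> n \<Longrightarrow> x \<in> L n \<Longrightarrow> (\<Sum>i=1..d n. P (Suc n) (append_index x i)) = of_nat (d n) *\<^sub>C P n x"
  shows "average n (P n) j y h k = cinner h (blinfun_apply (P j y) k) / of_nat (N j)"
proof -
  have "(\<Sum>z\<in>{z \<in> L n. trunc j z = y}. P n z) = (of_nat (N n) / of_nat (N j)) *\<^sub>C P j y"
    using j by (intro sum_descendants [OF level_ge_1 [OF y] j(2) y] mart) auto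
  then have "(\<Sum>z\<in>{z \<in> L n. trunc j z = y}. cinner h (blinfun_apply (P n z) k)) =
      (of_nat (N n) / of_nat (N j)) * cinner h (blinfun_apply (P j y) k)"
    by (simp add: cinner.sum_right [symmetric] blinfun.sum_left [symmetric] scaleC_blinfun.rep_eq cinner_scaleC_right)
  moreover have "N n > 0" using card_level_pos level_ge_1 [OF y] j by simp
  ultimately show ?thesis by (simp add: average_def)
qed

text \<open>Additivity of the integral. It leads from level \<open>j\<close> to a level
  \<open>m\<close> at which the martingale law already holds.\<close>

lemma average_descendants:
  assumes y: "y \<in> L j" and j: "j \<le> m" "m \<le> n"
  shows "average n P j y h k = (\<Sum>w\<in>{w \<in> L m. trunc j w = y}. average n P m w h k)"
proof -
  have m: "1 \<le> m" using level_ge_1 [OF y] j by simp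
  have "{z \<in> L n. trunc j z = y} = (\<Union>w\<in>{w \<in> L m. trunc j w = y}. {z \<in> L n. trunc m z = w})"
  proof (intro equalityI subsetI)
    fix z assume "z \<in> {z \<in> L n. trunc j z = y}"
    then show "z \<in> (\<Union>w\<in>{w \<in> L m. trunc j w = y}. {z \<in> L n. trunc m z = w})"
      using trunc_trunc [OF j(1), of z] trunc_in_level [OF m j(2), of z] by (intro UN_I [of "trunc m z"]) auto
  next
    fix z assume "z \<in> (\<Union>w\<in>{w \<in> L m. trunc j w = y}. {z \<in> L n. trunc m z = w})"
    then show "z \<in> {z \<in> L n. trunc j z = y}" using trunc_trunc [OF j(1), of z] by auto
  qed
  then have "(\<Sum>z\<in>{z \<in> L n. trunc j z = y}. cinner h (blinfun_apply (P z) k)) =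
      (\<Sum>w\<in>{w \<in> L m. trunc j w = y}. \<Sum>z\<in>{z \<in> L n. trunc m z = w}. cinner h (blinfun_apply (P z) k))"
    by (simp only:) (rule sum.UNION_disjoint, auto simp: finite_level)
  then show ?thesis by (simp add: average_def sum_divide_distrib)
qed

text \<open>The averages are constant from level \<open>max m j\<close> on, so a martingale law that
  starts at some level \<open>m\<close> suffices for convergence.\<close>

lemma represents_martingale:
  assumes P: "\<And>n x. x \<in> L n \<Longrightarrow> P n x \<in> bounded_ops" "\<And>n x. x \<in> L n \<Longrightarrow> norm (P n x) \<le> C" and C: "0 \<le> C"
    and mart: "\<And>n x. m \<le> n \<Longrightarrow> x \<in> L n \<Longrightarrow> (\<Sum>i=1..d n. P (Suc n) (append_index x i)) = of_nat (d n) *\<^sub>C P n x"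
  shows "\<exists>R. represents R P"
proof (rule represents_exists [OF P C])
  fix j y h k assume y: "y \<in> L j"
  let ?M = "max m j"
  let ?c = "\<Sum>w\<in>{w \<in> L ?M. trunc j w = y}. cinner h (blinfun_apply (P ?M w) k) / of_nat (N ?M)"
  have "eventually (\<lambda>n. average n (P n) j y h k = ?c) sequentially"
    using eventually_ge_at_top [of ?M]
  proof eventually_elim
    case (elim n)
    have "average n (P n) j y h k = (\<Sum>w\<in>{w \<in> L ?M. trunc j w = y}. average n (P n) ?M w h k)"
      using elim by (intro average_descendants [OF y]) auto
    also have "\<dots> = ?c"
      using elim by (intro sum.cong refl average_martingale mart) auto
    finally show ?case .
  qed
  then show "convergent (\<lambda>n. average n (P n) j y h k)"
    unfolding convergent_def by (intro exI [of _ ?c] tendsto_eventually)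
qed

lemma G_E: "w \<in> G m \<Longrightarrow> (\<And>x h n. w = t (e x) h \<Longrightarrow> x \<in> L n \<Longrightarrow> m \<le> n \<Longrightarrow> thesis) \<Longrightarrow> thesis"
  unfolding G_def by blast

section \<open>Multiplication by indicator functions of cylinders\<close>

lemma q_norm: "f \<in> sq_integrable \<mu> \<Longrightarrow> (norm (q f))\<^sup>2 = (\<integral>\<omega>. (norm (f \<omega>))\<^sup>2 \<partial>\<mu>)"
proof -
  assume f: "f \<in> sq_integrable \<mu>"
  have "complex_of_real ((norm (q f))\<^sup>2) = (\<integral>\<omega>. cnj (f \<omega>) * f \<omega> \<partial>\<mu>)"
    by (simp only: cinner_self [symmetric] q_inner [OF f f])
  also have "\<dots> = (\<integral>\<omega>. complex_of_real ((norm (f \<omega>))\<^sup>2) \<partial>\<mu>)"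
    by (simp only: complex_norm_square mult.commute)
  also have "\<dots> = complex_of_real (\<integral>\<omega>. (norm (f \<omega>))\<^sup>2 \<partial>\<mu>)"
    by (rule integral_complex_of_real)
  finally show ?thesis by (simp only: of_real_eq_iff)
qed

lemma sq_indicator_mult: "A \<in> sets \<mu> \<Longrightarrow> f \<in> sq_integrable \<mu> \<Longrightarrow> (\<lambda>\<omega>. indicator A \<omega> * f \<omega>) \<in> sq_integrable \<mu>"
  by (rule sq_bounded_mult) (auto simp: indicator_def)

text \<open>Multiplication by an indicator function contracts the L2 norm, so it respects classes;
  \<open>r\<close> picks representatives, and \<open>m\<close> does not depend on them.\<close>

lemma multiplication_exists:
  assumes A: "A \<in> sets \<mu>"
  shows "\<exists>M\<in>bounded_ops. \<forall>g\<in>sq_integrable \<mu>. blinfun_apply M (q g) = q (\<lambda>\<omega>. indicator A \<omega> * g \<omega>)"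
proof -
  let ?I = "\<lambda>g \<omega>. indicator A \<omega> * g \<omega> :: complex"
  note I = sq_indicator_mult [OF A]
  have contr: "norm (q (?I g)) \<le> norm (q g)" if g: "g \<in> sq_integrable \<mu>" for g
  proof -
    have "(norm (q (?I g)))\<^sup>2 \<le> (norm (q g))\<^sup>2"
      unfolding q_norm [OF g] q_norm [OF I [OF g]]
      by (intro integral_mono sq_integrable_norm g I) (auto simp: indicator_def)
    then show ?thesis by (rule power2_le_imp_le) simp
  qed
  have I_add: "?I (f + g) = ?I f + ?I g" and I_scale: "?I (c *\<^sub>C f) = c *\<^sub>C ?I f" for f g :: "(nat \<Rightarrow> nat) \<Rightarrow> complex" and c
    by (auto simp: fun_eq_iff distrib_left scaleC_fun_def scaleC_complex_def)
  obtain r where r: "\<And>\<xi>. r \<xi> \<in> sq_integrable \<mu>" "\<And>\<xi>. q (r \<xi>) = \<xi>" using q_surj by metis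
  define m where "m \<xi> = q (?I (r \<xi>))" for \<xi>
  have m: "m (q g) = q (?I g)" if g: "g \<in> sq_integrable \<mu>" for g
  proof -
    \<comment> \<open>The difference of two representatives of one class: its class is 0 and remains
      0 after multiplication, by \<open>contr\<close>.\<close>
    define h where "h = r (q g) + (-1) *\<^sub>C g"
    have h: "h \<in> sq_integrable \<mu>" unfolding h_def by (intro sq_add sq_scaleC r g)
    have "q h = q (r (q g)) + (-1) *\<^sub>C q g"
      unfolding h_def using r g sq_scaleC [OF g] by (simp only: q_add q_scaleC)
    then have "q h = 0" by (simp add: r scaleC_minus_one)
    then have "q (?I h) = 0" using contr [OF h] by simp
    moreover have "q (?I h) = m (q g) + (-1) *\<^sub>C q (?I g)"
      unfolding h_def I_add I_scale m_def
      using I [OF r(1)] I [OF g] sq_scaleC [OF I [OF g]] by (simp only: q_add q_scaleC)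
    ultimately show ?thesis by (simp add: scaleC_minus_one)
  qed
  have m_add: "m (\<xi> + \<eta>) = m \<xi> + m \<eta>" for \<xi> \<eta>
  proof -
    have "m (\<xi> + \<eta>) = m (q (r \<xi> + r \<eta>))" by (simp add: q_add r)
    also have "\<dots> = q (?I (r \<xi>) + ?I (r \<eta>))" by (simp only: m sq_add r I_add)
    also have "\<dots> = m \<xi> + m \<eta>" using I [OF r(1)] by (simp only: q_add m_def)
    finally show ?thesis .
  qed
  have m_scale: "m (c *\<^sub>C \<xi>) = c *\<^sub>C m \<xi>" for c \<xi>
  proof -
    have "m (c *\<^sub>C \<xi>) = m (q (c *\<^sub>C r \<xi>))" by (simp add: q_scaleC r)
    also have "\<dots> = q (c *\<^sub>C ?I (r \<xi>))" by (simp only: m sq_scaleC r I_scale)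
    also have "\<dots> = c *\<^sub>C m \<xi>" using I [OF r(1)] by (simp only: q_scaleC m_def)
    finally show ?thesis .
  qed
  have bl: "bounded_linear m"
  proof (rule bounded_linear_intro [where K = 1])
    show "norm (m \<xi>) \<le> norm \<xi> * 1" for \<xi> using contr [OF r(1), of \<xi>] by (simp add: m_def r)
  qed (simp_all add: m_add m_scale scaleR_scaleC)
  show ?thesis
    by (intro bexI [of _ "Blinfun m"])
      (simp_all add: bounded_linear_Blinfun_apply bl bounded_ops_def m_scale m)
qed

definition mult :: "'x \<times> nat list \<Rightarrow> 'l \<Rightarrow>\<^sub>L 'l" where
  "mult x = (SOME M. M \<in> bounded_ops \<and>
    (\<forall>g\<in>sq_integrable \<mu>. blinfun_apply M (q g) = q (\<lambda>\<omega>. indicator (cylinder d b x) \<omega> * g \<omega>)))"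

lemma mult:
  assumes "x \<in> L n"
  shows mult_bounded_ops: "mult x \<in> bounded_ops"
    and mult_q: "g \<in> sq_integrable \<mu> \<Longrightarrow>
      blinfun_apply (mult x) (q g) = q (\<lambda>\<omega>. indicator (cylinder d b x) \<omega> * g \<omega>)"
proof -
  have "mult x \<in> bounded_ops \<and>
    (\<forall>g\<in>sq_integrable \<mu>. blinfun_apply (mult x) (q g) = q (\<lambda>\<omega>. indicator (cylinder d b x) \<omega> * g \<omega>))"
    unfolding mult_def by (rule someI_ex) (use multiplication_exists [OF sets_cylinder [OF assms]] in blast)
  then show "mult x \<in> bounded_ops"
    "g \<in> sq_integrable \<mu> \<Longrightarrow> blinfun_apply (mult x) (q g) = q (\<lambda>\<omega>. indicator (cylinder d b x) \<omega> * g \<omega>)"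
    by auto
qed

lemma mult_e: "x \<in> L n \<Longrightarrow> blinfun_apply (mult x) (e x) = e x"
  by (simp add: e_def mult_q sq_cylinder indicator_inter_arith [symmetric])

lemma mult_Linf: "x \<in> L n \<Longrightarrow> mult x \<in> Linf_ops \<mu> q"
proof -
  assume x: "x \<in> L n"
  have "(indicator (cylinder d b x) :: _ \<Rightarrow> complex) \<in> borel_measurable \<mu>"
    using sets_cylinder [OF x] by simp
  moreover have "AE \<omega> in \<mu>. norm (indicator (cylinder d b x) \<omega> :: complex) \<le> 1"
    by (simp add: indicator_def)
  ultimately show ?thesis
    unfolding Linf_ops_def using mult_bounded_ops [OF x] mult_q [OF x] by blast
qed

lemma inner_mult:
  assumes x: "x \<in> L i" and z: "z \<in> L n" and i: "i \<le> n"
  shows "cinner (e z) (blinfun_apply (mult x) \<xi>) = (if trunc i z = x then cinner (e z) \<xi> else 0)"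
proof -
  obtain f where f: "f \<in> sq_integrable \<mu>" "q f = \<xi>" using q_surj by blast
  have "cinner (e z) (blinfun_apply (mult x) \<xi>) =
      (\<integral>\<omega>. indicator (cylinder d b x \<inter> cylinder d b z) \<omega> * f \<omega> \<partial>\<mu>)"
    unfolding f(2) [symmetric] mult_q [OF x f(1)] e_def
      q_inner [OF sq_cylinder [OF z] sq_indicator_mult [OF sets_cylinder [OF x] f(1)]]
    by (intro Bochner_Integration.integral_cong refl) (auto simp: indicator_def)
  also have "\<dots> = (if trunc i z = x then \<integral>\<omega>. cnj (indicator (cylinder d b z) \<omega>) * f \<omega> \<partial>\<mu> else 0)"
    unfolding cylinder_trunc [OF z x i] by (auto simp: indicator_def intro!: Bochner_Integration.integral_cong)
  also have "\<dots> = (if trunc i z = x then cinner (e z) \<xi> else 0)"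
    unfolding f(2) [symmetric] e_def q_inner [OF sq_cylinder [OF z] f(1)] ..
  finally show ?thesis .
qed

text \<open>Group the cylinders of level \<open>m\<close> by their ancestors at level
  \<open>n\<close>; on each group the integral is the one already attained at level
  \<open>n\<close>.\<close>

lemma form_martingale:
  assumes x: "x \<in> L i" "i \<le> n" and y: "y \<in> L j" "j \<le> n" and m: "n \<le> m"
    and P: "\<And>n x. x \<in> L n \<Longrightarrow> P n x \<in> bounded_ops"
    and mart: "\<And>m x. n \<le> m \<Longrightarrow> x \<in> L m \<Longrightarrow> (\<Sum>i=1..d m. P (Suc m) (append_index x i)) = of_nat (d m) *\<^sub>C P m x"
  shows "form m (P m) (t (e x) h) (t (e y) k) = form n (P n) (t (e x) h) (t (e y) k)"
proof -
  have im: "i \<le> m" "j \<le> m" using x y m by auto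
  have n1: "1 \<le> n" using level_ge_1 [OF x(1)] x(2) by simp
  let ?W = "{w \<in> L n. trunc i w = x \<and> trunc j w = y}"
  have set: "{z \<in> L m. trunc i z = x \<and> trunc j z = y} = (\<Union>w\<in>?W. {z \<in> L m. trunc n z = w})"
  proof (intro equalityI subsetI)
    fix z assume "z \<in> {z \<in> L m. trunc i z = x \<and> trunc j z = y}"
    then show "z \<in> (\<Union>w\<in>?W. {z \<in> L m. trunc n z = w})"
      using trunc_trunc [OF x(2), of z] trunc_trunc [OF y(2), of z] trunc_in_level [OF n1 m, of z]
      by (intro UN_I [of "trunc n z"]) auto
  next
    fix z assume "z \<in> (\<Union>w\<in>?W. {z \<in> L m. trunc n z = w})"
    then show "z \<in> {z \<in> L m. trunc i z = x \<and> trunc j z = y}"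
      using trunc_trunc [OF x(2), of z] trunc_trunc [OF y(2), of z] by auto
  qed
  have "form m (P m) (t (e x) h) (t (e y) k) =
      (\<Sum>z\<in>(\<Union>w\<in>?W. {z \<in> L m. trunc n z = w}). cinner h (blinfun_apply (P m z) k)) / of_nat (N m)"
    by (simp only: form_G [OF x(1) im(1) y(1) im(2) P] set)
  also have "\<dots> = (\<Sum>w\<in>?W. average m (P m) n w h k)"
    by (subst sum.UNION_disjoint) (auto simp: finite_level average_def sum_divide_distrib)
  also have "\<dots> = (\<Sum>w\<in>?W. cinner h (blinfun_apply (P n w) k) / of_nat (N n))"
    using m by (intro sum.cong refl average_martingale [where m = n] mart) auto
  also have "\<dots> = form n (P n) (t (e x) h) (t (e y) k)"
    by (simp only: form_G [OF x y P] sum_divide_distrib)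
  finally show ?thesis .
qed

lemma represents_martingale_form:
  assumes R: "represents R P" and x: "x \<in> L i" "i \<le> n" and y: "y \<in> L j" "j \<le> n"
    and P: "\<And>n x. x \<in> L n \<Longrightarrow> P n x \<in> bounded_ops"
    and mart: "\<And>m x. n \<le> m \<Longrightarrow> x \<in> L m \<Longrightarrow> (\<Sum>i=1..d m. P (Suc m) (append_index x i)) = of_nat (d m) *\<^sub>C P m x"
  shows "cinner (t (e x) h) (blinfun_apply R (t (e y) k)) = form n (P n) (t (e x) h) (t (e y) k)"
proof (rule LIMSEQ_unique)
  show "(\<lambda>m. form m (P m) (t (e x) h) (t (e y) k)) \<longlonglongrightarrow> cinner (t (e x) h) (blinfun_apply R (t (e y) k))"
    using R by (simp add: represents_def)
  have "eventually (\<lambda>m. form m (P m) (t (e x) h) (t (e y) k) = form n (P n) (t (e x) h) (t (e y) k)) sequentially"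
    using eventually_ge_at_top [of n] by eventually_elim (rule form_martingale [OF x y _ P mart])
  then show "(\<lambda>m. form m (P m) (t (e x) h) (t (e y) k)) \<longlonglongrightarrow> form n (P n) (t (e x) h) (t (e y) k)"
    by (rule tendsto_eventually)
qed

text \<open>At level \<open>j\<close> the only descendant of \<open>y\<close> is \<open>y\<close>
  itself, so the limit is attained as soon as the finer of the two vectors is resolved.\<close>

lemma represents_martingale_value:
  assumes R: "represents R P" and z: "z \<in> L n" and y: "y \<in> L j" "n \<le> j"
    and P: "\<And>n x. x \<in> L n \<Longrightarrow> P n x \<in> bounded_ops"
    and mart: "\<And>m x. j \<le> m \<Longrightarrow> x \<in> L m \<Longrightarrow> (\<Sum>i=1..d m. P (Suc m) (append_index x i)) = of_nat (d m) *\<^sub>C P m x"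
  shows "cinner (t (e z) h) (blinfun_apply R (t (e y) k)) =
      (if trunc n y = z then cinner h (blinfun_apply (P j y) k) / of_nat (N j) else 0)"
    and "cinner (t (e y) h) (blinfun_apply R (t (e z) k)) =
      (if trunc n y = z then cinner h (blinfun_apply (P j y) k) / of_nat (N j) else 0)"
proof -
  have single: "{w \<in> L j. trunc j w = y} = {y}" using y(1) trunc_self by auto
  show "cinner (t (e z) h) (blinfun_apply R (t (e y) k)) =
      (if trunc n y = z then cinner h (blinfun_apply (P j y) k) / of_nat (N j) else 0)"
    by (simp add: represents_martingale_form [OF R z y(2) y(1) order_refl P mart] form_average [OF z y(1) y(2) order_refl P] average_def single)
  show "cinner (t (e y) h) (blinfun_apply R (t (e z) k)) =
      (if trunc n y = z then cinner h (blinfun_apply (P j y) k) / of_nat (N j) else 0)"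
    by (simp add: represents_martingale_form [OF R y(1) order_refl z y(2) P mart] form_average [OF z y(1) y(2) order_refl P] average_def single)
qed

section \<open>The identity and elementary tensors as martingales\<close>

lemma sum_const_scaleC: "(\<Sum>i=1..n. T) = of_nat n *\<^sub>C (T :: 'h \<Rightarrow>\<^sub>L 'h)"
  by (intro blinfun_eqI) (simp add: blinfun.sum_left scaleC_blinfun.rep_eq scaleR_scaleC sum_constant_scaleR blinfun.scaleR_left)

text \<open>For the constant family, \<open>form n\<close> belongs to the projection onto the
  vectors of level \<open>n\<close>. The weak limit of these projections is identified by its
  entries on test vectors.\<close>

lemma represents_id: "represents id_blinfun (\<lambda>_ _. id_blinfun)"
proof -
  obtain R where R: "represents R (\<lambda>_ _. id_blinfun)"
    using represents_martingale [of "\<lambda>_ _. id_blinfun" 1 0] sum_const_scaleC by (auto simp: id_bounded_ops norm_blinfun_id_le)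
  have "R = id_blinfun"
  proof (rule op_ext_G [of _ _ 0])
    show "R \<in> bounded_ops" using R by (simp add: represents_def)
    fix u v assume "u \<in> G 0" "v \<in> G 0"
    then obtain x i h y j k where u: "u = t (e x) h" "x \<in> L i" and v: "v = t (e y) k" "y \<in> L j"
      by (blast elim: G_E)
    note val = represents_martingale_value [OF R _ _ _ id_bounded_ops sum_const_scaleC]
    show "cinner u (blinfun_apply R v) = cinner u (blinfun_apply id_blinfun v)"
    proof (cases "i \<le> j")
      case True
      then show ?thesis by (simp add: u v val(1) [OF u(2) v(2)] t_inner inner_e [OF u(2) v(2)])
    next
      case False
      then show ?thesis by (simp add: u v val(2) [OF v(2) u(2)] t_inner inner_e' [OF v(2) u(2)])
    qed
  qed (rule id_bounded_ops)
  with R show ?thesis by simp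
qed

text \<open>\<open>elem i x T\<close> is the operator \<open>1\<^sub>x \<otimes> T\<close>; it is itself represented by a martingale.\<close>

definition elem_family :: "nat \<Rightarrow> 'x \<times> nat list \<Rightarrow> ('h \<Rightarrow>\<^sub>L 'h) \<Rightarrow> nat \<Rightarrow> 'x \<times> nat list \<Rightarrow> 'h \<Rightarrow>\<^sub>L 'h" where
  "elem_family i x T n z = (if trunc i z = x then T else 0)"

definition elem :: "nat \<Rightarrow> 'x \<times> nat list \<Rightarrow> ('h \<Rightarrow>\<^sub>L 'h) \<Rightarrow> 'k \<Rightarrow>\<^sub>L 'k" where
  "elem i x T = (SOME R. represents R (elem_family i x T))"

lemma elem_family_bounded_ops: "T \<in> bounded_ops \<Longrightarrow> elem_family i x T n z \<in> bounded_ops"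
  by (simp add: elem_family_def csubspace_zero [OF csubspace_bounded_ops])

lemma elem_family_martingale:
  "i \<le> m \<Longrightarrow> z \<in> L m \<Longrightarrow> (\<Sum>l=1..d m. elem_family i x T (Suc m) (append_index z l)) = of_nat (d m) *\<^sub>C elem_family i x T m z"
  unfolding elem_family_def sum_const_scaleC [symmetric]
  by (intro sum.cong refl) (simp add: trunc_append)

lemma elem_represents: "T \<in> bounded_ops \<Longrightarrow> represents (elem i x T) (elem_family i x T)"
proof -
  assume T: "T \<in> bounded_ops"
  have "\<exists>R. represents R (elem_family i x T)"
    by (rule represents_martingale [where C = "norm T" and m = i])
      (use T elem_family_bounded_ops elem_family_martingale in \<open>auto simp: elem_family_def\<close>)
  then show ?thesis unfolding elem_def by (rule someI_ex)
qed

lemma elem_bounded_ops: "T \<in> bounded_ops \<Longrightarrow> elem i x T \<in> bounded_ops"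
  using elem_represents by (simp add: represents_def)

text \<open>Both sides are tested against \<open>w\<close> of level at least \<open>i\<close>, and
  then, for such \<open>w\<close>, compared as functionals of \<open>\<xi>\<close> on vectors
  \<open>e y\<close> at least as fine as \<open>w\<close>, where all entries are explicit.\<close>

lemma elem_apply:
  assumes T: "T \<in> bounded_ops" and x: "x \<in> L i"
  shows "blinfun_apply (elem i x T) (t \<xi> h) = t (blinfun_apply (mult x) \<xi>) (blinfun_apply T h)"
proof -
  have "cinner (blinfun_apply (elem i x T) (t \<xi> h) - t (blinfun_apply (mult x) \<xi>) (blinfun_apply T h)) w = 0"
    if wG: "w \<in> G i" for w
  proof -
    obtain z n k where w: "w = t (e z) k" "z \<in> L n" "i \<le> n" using wG by (blast elim: G_E)
    let ?f = "\<lambda>\<xi>. cinner w (blinfun_apply (elem i x T) (t \<xi> h)) - cinner w (t (blinfun_apply (mult x) \<xi>) (blinfun_apply T h))"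
    let ?G = "{e y | y j. n \<le> j \<and> y \<in> L j}"
    have "?f \<xi> = 0"
    proof (rule total_functional_zero [where G = ?G and f = ?f and
          C = "norm w * norm (elem i x T) * norm h + norm w * norm (mult x) * norm (blinfun_apply T h)"])
      show "u = 0" if "\<And>w. w \<in> ?G \<Longrightarrow> cinner u w = 0" for u
        by (rule total_e [of n]) (use that in blast)
      show "?f (\<xi> + \<eta>) = ?f \<xi> + ?f \<eta>" for \<xi> \<eta>
        by (simp add: t_add_left blinfun.add_right cinner_add_right)
      show "?f (c *\<^sub>C \<xi>) = c * ?f \<xi>" for c \<xi>
        by (simp add: t_scaleC_left bounded_opsD [OF elem_bounded_ops [OF T]] bounded_opsD [OF mult_bounded_ops [OF x]]
            cinner_scaleC_right right_diff_distrib)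
      show "norm (?f \<xi>) \<le> (norm w * norm (elem i x T) * norm h + norm w * norm (mult x) * norm (blinfun_apply T h)) * norm \<xi>" for \<xi>
      proof -
        have 1: "norm (cinner w (blinfun_apply (elem i x T) (t \<xi> h))) \<le> norm (elem i x T) * norm w * (norm \<xi> * norm h)"
          using cinner_blinfun_bound [of w "elem i x T" "t \<xi> h"] by (simp add: t_norm)
        have "norm (cinner w (t (blinfun_apply (mult x) \<xi>) (blinfun_apply T h))) \<le> norm w * (norm (blinfun_apply (mult x) \<xi>) * norm (blinfun_apply T h))"
          using cinner_Cauchy_Schwarz [of w "t (blinfun_apply (mult x) \<xi>) (blinfun_apply T h)"] by (simp add: t_norm)
        also have "\<dots> \<le> norm w * ((norm (mult x) * norm \<xi>) * norm (blinfun_apply T h))"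
          by (intro mult_left_mono mult_right_mono norm_blinfun) auto
        finally show ?thesis
          using 1 norm_triangle_ineq4 [of "cinner w (blinfun_apply (elem i x T) (t \<xi> h))" "cinner w (t (blinfun_apply (mult x) \<xi>) (blinfun_apply T h))"]
          by (simp add: algebra_simps)
      qed
      fix v assume "v \<in> ?G"
      then obtain y j where v: "v = e y" "n \<le> j" "y \<in> L j" by blast
      have "cinner w (blinfun_apply (elem i x T) (t (e y) h)) =
          (if trunc n y = z then cinner k (blinfun_apply (elem_family i x T j y) h) / of_nat (N j) else 0)"
        unfolding w(1) using w(3) v(2)
        by (intro represents_martingale_value [OF elem_represents [OF T] w(2) v(3) v(2)]
            elem_family_bounded_ops T elem_family_martingale) auto
      moreover have "trunc i z = trunc i y" if "trunc n y = z"
        using trunc_trunc [OF w(3), of y] that by simp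
      ultimately show "?f v = 0"
        unfolding v(1) by (simp add: w(1) t_inner inner_mult [OF x w(2,3)] inner_e [OF w(2) v(3,2)] elem_family_def cinner.zero_right)
    qed
    then show ?thesis
      by (subst cinner_commute) (simp add: cinner.diff_right)
  qed
  then have "blinfun_apply (elem i x T) (t \<xi> h) - t (blinfun_apply (mult x) \<xi>) (blinfun_apply T h) = 0"
    by (rule total_G)
  then show ?thesis by simp
qed

section \<open>The von Neumann algebra tensor product\<close>

abbreviation "simple_tensors \<equiv> {R \<in> bounded_ops. \<exists>S\<in>Linf_ops \<mu> q. \<exists>T\<in>bounded_ops.
     \<forall>x y. blinfun_apply R (t x y) = t (blinfun_apply S x) (blinfun_apply T y)}"

abbreviation "vn \<equiv> vn_tensor t (Linf_ops \<mu> q) bounded_ops"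

lemma elem_simple: "T \<in> bounded_ops \<Longrightarrow> x \<in> L i \<Longrightarrow> elem i x T \<in> simple_tensors"
  using elem_bounded_ops elem_apply mult_Linf by blast

lemma vn_bounded_ops: "vn \<subseteq> bounded_ops"
  by (auto simp: vn_tensor_def commutant_def)

text \<open>\<open>R\<close> is the weak limit of the operators \<open>\<Sum>\<^sub>x 1\<^sub>x \<otimes> P n x\<close>, and commutants are weakly closed.\<close>

lemma represents_in_vn:
  assumes R: "represents R P"
    and P: "\<And>n x. x \<in> L n \<Longrightarrow> P n x \<in> bounded_ops" "\<And>n x. x \<in> L n \<Longrightarrow> norm (P n x) \<le> C" and C: "0 \<le> C"
  shows "R \<in> vn"
proof -
  define Rn where "Rn n = (\<Sum>x\<in>L n. elem n x (P n x))" for n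
  \<comment> \<open>The martingale of \<open>Rn n\<close>: its value at \<open>w\<close> is
    \<open>P n\<close> at the ancestor of \<open>w\<close> of level \<open>n\<close>, so on vectors
    up to that level \<open>Rn n\<close> has exactly the form \<open>form n (P n)\<close>.\<close>
  define F where "F n m w = (\<Sum>x\<in>L n. elem_family n x (P n x) m w)" for n m w
  have F: "F n m w = (if trunc n w \<in> L n then P n (trunc n w) else 0)" for n m w
    by (simp add: F_def elem_family_def finite_level)
  have F_ops: "F n m w \<in> bounded_ops" for n m w
    by (simp add: F P csubspace_zero [OF csubspace_bounded_ops])
  have Rn_repr: "represents (Rn n) (F n)" for n
    unfolding Rn_def F_def [abs_def] by (intro represents_sum elem_represents P)
  have Rn_ops: "Rn n \<in> bounded_ops" for n using Rn_repr by (simp add: represents_def)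
  have Rn_bound: "norm (cinner u (blinfun_apply (Rn n) v)) \<le> C * norm u * norm v" for n u v
    by (rule represents_bound [OF Rn_repr]) (simp_all add: F P C)
  have F_mart: "(\<Sum>l=1..d m. F n (Suc m) (append_index z l)) = of_nat (d m) *\<^sub>C F n m z" if "n \<le> m" "z \<in> L m" for n m z
    unfolding F_def using elem_family_martingale [OF that] by (subst sum.swap) (simp add: scaleC_sum_right)
  have Rn_lim: "(\<lambda>n. cinner u (blinfun_apply (Rn n) v)) \<longlonglongrightarrow> cinner u (blinfun_apply R v)" if uv: "u \<in> G 0" "v \<in> G 0" for u v
  proof -
    obtain x i h y j k where u: "u = t (e x) h" "x \<in> L i" and v: "v = t (e y) k" "y \<in> L j"
      using uv by (blast elim: G_E)
    have ev: "eventually (\<lambda>n. form n (P n) u v = cinner u (blinfun_apply (Rn n) v)) sequentially"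
      using eventually_ge_at_top [of i] eventually_ge_at_top [of j]
    proof eventually_elim
      case (elim n)
      have "cinner u (blinfun_apply (Rn n) v) = form n (F n n) u v"
        unfolding u(1) v(1) by (rule represents_martingale_form [OF Rn_repr u(2) elim(1) v(2) elim(2) F_ops F_mart])
      then show ?case by (simp add: form_def F trunc_self)
    qed
    have "(\<lambda>n. form n (P n) u v) \<longlonglongrightarrow> cinner u (blinfun_apply R v)" using R by (simp add: represents_def)
    then show ?thesis using ev by (rule Lim_transform_eventually)
  qed
  have "\<exists>R'\<in>bounded_ops. \<forall>u v. (\<lambda>n. cinner u (blinfun_apply (Rn n) v)) \<longlonglongrightarrow> cinner u (blinfun_apply R' v)"
  proof (rule weak_limit_operator [where C = C and G = "G 0"])
    show "convergent (\<lambda>n. cinner u (blinfun_apply (Rn n) v))" if "u \<in> G 0" "v \<in> G 0" for u v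
      using Rn_lim [OF that] by (rule convergentI)
  qed (use total_G [of 0] in \<open>auto simp: Rn_bound cinner_add_left cinner_add_right blinfun.add_right
      cinner_scaleC_left cinner_scaleC_right bounded_opsD [OF Rn_ops]\<close>)
  then obtain R' where R': "R' \<in> bounded_ops" "\<And>u v. (\<lambda>n. cinner u (blinfun_apply (Rn n) v)) \<longlonglongrightarrow> cinner u (blinfun_apply R' v)"
    by blast
  have R_ops: "R \<in> bounded_ops" using R by (simp add: represents_def)
  have "R' = R"
    by (rule op_ext_G [OF R'(1) R_ops]) (rule LIMSEQ_unique [OF R'(2) Rn_lim])
  then have lim: "(\<lambda>n. cinner u (blinfun_apply (Rn n) v)) \<longlonglongrightarrow> cinner u (blinfun_apply R v)" for u v
    using R'(2) by simp
  have "R o\<^sub>L Z = Z o\<^sub>L R" if Z: "Z \<in> commutant simple_tensors" for Z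
  proof (rule bounded_ops_ext)
    fix u v
    have Z_ops: "Z \<in> bounded_ops" using Z by (simp add: commutant_def)
    have "blinfun_apply Z (blinfun_apply (elem n x (P n x)) v) = blinfun_apply (elem n x (P n x)) (blinfun_apply Z v)"
      if "x \<in> L n" for n x
    proof -
      have "Z o\<^sub>L elem n x (P n x) = elem n x (P n x) o\<^sub>L Z"
        using Z elem_simple [OF P(1) [OF that] that] unfolding commutant_def by blast
      from arg_cong [OF this, of "\<lambda>T. blinfun_apply T v"] show ?thesis by simp
    qed
    then have comm: "blinfun_apply Z (blinfun_apply (Rn n) v) = blinfun_apply (Rn n) (blinfun_apply Z v)" for n
      by (simp add: Rn_def blinfun.sum_left blinfun.sum_right)
    \<comment> \<open>\<open>Z\<close> is moved to the left vector by its adjoint, where weak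
      convergence can be applied.\<close>
    have "(\<lambda>n. cinner (blinfun_apply (cadjoint Z) u) (blinfun_apply (Rn n) v)) \<longlonglongrightarrow>
        cinner (blinfun_apply (cadjoint Z) u) (blinfun_apply R v)"
      by (rule lim)
    then have "(\<lambda>n. cinner u (blinfun_apply (Rn n) (blinfun_apply Z v))) \<longlonglongrightarrow> cinner u (blinfun_apply Z (blinfun_apply R v))"
      by (simp add: cinner_cadjoint [OF Z_ops] comm)
    then show "cinner u (blinfun_apply (R o\<^sub>L Z) v) = cinner u (blinfun_apply (Z o\<^sub>L R) v)"
      using lim [of u "blinfun_apply Z v"] by (simp add: LIMSEQ_unique)
  qed
  with R_ops show ?thesis by (simp add: vn_tensor_def commutant_def [of "commutant _"])
qed

text \<open>Multiplications commute pointwise; the point is that the essentially bounded multiple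
  \<open>f * g\<close> is again square integrable, so that \<open>mult_q\<close> applies to
  it.\<close>

lemma Linf_mult_commute:
  assumes S: "S \<in> Linf_ops \<mu> q" and x: "x \<in> L n"
  shows "blinfun_apply S (blinfun_apply (mult x) \<xi>) = blinfun_apply (mult x) (blinfun_apply S \<xi>)"
proof -
  obtain f c where f: "f \<in> borel_measurable \<mu>" "AE \<omega> in \<mu>. norm (f \<omega>) \<le> c"
    "\<And>g. g \<in> sq_integrable \<mu> \<Longrightarrow> blinfun_apply S (q g) = q (\<lambda>\<omega>. f \<omega> * g \<omega>)"
    using S by (auto simp: Linf_ops_def)
  obtain g where g: "g \<in> sq_integrable \<mu>" "q g = \<xi>" using q_surj by blast
  have m: "g \<in> borel_measurable \<mu>" by (rule sq_measurable [OF g(1)])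
  have "integrable \<mu> (\<lambda>\<omega>. (norm (f \<omega> * g \<omega>))\<^sup>2)"
  proof (rule Bochner_Integration.integrable_bound)
    show "integrable \<mu> (\<lambda>\<omega>. c\<^sup>2 * (norm (g \<omega>))\<^sup>2)" using sq_integrable_norm [OF g(1)] by simp
    show "(\<lambda>\<omega>. (norm (f \<omega> * g \<omega>))\<^sup>2) \<in> borel_measurable \<mu>" using m f(1) by measurable
    show "AE \<omega> in \<mu>. norm ((norm (f \<omega> * g \<omega>))\<^sup>2) \<le> norm (c\<^sup>2 * (norm (g \<omega>))\<^sup>2)"
      using f(2) by eventually_elim (simp add: norm_mult power_mult_distrib mult_right_mono power_mono)
  qed
  then have fg: "(\<lambda>\<omega>. f \<omega> * g \<omega>) \<in> sq_integrable \<mu>" using m f(1) by (simp add: sq_integrable_def)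
  show ?thesis
    unfolding g(2) [symmetric]
    by (simp add: mult_q [OF x] g(1) fg f(3) sq_indicator_mult [OF sets_cylinder [OF x]] mult.left_commute)
qed

text \<open>Both facts needed are that L-infinity is commutative and that \<open>id_blinfun\<close>
  commutes with every \<open>T\<close>. Operators of the double commutant hence commute with
  \<open>elem n x id_blinfun\<close>, which \<open>vn_offdiagonal\<close> exploits.\<close>

lemma elem_id_commutant: "x \<in> L n \<Longrightarrow> elem n x id_blinfun \<in> commutant simple_tensors"
proof -
  assume x: "x \<in> L n"
  note Q = elem_bounded_ops [OF id_bounded_ops, of n x]
  have "elem n x id_blinfun o\<^sub>L W = W o\<^sub>L elem n x id_blinfun" if W: "W \<in> simple_tensors" for W
  proof (rule op_ext_t)
    obtain S T where ST: "W \<in> bounded_ops" "S \<in> Linf_ops \<mu> q" "T \<in> bounded_ops"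
      "\<And>\<xi> h. blinfun_apply W (t \<xi> h) = t (blinfun_apply S \<xi>) (blinfun_apply T h)" using W by blast
    show "elem n x id_blinfun o\<^sub>L W \<in> bounded_ops" "W o\<^sub>L elem n x id_blinfun \<in> bounded_ops"
      using Q ST(1) by (simp_all add: bounded_ops_def)
    show "blinfun_apply (elem n x id_blinfun o\<^sub>L W) (t \<xi> h) = blinfun_apply (W o\<^sub>L elem n x id_blinfun) (t \<xi> h)" for \<xi> h
      by (simp add: ST(4) elem_apply [OF id_bounded_ops x] Linf_mult_commute [OF ST(2) x])
  qed
  with Q show ?thesis by (simp add: commutant_def)
qed

lemma vn_offdiagonal:
  assumes R: "R \<in> vn" and x: "x \<in> L n" and y: "y \<in> L n" and ne: "x \<noteq> y"
  shows "cinner (t (e x) h) (blinfun_apply R (t (e y) k)) = 0"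
proof -
  let ?Q = "elem n y id_blinfun"
  have "R o\<^sub>L ?Q = ?Q o\<^sub>L R"
    using R elem_id_commutant [OF y] unfolding vn_tensor_def commutant_def [of "commutant _"] by blast
  from arg_cong [OF this, of "\<lambda>T. blinfun_apply T (t (e y) k)"]
  have eq: "blinfun_apply R (t (e y) k) = blinfun_apply ?Q (blinfun_apply R (t (e y) k))"
    by (simp add: elem_apply [OF id_bounded_ops y] mult_e [OF y])
  \<comment> \<open>The range of \<open>?Q\<close> is orthogonal to \<open>t (e x) h\<close>, as the
    cylinders are disjoint; by \<open>eq\<close> the vector in question lies in that range.\<close>
  have "cinner (t (e x) h) (blinfun_apply ?Q w) = 0" for w
  proof (rule total_functional_zero [where G = "{t \<xi> k | \<xi> k. True}" and f = "\<lambda>w. cinner (t (e x) h) (blinfun_apply ?Q w)"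
        and C = "norm ?Q * norm (t (e x) h)"])
    show "cinner (t (e x) h) (blinfun_apply ?Q w) = 0" if "w \<in> {t \<xi> k | \<xi> k. True}" for w
      using that ne by (auto simp: elem_apply [OF id_bounded_ops y] t_inner inner_mult [OF y x order_refl] trunc_self [OF x])
    show "u = 0" if "\<And>w. w \<in> {t \<xi> k | \<xi> k. True} \<Longrightarrow> cinner u w = 0" for u
      by (rule total_t) (use that in blast)
  qed (simp_all add: blinfun.add_right cinner_add_right cinner_blinfun_bound
      bounded_opsD [OF elem_bounded_ops [OF id_bounded_ops]] cinner_scaleC_right)
  with eq show ?thesis by metis
qed

section \<open>Slices\<close>

lemma
  assumes R: "R \<in> bounded_ops"
  shows slice_bounded_ops: "slice t \<xi> R \<in> bounded_ops"
    and cinner_slice: "cinner h (blinfun_apply (slice t \<xi> R) k) = cinner (t \<xi> h) (blinfun_apply R (t \<xi> k))"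
proof -
  have "\<exists>E\<in>bounded_ops. \<forall>h k. cinner h (blinfun_apply E k) = cinner (t \<xi> h) (blinfun_apply R (t \<xi> k))"
  proof (rule bounded_ops_of_form [where C = "norm R * norm \<xi> * norm \<xi>"])
    show "norm (cinner (t \<xi> h) (blinfun_apply R (t \<xi> k))) \<le> norm R * norm \<xi> * norm \<xi> * norm h * norm k" for h k
      using cinner_blinfun_bound [of "t \<xi> h" R "t \<xi> k"] by (simp add: t_norm mult_ac)
  qed (simp_all add: t_add_right t_scaleC_right blinfun.add_right cinner_add_left cinner_add_right
      bounded_opsD [OF R] cinner_scaleC_left cinner_scaleC_right)
  then obtain E where E: "E \<in> bounded_ops" "\<And>h k. cinner h (blinfun_apply E k) = cinner (t \<xi> h) (blinfun_apply R (t \<xi> k))"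
    by blast
  have "slice t \<xi> R = E"
    unfolding slice_def
  proof (rule the_equality)
    fix E' assume "\<forall>h k. cinner h (blinfun_apply E' k) = cinner (t \<xi> h) (blinfun_apply R (t \<xi> k))"
    then show "E' = E" by (intro bounded_ops_ext) (simp add: E(2))
  qed (simp add: E(2))
  then show "slice t \<xi> R \<in> bounded_ops"
    "cinner h (blinfun_apply (slice t \<xi> R) k) = cinner (t \<xi> h) (blinfun_apply R (t \<xi> k))"
    using E by simp_all
qed

text \<open>Expand \<open>e x\<close> over its children on both sides; only the diagonal terms
  survive, by \<open>vn_offdiagonal\<close>. After normalisation this is the compatibility of the
  slices with \<gamma>.\<close>

lemma vn_slice_refine:
  assumes R: "R \<in> vn" and x: "x \<in> L n"
  shows "slice t (e x) R = (\<Sum>i=1..d n. slice t (e (append_index x i)) R)"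
proof (rule bounded_ops_ext)
  fix h k
  note Rb = subsetD [OF vn_bounded_ops R]
  let ?D = "{y \<in> L (Suc n). trunc n y = x}"
  have e: "e x = (\<Sum>y\<in>?D. e y)" by (rule e_descendants [OF level_ge_1 [OF x] _ x]) simp
  have "cinner (t (e x) h) (blinfun_apply R (t (e x) k)) =
      (\<Sum>y\<in>?D. \<Sum>z\<in>?D. cinner (t (e y) h) (blinfun_apply R (t (e z) k)))"
  proof -
    have t: "t (e x) h = (\<Sum>y\<in>?D. t (e y) h)" for h unfolding e by (rule t.sum_left)
    have "cinner (t (e x) h) (blinfun_apply R (t (e x) k)) = (\<Sum>y\<in>?D. cinner (t (e y) h) (blinfun_apply R (t (e x) k)))"
      by (subst t) (rule cinner.sum_left)
    also have "\<dots> = (\<Sum>y\<in>?D. \<Sum>z\<in>?D. cinner (t (e y) h) (blinfun_apply R (t (e z) k)))"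
      unfolding t [of k] by (simp only: blinfun.sum_right cinner.sum_right)
    finally show ?thesis .
  qed
  also have "\<dots> = (\<Sum>y\<in>?D. \<Sum>z\<in>?D. if z = y then cinner h (blinfun_apply (slice t (e y) R) k) else 0)"
    by (intro sum.cong refl) (simp add: vn_offdiagonal [OF R, of _ "Suc n"] cinner_slice [OF Rb])
  also have "\<dots> = (\<Sum>y\<in>?D. cinner h (blinfun_apply (slice t (e y) R) k))"
    by (simp add: finite_level)
  also have "\<dots> = (\<Sum>i=1..d n. cinner h (blinfun_apply (slice t (e (append_index x i)) R) k))"
    by (rule sum_children [OF x])
  finally show "cinner h (blinfun_apply (slice t (e x) R) k) =
      cinner h (blinfun_apply (\<Sum>i=1..d n. slice t (e (append_index x i)) R) k)"
    by (simp add: cinner_slice [OF Rb] blinfun.sum_left cinner.sum_right)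
qed

text \<open>Refine both test vectors to a common level: entries between different cylinders vanish,
  and the remaining ones are entries of slices.\<close>

lemma vn_ext:
  assumes R: "R \<in> vn" "R' \<in> vn"
    and slices: "\<And>n x. m \<le> n \<Longrightarrow> x \<in> L n \<Longrightarrow> slice t (e x) R = slice t (e x) R'"
  shows "R = R'"
proof (rule op_ext_G [of _ _ m])
  note Rb = subsetD [OF vn_bounded_ops R(1)] subsetD [OF vn_bounded_ops R(2)]
  show "R \<in> bounded_ops" "R' \<in> bounded_ops" by (rule Rb)+
  fix u v assume "u \<in> G m" "v \<in> G m"
  then obtain x i h y j k where u: "u = t (e x) h" "x \<in> L i" "m \<le> i" and v: "v = t (e y) k" "y \<in> L j"
    by (blast elim: G_E)
  let ?n = "max i j"
  have ex: "e x = (\<Sum>z\<in>{z \<in> L ?n. trunc i z = x}. e z)" and ey: "e y = (\<Sum>w\<in>{w \<in> L ?n. trunc j w = y}. e w)"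
    by (rule e_descendants [OF level_ge_1 [OF u(2)] _ u(2)], simp)
      (rule e_descendants [OF level_ge_1 [OF v(2)] _ v(2)], simp)
  have exp: "cinner u (blinfun_apply T v) = (\<Sum>w\<in>{w \<in> L ?n. trunc j w = y}. \<Sum>z\<in>{z \<in> L ?n. trunc i z = x}.
      cinner (t (e z) h) (blinfun_apply T (t (e w) k)))" for T
    unfolding u(1) v(1) ex ey by (simp add: t.sum_left blinfun.sum_right cinner.sum_left cinner.sum_right)
  have "cinner (t (e z) h) (blinfun_apply R (t (e w) k)) = cinner (t (e z) h) (blinfun_apply R' (t (e w) k))"
    if "z \<in> L ?n" "w \<in> L ?n" for z w
  proof (cases "z = w")
    case True
    then show ?thesis
      using slices [of ?n w] that u(3) cinner_slice [OF Rb(1), of h "e w" k] cinner_slice [OF Rb(2), of h "e w" k] by simp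
  next
    case False
    then show ?thesis using that by (simp add: vn_offdiagonal [OF R(1)] vn_offdiagonal [OF R(2)])
  qed
  then show "cinner u (blinfun_apply R v) = cinner u (blinfun_apply R' v)"
    unfolding exp by (intro sum.cong refl) auto
qed

end

section \<open>The correspondence\<close>

text \<open>Composition with \<open>h\<close>, extended by 0 as for all functions in
  \<open>fun_opsys\<close>. Lifting, sampling and refining are of this kind, so
  \<open>pullback_ucp\<close> treats them at once.\<close>

definition pullback :: "'p set \<Rightarrow> ('p \<Rightarrow> 'o) \<Rightarrow> ('o \<Rightarrow> complex) \<Rightarrow> 'p \<Rightarrow> complex" where
  "pullback \<Omega>' h f = (\<lambda>\<omega>. if \<omega> \<in> \<Omega>' then f (h \<omega>) else 0)"

lemma fun_opsys_simps [simp]: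
  "carr (fun_opsys \<Omega> F) = F" "ounit (fun_opsys \<Omega> F) = indicator \<Omega>"
  by (simp_all add: fun_opsys_def)

lemma pullback_ucp:
  assumes h: "h ` \<Omega>' \<subseteq> \<Omega>" and F: "\<And>f. f \<in> F \<Longrightarrow> pullback \<Omega>' h f \<in> F'"
  shows "is_ucp (fun_opsys \<Omega> F) (fun_opsys \<Omega>' F') (pullback \<Omega>' h)"
  unfolding is_ucp_def
proof (intro conjI ballI allI)
  show "pullback \<Omega>' h (ounit (fun_opsys \<Omega> F)) = ounit (fun_opsys \<Omega>' F')"
    using h by (auto simp: pullback_def fun_eq_iff indicator_def)
  show "(\<lambda>i j. pullback \<Omega>' h (X i j)) \<in> pos (fun_opsys \<Omega>' F') k" if X: "X \<in> pos (fun_opsys \<Omega> F) k" for X k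
  proof -
    have "(\<Sum>i<k. \<Sum>j<k. cnj (c i) * pullback \<Omega>' h (X i j) \<omega> * c j) \<in> \<real>\<^sub>\<ge>\<^sub>0" if "\<omega> \<in> \<Omega>'" for \<omega> and c :: "nat \<Rightarrow> complex"
      using X h that by (auto simp: fun_opsys_def pullback_def)
    then show ?thesis
      using X F by (auto simp: fun_opsys_def mats_def pullback_def)
  qed
qed (use F in \<open>auto simp: pullback_def fun_eq_iff scaleC_fun_def scaleC_complex_def\<close>)

lemma diag_carr: "carr (diag_opsys U) = {f. \<forall>u. u \<notin> U \<longrightarrow> f u = 0}"
  by (simp add: diag_opsys_def)

lemma cont_carr: "carr (cont_opsys \<Omega>) = {f. continuous_on \<Omega> f \<and> (\<forall>\<omega>. \<omega> \<notin> \<Omega> \<longrightarrow> f \<omega> = 0)}"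
  by (simp add: cont_opsys_def)

lemma csubspace_diag: "csubspace (carr (diag_opsys U))"
  by (auto simp: csubspace_def diag_carr scaleC_fun_def scaleC_complex_def)

lemma csubspace_cont: "csubspace (carr (cont_opsys \<Omega>))"
  by (auto simp: csubspace_def cont_carr scaleC_fun_def scaleC_complex_def plus_fun_def zero_fun_def
      intro!: continuous_intros)

lemma diag_norm_bound:
  assumes "is_ucp (diag_opsys U) (op_opsys M) \<phi>" "M \<subseteq> bounded_ops"
    and "c \<in> carr (diag_opsys U)" "0 \<le> r" "\<And>u. u \<in> U \<Longrightarrow> norm (c u) \<le> r"
  shows "norm (\<phi> c) \<le> r"
  by (rule is_ucp_norm_bound [OF assms(1) [unfolded diag_opsys_def] assms(2)])
    (use assms csubspace_diag in \<open>auto simp: diag_carr\<close>)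

lemma cont_norm_bound:
  assumes "is_ucp (cont_opsys \<Omega>) (op_opsys M) \<phi>" "M \<subseteq> bounded_ops"
    and "f \<in> carr (cont_opsys \<Omega>)" "0 \<le> r" "\<And>\<omega>. \<omega> \<in> \<Omega> \<Longrightarrow> norm (f \<omega>) \<le> r"
  shows "norm (\<phi> f) \<le> r"
proof (rule is_ucp_norm_bound [OF assms(1) [unfolded cont_opsys_def] assms(2)])
  have "continuous_on \<Omega> (indicator \<Omega> :: _ \<Rightarrow> complex)"
    by (rule continuous_on_cong [THEN iffD1, OF refl _ continuous_on_const [of _ 1]]) simp
  then show "indicator \<Omega> \<in> {f. continuous_on \<Omega> f \<and> (\<forall>\<omega>. \<omega> \<notin> \<Omega> \<longrightarrow> f \<omega> = (0 :: complex))}"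
    by simp
qed (use assms csubspace_cont [of \<Omega>] in \<open>auto simp: cont_carr intro!: continuous_intros\<close>)

lemma diag_expansion:
  assumes "finite U" "c \<in> carr (diag_opsys U)"
  shows "c = (\<Sum>u\<in>U. c u *\<^sub>C indicator {u})"
proof
  fix v
  have "(\<Sum>u\<in>U. c u *\<^sub>C indicator {u}) v = (\<Sum>u\<in>U. if u = v then c u else 0)"
    unfolding sum_apply_point by (intro sum.cong refl) (simp add: scaleC_fun_def scaleC_complex_def indicator_def)
  then show "c v = (\<Sum>u\<in>U. c u *\<^sub>C indicator {u}) v" using assms by (auto simp: diag_carr)
qed

lemma indicator_diag: "u \<in> U \<Longrightarrow> indicator {u} \<in> carr (diag_opsys U)"
  by (auto simp: diag_carr indicator_def)

lemma diag_ucp_expansion: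
  assumes U: "finite U" and c: "c \<in> carr (diag_opsys U)" and \<phi>: "is_ucp (diag_opsys U) R \<phi>"
  shows "\<phi> c = (\<Sum>u\<in>U. c u *\<^sub>C \<phi> (indicator {u}))"
proof -
  have "\<phi> c = \<phi> (\<Sum>u\<in>U. c u *\<^sub>C indicator {u})" by (simp only: diag_expansion [OF U c, symmetric])
  also have "\<dots> = (\<Sum>u\<in>U. \<phi> (c u *\<^sub>C indicator {u}))"
    by (intro is_ucp_sum [OF \<phi> csubspace_diag] csubspace_scaleC [OF csubspace_diag] indicator_diag)
  also have "\<dots> = (\<Sum>u\<in>U. c u *\<^sub>C \<phi> (indicator {u}))"
    by (intro sum.cong refl is_ucp_scaleC [OF \<phi>] indicator_diag)
  finally show ?thesis .
qed

section \<open>Cylinder functions and sampling\<close>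

context set_family
begin

lemma append_in_level:
  assumes x: "x \<in> level X1 d n" and i: "i \<in> {1..d n}"
  shows "append_index x i \<in> level X1 d (Suc n)"
proof -
  have "1 \<le> n" using x by (auto simp: level_iff)
  then have "(\<lambda>(x, i). append_index x i) ` (level X1 d n \<times> {1..d n}) = level X1 d (Suc n)"
    using level_Suc by (simp add: bij_betw_def)
  with x i show ?thesis by (metis (no_types, lifting) SigmaI case_prod_conv imageI)
qed

abbreviation "D n \<equiv> diag_opsys (level X1 d n)"
abbreviation "C \<equiv> cont_opsys (cantor d)"

text \<open>For positive \<open>n\<close>, \<open>lift n\<close> embeds the diagonal algebra of
  level \<open>n\<close> as the functions of the first \<open>n\<close> coordinates,
  \<open>sample n\<close> is a unital completely positive left inverse of it, and
  \<open>refine n m\<close> is the inclusion into a deeper level.\<close>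

definition "lift = (\<lambda>n. pullback (cantor d) (initial n))"
definition "sample = (\<lambda>n. pullback (level X1 d n) point)"
definition "refine = (\<lambda>n m. pullback (level X1 d m) (trunc n))"

lemma lift_ucp: "1 \<le> n \<Longrightarrow> is_ucp (D n) C (lift n)"
  unfolding lift_def diag_opsys_def cont_opsys_def
proof (rule pullback_ucp)
  fix f :: "'x \<times> nat list \<Rightarrow> complex"
  have "continuous_on (cantor d) (pullback (cantor d) (initial n) f)"
    by (rule continuous_on_cong [THEN iffD1, OF refl _ continuous_on_initial [of f n]]) (simp add: pullback_def)
  then show "pullback (cantor d) (initial n) f \<in> {f. continuous_on (cantor d) f \<and> (\<forall>\<omega>. \<omega> \<notin> cantor d \<longrightarrow> f \<omega> = 0)}"
    by (simp add: pullback_def)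
qed (simp add: image_subset_iff initial_in_level)

lemma sample_ucp: "is_ucp C (D n) (sample n)"
  unfolding sample_def diag_opsys_def cont_opsys_def
  by (rule pullback_ucp) (auto simp: image_subset_iff point_in_cantor pullback_def)

lemma refine_ucp: "1 \<le> n \<Longrightarrow> n \<le> m \<Longrightarrow> is_ucp (D n) (D m) (refine n m)"
  unfolding refine_def diag_opsys_def
  by (rule pullback_ucp) (simp_all add: image_subset_iff trunc_in_level pullback_def)

lemma lift_indicator: "a \<in> level X1 d n \<Longrightarrow> lift n (indicator {a}) = indicator (cylinder d b a)"
  by (auto simp: lift_def pullback_def cylinder_eq fun_eq_iff indicator_def)

lemma lift_refine: "1 \<le> n \<Longrightarrow> n \<le> m \<Longrightarrow> lift m (refine n m c) = lift n c"
  by (auto simp: lift_def refine_def pullback_def fun_eq_iff trunc_initial initial_in_level)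

lemma sample_lift: "1 \<le> n \<Longrightarrow> n \<le> m \<Longrightarrow> sample m (lift n c) = refine n m c"
proof
  fix y assume n: "1 \<le> n" "n \<le> m"
  have "initial n (point y) = trunc n y" if "y \<in> level X1 d m"
    using trunc_initial [OF n(2), of "point y"] initial_point [OF that] by simp
  then show "sample m (lift n c) y = refine n m c y"
    by (auto simp: lift_def sample_def refine_def pullback_def point_in_cantor)
qed

lemma refine_refine: "1 \<le> n \<Longrightarrow> n \<le> m \<Longrightarrow> m \<le> k \<Longrightarrow> refine m k (refine n m c) = refine n k c"
  by (auto simp: refine_def pullback_def fun_eq_iff trunc_trunc trunc_in_level)

lemma refine_self: "c \<in> carr (D n) \<Longrightarrow> refine n n c = c"
  by (auto simp: refine_def pullback_def fun_eq_iff trunc_self diag_carr)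

lemma refine_indicator:
  assumes a: "a \<in> level X1 d n" "n \<le> m"
  shows "refine n m (indicator {a}) = (\<Sum>y\<in>{y \<in> level X1 d m. trunc n y = a}. indicator {y})"
proof
  fix z
  have "(\<Sum>y\<in>{y \<in> level X1 d m. trunc n y = a}. indicator {y}) z =
      (\<Sum>y\<in>{y \<in> level X1 d m. trunc n y = a}. if y = z then 1 else (0 :: complex))"
    unfolding sum_apply_point by (intro sum.cong refl) (simp add: indicator_def)
  then show "refine n m (indicator {a}) z = (\<Sum>y\<in>{y \<in> level X1 d m. trunc n y = a}. indicator {y}) z"
    by (simp add: finite_level refine_def pullback_def indicator_def)
qed

text \<open>At each point, \<open>f\<close> and its sampled version differ by the values of
  \<open>f\<close> at two points with the same initial segment.\<close>

lemma uniform_approximation: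
  assumes f: "f \<in> carr C" and e: "0 < e"
  shows "\<exists>N\<ge>1. \<forall>\<omega>\<in>cantor d. norm (f \<omega> - lift N (sample N f) \<omega>) < e"
proof -
  have "continuous_on (cantor d) f" using f by (simp add: cont_carr)
  from cantor_uniformly_continuous [OF this e]
  obtain N where N: "1 \<le> N" "\<And>\<omega> \<omega>'. \<omega> \<in> cantor d \<Longrightarrow> \<omega>' \<in> cantor d \<Longrightarrow> initial N \<omega> = initial N \<omega>' \<Longrightarrow> norm (f \<omega> - f \<omega>') < e"
    by blast
  have "norm (f \<omega> - lift N (sample N f) \<omega>) < e" if \<omega>: "\<omega> \<in> cantor d" for \<omega>
  proof -
    have l: "initial N \<omega> \<in> level X1 d N" using initial_in_level N(1) \<omega> by blast
    have "norm (f \<omega> - f (point (initial N \<omega>))) < e"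
      using initial_point [OF l] by (intro N(2) \<omega> point_in_cantor [OF l]) simp
    then show ?thesis using \<omega> l by (simp add: lift_def sample_def pullback_def)
  qed
  with N(1) show ?thesis by blast
qed

text \<open>\<open>f\<close> is within distance 1 of a function with finitely many values; the sum
  of their norms stands in for the maximum.\<close>

lemma cont_bounded:
  assumes f: "f \<in> carr C"
  shows "\<exists>r\<ge>0. \<forall>\<omega>\<in>cantor d. norm (f \<omega>) \<le> r"
proof -
  obtain N where N: "1 \<le> N" "\<And>\<omega>. \<omega> \<in> cantor d \<Longrightarrow> norm (f \<omega> - lift N (sample N f) \<omega>) < 1"
    using uniform_approximation [OF f, of 1] by auto
  let ?r = "(\<Sum>a\<in>level X1 d N. norm (f (point a))) + 1"
  have "norm (f \<omega>) \<le> ?r" if \<omega>: "\<omega> \<in> cantor d" for \<omega>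
  proof -
    have l: "initial N \<omega> \<in> level X1 d N" using initial_in_level N(1) \<omega> by blast
    have "norm (f (point (initial N \<omega>))) \<le> (\<Sum>a\<in>level X1 d N. norm (f (point a)))"
      using l by (intro member_le_sum) (auto simp: finite_level)
    moreover have "norm (f \<omega> - f (point (initial N \<omega>))) < 1"
      using N(2) [OF \<omega>] \<omega> l by (simp add: lift_def sample_def pullback_def)
    ultimately show ?thesis
      using norm_triangle_sub [of "f \<omega>" "f (point (initial N \<omega>))"] by linarith
  qed
  moreover have "0 \<le> ?r" by (simp add: sum_nonneg add_nonneg_nonneg)
  ultimately show ?thesis by blast
qed

end

text \<open>The relation is total and single-valued in both directions. A relation is the convenient
  form because the correspondence is characterised by values on generators.\<close>

lemma bij_betw_of_relation:
  assumes "\<And>x. x \<in> A \<Longrightarrow> \<exists>y\<in>B. Q x y" "\<And>y. y \<in> B \<Longrightarrow> \<exists>x\<in>A. Q x y"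
    and "\<And>x y y'. x \<in> A \<Longrightarrow> y \<in> B \<Longrightarrow> y' \<in> B \<Longrightarrow> Q x y \<Longrightarrow> Q x y' \<Longrightarrow> y = y'"
    and "\<And>x x' y. x \<in> A \<Longrightarrow> x' \<in> A \<Longrightarrow> y \<in> B \<Longrightarrow> Q x y \<Longrightarrow> Q x' y \<Longrightarrow> x = x'"
  shows "\<exists>F. bij_betw F A B \<and> (\<forall>x\<in>A. \<forall>y\<in>B. F x = y \<longleftrightarrow> Q x y)"
proof -
  obtain F where F: "\<And>x. x \<in> A \<Longrightarrow> F x \<in> B" "\<And>x. x \<in> A \<Longrightarrow> Q x (F x)"
    using assms(1) by metis
  have eq: "F x = y \<longleftrightarrow> Q x y" if "x \<in> A" "y \<in> B" for x y
    using F that assms(3) by blast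
  have "inj_on F A"
    using F assms(4) by (intro inj_onI) metis
  moreover have "F ` A = B"
    using F(1) assms(2) eq by blast
  ultimately show ?thesis using eq by (intro exI [of _ F]) (simp add: bij_betw_def)
qed

section \<open>Uniqueness, and the passage from \<Phi> to \<Gamma>\<close>

locale correspondence = cantor_tensor X1 dX bX q t + A: set_family A1 dA bA
  for X1 :: "'x set" and dX :: "nat \<Rightarrow> nat" and bX :: "'x \<Rightarrow> nat"
    and q :: "((nat \<Rightarrow> nat) \<Rightarrow> complex) \<Rightarrow> 'l::chilbert_space"
    and t :: "'l \<Rightarrow> 'h::chilbert_space \<Rightarrow> 'k::chilbert_space"
    and A1 :: "'a set" and dA :: "nat \<Rightarrow> nat" and bA :: "'a \<Rightarrow> nat" +
  fixes S :: "nat \<Rightarrow> 's::complex_vector opsys"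
    and \<iota> :: "nat \<Rightarrow> 'x \<times> nat list \<Rightarrow> ('a \<times> nat list \<Rightarrow> complex) \<Rightarrow> 's"
    and \<gamma> :: "nat \<Rightarrow> 's \<Rightarrow> 's"
    and SXA :: "'t::complex_vector opsys"
    and g :: "nat \<Rightarrow> 's \<Rightarrow> 't"
    and emb :: "('h \<Rightarrow>\<^sub>L 'h) \<Rightarrow> 'v::complex_vector"
  assumes emb: "linear_embedding emb"
    and coproducts: "\<And>n. n \<ge> 1 \<Longrightarrow> is_coproduct TYPE('v) (level X1 dX n) (level A1 dA n) (S n) (\<iota> n)"
    and \<gamma>_ucp: "\<And>n. n \<ge> 1 \<Longrightarrow> is_ucp (S n) (S (Suc n)) (\<gamma> n)"
    and \<gamma>_generators: "\<And>n x a. \<lbrakk>n \<ge> 1; x \<in> level X1 dX n; a \<in> level A1 dA n\<rbrakk> \<Longrightarrow>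
          \<gamma> n (\<iota> n x (indicator {a})) =
            (1 / of_nat (dX n)) *\<^sub>C
              (\<Sum>i=1..dX n. \<Sum>j=1..dA n. \<iota> (Suc n) (append_index x i) (indicator {append_index a j}))"
    and limit: "is_inductive_limit TYPE('v) S \<gamma> SXA g"
begin

abbreviation "B \<equiv> op_opsys (bounded_ops :: ('h \<Rightarrow>\<^sub>L 'h) set)"
abbreviation "V \<equiv> op_opsys vn"

text \<open>The factor \<open>N n\<close> makes the slice along \<open>e x\<close> unital. Only
  \<open>x\<close> and \<open>a\<close> of equal level are compared, which is enough since either
  can be refined.\<close>

definition corresponds :: "('t \<Rightarrow> 'h \<Rightarrow>\<^sub>L 'h) \<Rightarrow> (((nat \<Rightarrow> nat) \<Rightarrow> complex) \<Rightarrow> 'k \<Rightarrow>\<^sub>L 'k) \<Rightarrow> bool" where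
  "corresponds \<Gamma> \<Phi> \<longleftrightarrow> (\<forall>n\<ge>1. \<forall>x\<in>L n. \<forall>a\<in>level A1 dA n.
     \<Gamma> (g n (\<iota> n x (indicator {a}))) = of_nat (N n) *\<^sub>C slice t (e x) (\<Phi> (indicator (cylinder dA bA a))))"

lemma B_opsys: "operator_system B"
  by (rule operator_system_bounded_ops)

lemma S_opsys: "1 \<le> n \<Longrightarrow> operator_system (S n)"
  using coproducts by (simp add: is_coproduct_def)

lemma g_ucp: "1 \<le> n \<Longrightarrow> is_ucp (S n) SXA (g n)"
  and g_compatible: "1 \<le> n \<Longrightarrow> s \<in> carr (S n) \<Longrightarrow> g (Suc n) (\<gamma> n s) = g n s"
  using limit by (auto simp: is_inductive_limit_def)

lemma \<iota>_ucp: "1 \<le> n \<Longrightarrow> x \<in> L n \<Longrightarrow> is_ucp (A.D n) (S n) (\<iota> n x)"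
  by (rule coproduct_inclusion_ucp [OF coproducts])

text \<open>Linear extension of \<open>\<gamma>_generators\<close> from the basis:
  \<open>\<gamma> n\<close> averages over the children of \<open>x\<close> and refines the diagonal
  matrix.\<close>

lemma \<gamma>_\<iota>:
  assumes x: "x \<in> L n" and c: "c \<in> carr (A.D n)"
  shows "\<gamma> n (\<iota> n x c) = (1 / of_nat (dX n)) *\<^sub>C (\<Sum>i=1..dX n. \<iota> (Suc n) (append_index x i) (A.refine n (Suc n) c))"
proof -
  have n: "1 \<le> n" by (rule level_ge_1 [OF x])
  note fin = A.finite_level
  have r: "A.refine n (Suc n) (indicator {a}) = (\<Sum>j=1..dA n. indicator {append_index a j})"
    if "a \<in> level A1 dA n" for a
    using A.refine_indicator [OF that, of "Suc n"] A.sum_children [OF that, of "\<lambda>y. indicator {y}"] by simp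
  have \<iota>': "is_ucp (A.D (Suc n)) (S (Suc n)) (\<iota> (Suc n) (append_index x i))" if "i \<in> {1..dX n}" for i
    using append_in_level [OF x that] by (intro \<iota>_ucp) auto
  have "is_ucp (A.D n) (S (Suc n)) (\<lambda>c. \<gamma> n (\<iota> n x c))"
    by (rule is_ucp_comp [OF \<iota>_ucp [OF n x] \<gamma>_ucp [OF n]])
  from diag_ucp_expansion [OF fin c this]
  have "\<gamma> n (\<iota> n x c) = (\<Sum>a\<in>level A1 dA n. c a *\<^sub>C (1 / of_nat (dX n)) *\<^sub>C
      (\<Sum>i=1..dX n. \<iota> (Suc n) (append_index x i) (A.refine n (Suc n) (indicator {a}))))"
  proof (rule trans, intro sum.cong refl arg_cong [where f = "\<lambda>s. _ *\<^sub>C s"])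
    fix a assume a: "a \<in> level A1 dA n"
    have "\<iota> (Suc n) (append_index x i) (A.refine n (Suc n) (indicator {a})) =
        (\<Sum>j=1..dA n. \<iota> (Suc n) (append_index x i) (indicator {append_index a j}))" if "i \<in> {1..dX n}" for i
      unfolding r [OF a]
      by (intro is_ucp_sum [OF \<iota>' [OF that] csubspace_diag] indicator_diag A.append_in_level [OF a])
    then show "\<gamma> n (\<iota> n x (indicator {a})) = (1 / of_nat (dX n)) *\<^sub>C
        (\<Sum>i=1..dX n. \<iota> (Suc n) (append_index x i) (A.refine n (Suc n) (indicator {a})))"
      using \<gamma>_generators [OF n x a] by simp
  qed
  also have "\<dots> = (1 / of_nat (dX n)) *\<^sub>C (\<Sum>a\<in>level A1 dA n. \<Sum>i=1..dX n. c a *\<^sub>C \<iota> (Suc n) (append_index x i) (A.refine n (Suc n) (indicator {a})))"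
    by (simp add: scaleC_sum_right scaleC_scaleC mult.commute)
  also have "\<dots> = (1 / of_nat (dX n)) *\<^sub>C (\<Sum>i=1..dX n. \<Sum>a\<in>level A1 dA n. c a *\<^sub>C \<iota> (Suc n) (append_index x i) (A.refine n (Suc n) (indicator {a})))"
    by (subst sum.swap) (rule refl)
  also have "\<dots> = (1 / of_nat (dX n)) *\<^sub>C (\<Sum>i=1..dX n. \<iota> (Suc n) (append_index x i) (A.refine n (Suc n) c))"
  proof (intro arg_cong [where f = "\<lambda>s. _ *\<^sub>C s"] sum.cong refl)
    fix i assume "i \<in> {1..dX n}"
    from is_ucp_comp [OF A.refine_ucp \<iota>' [OF this]] n
    have "is_ucp (A.D n) (S (Suc n)) (\<lambda>c. \<iota> (Suc n) (append_index x i) (A.refine n (Suc n) c))" by simp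
    from diag_ucp_expansion [OF fin c this]
    show "(\<Sum>a\<in>level A1 dA n. c a *\<^sub>C \<iota> (Suc n) (append_index x i) (A.refine n (Suc n) (indicator {a}))) =
        \<iota> (Suc n) (append_index x i) (A.refine n (Suc n) c)" by simp
  qed
  finally show ?thesis .
qed

lemma d_pos: "of_nat (dX n) \<noteq> (0 :: complex)"
  using d_ge_1 [of n] by simp

text \<open>Generators determine \<Gamma> on each diagonal algebra by linearity, then on
  \<open>S n\<close> by the coproduct, then on \<open>SXA\<close> by the limit.\<close>

lemma corresponds_unique_\<Gamma>:
  assumes \<Gamma>: "\<Gamma> \<in> UCP SXA B" "\<Gamma>' \<in> UCP SXA B" and c: "corresponds \<Gamma> \<Phi>" "corresponds \<Gamma>' \<Phi>"
  shows "\<Gamma> = \<Gamma>'"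
proof -
  have u: "is_ucp SXA B \<Gamma>" "is_ucp SXA B \<Gamma>'" using \<Gamma> by (auto simp: UCP_def)
  have eq: "\<Gamma> (g n s) = \<Gamma>' (g n s)" if n: "1 \<le> n" and s: "s \<in> carr (S n)" for n s
  proof (rule coproduct_unique [OF emb B_opsys coproducts [OF n] is_ucp_comp [OF g_ucp [OF n] u(1)] is_ucp_comp [OF g_ucp [OF n] u(2)] _ s])
    fix x d assume x: "x \<in> L n" and d: "d \<in> carr (A.D n)"
    have "is_ucp (A.D n) B (\<lambda>c. \<Gamma> (g n (\<iota> n x c)))" "is_ucp (A.D n) B (\<lambda>c. \<Gamma>' (g n (\<iota> n x c)))"
      by (rule is_ucp_comp [OF is_ucp_comp [OF \<iota>_ucp [OF n x] g_ucp [OF n]]], rule u)+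
    from this [THEN diag_ucp_expansion [OF A.finite_level d]] c n x
    show "\<Gamma> (g n (\<iota> n x d)) = \<Gamma>' (g n (\<iota> n x d))"
      by (simp add: corresponds_def)
  qed
  show ?thesis
  proof (rule extensionalityI)
    show "\<Gamma> \<in> extensional (carr SXA)" "\<Gamma>' \<in> extensional (carr SXA)" using \<Gamma> by (auto simp: UCP_def)
    show "\<Gamma> s = \<Gamma>' s" if "s \<in> carr SXA" for s
      by (rule inductive_limit_unique [OF emb B_opsys limit u eq that])
  qed
qed

text \<open>This is compression by the isometry that sends \<open>h\<close> to
  \<open>sqrt (N n)\<close> times \<open>t (e x) h\<close>; matrix positivity is inherited because
  each quadratic form of the image is one of the original.\<close>

lemma slice_ucp:
  assumes M: "M \<subseteq> bounded_ops" and x: "x \<in> L n"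
  shows "is_ucp (op_opsys M) B (\<lambda>R. of_nat (N n) *\<^sub>C slice t (e x) R)"
  unfolding is_ucp_def
proof (intro conjI ballI allI)
  let ?s = "\<lambda>R. of_nat (N n) *\<^sub>C slice t (e x) R"
  have Mb: "R \<in> bounded_ops" if "R \<in> carr (op_opsys M)" for R using that M by auto
  have inner: "cinner h (blinfun_apply (?s R) k) = of_nat (N n) * cinner (t (e x) h) (blinfun_apply R (t (e x) k))"
    if "R \<in> bounded_ops" for R h k
    using that by (simp add: scaleC_blinfun.rep_eq cinner_scaleC_right cinner_slice)
  have s_ops: "?s R \<in> bounded_ops" if "R \<in> bounded_ops" for R
    using that by (intro csubspace_scaleC [OF csubspace_bounded_ops] slice_bounded_ops)
  show "?s ` carr (op_opsys M) \<subseteq> carr B" using Mb s_ops by auto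
  show "?s (R + R') = ?s R + ?s R'" if "R \<in> carr (op_opsys M)" "R' \<in> carr (op_opsys M)" for R R'
    using Mb [OF that(1)] Mb [OF that(2)]
    by (intro bounded_ops_ext)
      (simp add: inner csubspace_add [OF csubspace_bounded_ops] blinfun.add_left cinner_add_right distrib_left)
  show sc: "?s (c *\<^sub>C R) = c *\<^sub>C ?s R" if "R \<in> carr (op_opsys M)" for c R
    using Mb [OF that]
    by (intro bounded_ops_ext)
      (simp only: inner csubspace_scaleC [OF csubspace_bounded_ops] scaleC_blinfun.rep_eq [of c] cinner_scaleC_right mult.left_commute)
  show "?s (ounit (op_opsys M)) = ounit B"
    using N_pos [OF x]
    by (intro bounded_ops_ext) (simp add: inner id_bounded_ops t_inner inner_e [OF x x] trunc_self [OF x])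
  fix k X assume X: "X \<in> pos (op_opsys M) k"
  then have Xb: "X i j \<in> bounded_ops" if "i < k" "j < k" for i j using that M by (auto simp: op_pos_iff mats_def)
  have mf: "mform k (\<lambda>i j. ?s (X i j)) u u = of_nat (N n) * mform k X (\<lambda>i. t (e x) (u i)) (\<lambda>i. t (e x) (u i))" for u
    by (simp add: mform_def inner Xb sum_distrib_left)
  have "slice t (e x) 0 = 0"
    by (intro bounded_ops_ext) (simp add: cinner_slice csubspace_zero [OF csubspace_bounded_ops] cinner.zero_right blinfun.zero_left)
  then have "(\<lambda>i j. ?s (X i j)) \<in> mats k bounded_ops"
    using X s_ops Xb by (auto simp: op_pos_iff mats_def)
  then show "(\<lambda>i j. ?s (X i j)) \<in> pos B k"
    using X unfolding op_pos_iff mf by (simp add: op_pos_iff)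
qed

lemma corresponds_unique_\<Phi>:
  assumes \<Phi>: "\<Phi> \<in> UCP A.C V" "\<Phi>' \<in> UCP A.C V" and c: "corresponds \<Gamma> \<Phi>" "corresponds \<Gamma> \<Phi>'"
  shows "\<Phi> = \<Phi>'"
proof -
  have u: "is_ucp A.C V \<Phi>" "is_ucp A.C V \<Phi>'" using \<Phi> by (auto simp: UCP_def)
  have ucp_lift: "is_ucp (A.D m) V (\<lambda>c. \<Phi> (A.lift m c))" "is_ucp (A.D m) V (\<lambda>c. \<Phi>' (A.lift m c))" if "1 \<le> m" for m
    by (rule is_ucp_comp [OF A.lift_ucp [OF that]], rule u)+
  have gen: "\<Phi> (A.lift m (indicator {a})) = \<Phi>' (A.lift m (indicator {a}))" if a: "a \<in> level A1 dA m" for m a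
  proof (rule vn_ext [of _ _ m])
    have m: "1 \<le> m" using a by (auto simp: A.level_iff)
    have ia: "indicator {a} \<in> carr (A.D m)" by (rule indicator_diag [OF a])
    show "\<Phi> (A.lift m (indicator {a})) \<in> vn" "\<Phi>' (A.lift m (indicator {a})) \<in> vn"
      using is_ucp_carr [OF ucp_lift(1) [OF m] ia] is_ucp_carr [OF ucp_lift(2) [OF m] ia] by simp_all
    fix n x assume n: "m \<le> n" and x: "x \<in> L n"
    have n1: "1 \<le> n" using m n by simp
    have s: "is_ucp (A.D n) B (\<lambda>c. of_nat (N n) *\<^sub>C slice t (e x) (\<Phi> (A.lift n c)))"
      "is_ucp (A.D n) B (\<lambda>c. of_nat (N n) *\<^sub>C slice t (e x) (\<Phi>' (A.lift n c)))"
      by (rule is_ucp_comp [OF ucp_lift(1) [OF n1] slice_ucp [OF vn_bounded_ops x]],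
          rule is_ucp_comp [OF ucp_lift(2) [OF n1] slice_ucp [OF vn_bounded_ops x]])
    \<comment> \<open>\<open>corresponds\<close> relates equal levels only, so the indicator of
      level \<open>m\<close> is refined to level \<open>n\<close> and expanded over the basis
      there.\<close>
    have r: "A.refine m n (indicator {a}) \<in> carr (A.D n)"
      by (rule is_ucp_carr [OF A.refine_ucp [OF m n] ia])
    have "of_nat (N n) *\<^sub>C slice t (e x) (\<Phi> (A.lift n (indicator {a'}))) =
        of_nat (N n) *\<^sub>C slice t (e x) (\<Phi>' (A.lift n (indicator {a'})))" if "a' \<in> level A1 dA n" for a'
      using c n1 x that by (simp add: corresponds_def A.lift_indicator)
    then have "of_nat (N n) *\<^sub>C slice t (e x) (\<Phi> (A.lift n (A.refine m n (indicator {a})))) =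
        of_nat (N n) *\<^sub>C slice t (e x) (\<Phi>' (A.lift n (A.refine m n (indicator {a}))))"
      using diag_ucp_expansion [OF A.finite_level r s(1)] diag_ucp_expansion [OF A.finite_level r s(2)] by simp
    from arg_cong [OF this, of "\<lambda>T. (1 / of_nat (N n)) *\<^sub>C T"]
    show "slice t (e x) (\<Phi> (A.lift m (indicator {a}))) = slice t (e x) (\<Phi>' (A.lift m (indicator {a})))"
      using N_pos [OF x] by (simp add: A.lift_refine [OF m n] scaleC_scaleC scaleC_one)
  qed
  have lift_eq: "\<Phi> (A.lift m c) = \<Phi>' (A.lift m c)" if "1 \<le> m" "c \<in> carr (A.D m)" for m c
    unfolding diag_ucp_expansion [OF A.finite_level that(2) ucp_lift(1) [OF that(1)]]
      diag_ucp_expansion [OF A.finite_level that(2) ucp_lift(2) [OF that(1)]]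
    by (intro sum.cong refl) (simp add: gen)
  show ?thesis
  proof (rule extensionalityI)
    show "\<Phi> \<in> extensional (carr A.C)" "\<Phi>' \<in> extensional (carr A.C)" using \<Phi> by (auto simp: UCP_def)
    fix f assume f: "f \<in> carr A.C"
    have "norm (\<Phi> f - \<Phi>' f) \<le> 0"
    proof (rule field_le_epsilon)
      fix r :: real assume r: "0 < r"
      obtain n where n: "1 \<le> n" "\<And>\<omega>. \<omega> \<in> cantor dA \<Longrightarrow> norm (f \<omega> - A.lift n (A.sample n f) \<omega>) < r / 2"
        using A.uniform_approximation [OF f, of "r / 2"] r by auto
      let ?l = "A.lift n (A.sample n f)"
      have sf: "A.sample n f \<in> carr (A.D n)" by (rule is_ucp_carr [OF A.sample_ucp f])
      have l: "?l \<in> carr A.C" by (rule is_ucp_carr [OF A.lift_ucp [OF n(1)] sf])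
      \<comment> \<open>Both maps agree on the cylinder function \<open>?l\<close>, and by
        \<open>cont_norm_bound\<close> each sends the small remainder \<open>?k\<close> to an
        operator of norm at most \<open>r / 2\<close>.\<close>
      let ?k = "f + (-1) *\<^sub>C ?l"
      have ml: "(-1) *\<^sub>C ?l \<in> carr A.C" by (rule csubspace_scaleC [OF csubspace_cont l])
      have k: "?k \<in> carr A.C" by (rule csubspace_add [OF csubspace_cont f ml])
      have "norm (?k \<omega>) \<le> r / 2" if "\<omega> \<in> cantor dA" for \<omega>
        using n(2) [OF that] by (simp add: scaleC_minus_one)
      then have bd: "norm (\<Psi> ?k) \<le> r / 2" if "is_ucp A.C V \<Psi>" for \<Psi>
        using r by (intro cont_norm_bound [OF that vn_bounded_ops k]) auto
      have split: "\<Psi> ?k = \<Psi> f - \<Psi> ?l" if "is_ucp A.C V \<Psi>" for \<Psi>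
      proof -
        have "\<Psi> ?k = \<Psi> f + (-1) *\<^sub>C \<Psi> ?l"
          by (simp only: is_ucp_add [OF that f ml] is_ucp_scaleC [OF that l])
        then show ?thesis by (simp only: scaleC_minus_one diff_conv_add_uminus)
      qed
      have "\<Phi> f - \<Phi>' f = \<Phi> ?k - \<Phi>' ?k"
        by (simp only: split [OF u(1)] split [OF u(2)] lift_eq [OF n(1) sf]) simp
      then show "norm (\<Phi> f - \<Phi>' f) \<le> 0 + r"
        using bd [OF u(1)] bd [OF u(2)] norm_triangle_ineq4 [of "\<Phi> ?k" "\<Phi>' ?k"] by simp
    qed
    then show "\<Phi> f = \<Phi>' f" by simp
  qed
qed

lemma corresponds_exists_\<Gamma>:
  assumes \<Phi>: "\<Phi> \<in> UCP A.C V"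
  shows "\<exists>\<Gamma>\<in>UCP SXA B. corresponds \<Gamma> \<Phi>"
proof -
  have u: "is_ucp A.C V \<Phi>" using \<Phi> by (simp add: UCP_def)
  define \<psi> where "\<psi> n x c = of_nat (N n) *\<^sub>C slice t (e x) (\<Phi> (A.lift n c))" for n x c
  have \<psi>: "is_ucp (A.D n) B (\<psi> n x)" if "1 \<le> n" "x \<in> L n" for n x
    unfolding \<psi>_def [abs_def]
    by (rule is_ucp_comp [OF is_ucp_comp [OF A.lift_ucp [OF that(1)] u] slice_ucp [OF vn_bounded_ops that(2)]])
  have "\<exists>\<rho>\<in>UCP (S n) B. \<forall>x\<in>L n. \<forall>c\<in>carr (A.D n). \<rho> (\<iota> n x c) = \<psi> n x c" if "1 \<le> n" for n
    by (rule coproduct_universal [OF emb B_opsys coproducts [OF that] \<psi> [OF that]])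
  then obtain \<rho> where \<rho>: "\<And>n. 1 \<le> n \<Longrightarrow> \<rho> n \<in> UCP (S n) B"
    "\<And>n x c. 1 \<le> n \<Longrightarrow> x \<in> L n \<Longrightarrow> c \<in> carr (A.D n) \<Longrightarrow> \<rho> n (\<iota> n x c) = \<psi> n x c"
    by metis
  have \<rho>_ucp: "is_ucp (S n) B (\<rho> n)" if "1 \<le> n" for n using \<rho>(1) [OF that] by (simp add: UCP_def)
  \<comment> \<open>Compatibility is tested on the summands of the coproduct, where
    \<open>\<gamma>_\<iota>\<close> and \<open>vn_slice_refine\<close> are available.\<close>
  have "\<rho> (Suc n) (\<gamma> n s) = \<rho> n s" if n: "1 \<le> n" and s: "s \<in> carr (S n)" for n s
  proof (rule coproduct_unique [OF emb B_opsys coproducts [OF n] is_ucp_comp [OF \<gamma>_ucp [OF n] \<rho>_ucp] \<rho>_ucp [OF n] _ s])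
    fix x c assume x: "x \<in> L n" and c: "c \<in> carr (A.D n)"
    let ?c = "A.refine n (Suc n) c"
    have c': "?c \<in> carr (A.D (Suc n))" by (rule is_ucp_carr [OF A.refine_ucp [OF n] c]) simp
    have \<Phi>c: "\<Phi> (A.lift n c) \<in> vn"
      using is_ucp_carr [OF u is_ucp_carr [OF A.lift_ucp [OF n] c]] by simp
    interpret S': operator_system "S (Suc n)" by (rule S_opsys) simp
    have i: "\<iota> (Suc n) (append_index x i) ?c \<in> carr (S (Suc n))" if "i \<in> {1..dX n}" for i
      using append_in_level [OF x that] by (intro is_ucp_carr [OF \<iota>_ucp c']) auto
    have "\<rho> (Suc n) (\<gamma> n (\<iota> n x c)) = (1 / of_nat (dX n)) *\<^sub>C (\<Sum>i=1..dX n. \<rho> (Suc n) (\<iota> (Suc n) (append_index x i) ?c))"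
      unfolding \<gamma>_\<iota> [OF x c]
      by (subst is_ucp_scaleC [OF \<rho>_ucp], simp, rule csubspace_sum [OF S'.csubspace_carr i], assumption,
          subst is_ucp_sum [OF \<rho>_ucp S'.csubspace_carr i], simp, assumption, rule refl)
    also have "\<dots> = (1 / of_nat (dX n)) *\<^sub>C (\<Sum>i=1..dX n. of_nat (N (Suc n)) *\<^sub>C slice t (e (append_index x i)) (\<Phi> (A.lift n c)))"
      using append_in_level [OF x] c'
      by (intro arg_cong [where f = "\<lambda>s. _ *\<^sub>C s"] sum.cong refl) (simp add: \<rho>(2) \<psi>_def A.lift_refine [OF n, of "Suc n"])
    \<comment> \<open>The slices of the children add up to the slice of \<open>x\<close>, and
      \<open>N (Suc n) / dX n = N n\<close>.\<close>
    also have "\<dots> = of_nat (N n) *\<^sub>C slice t (e x) (\<Phi> (A.lift n c))"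
      using d_pos [of n] n
      by (simp add: scaleC_sum_right [symmetric] scaleC_scaleC vn_slice_refine [OF \<Phi>c x] card_level)
    also have "\<dots> = \<rho> n (\<iota> n x c)" by (simp only: \<rho>(2) [OF n x c] \<psi>_def)
    finally show "\<rho> (Suc n) (\<gamma> n (\<iota> n x c)) = \<rho> n (\<iota> n x c)" .
  qed simp
  from inductive_limit_universal [OF emb B_opsys limit \<rho>_ucp this]
  obtain \<Gamma> where \<Gamma>: "\<Gamma> \<in> UCP SXA B" "\<And>n s. 1 \<le> n \<Longrightarrow> s \<in> carr (S n) \<Longrightarrow> \<Gamma> (g n s) = \<rho> n s" by blast
  have "corresponds \<Gamma> \<Phi>"
    unfolding corresponds_def
    by (auto simp: \<Gamma>(2) is_ucp_carr [OF \<iota>_ucp indicator_diag] \<rho>(2) indicator_diag \<psi>_def A.lift_indicator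
        simp del: split_paired_All)
  with \<Gamma>(1) show ?thesis by blast
qed

section \<open>The passage from \<Gamma> to \<Phi>\<close>

context
  fixes \<Gamma> :: "'t \<Rightarrow> 'h \<Rightarrow>\<^sub>L 'h"
  assumes \<Gamma>: "is_ucp SXA B \<Gamma>"
begin

definition component :: "nat \<Rightarrow> 'x \<times> nat list \<Rightarrow> ('a \<times> nat list \<Rightarrow> complex) \<Rightarrow> 'h \<Rightarrow>\<^sub>L 'h" where
  "component n x c = \<Gamma> (g n (\<iota> n x c))"

definition family :: "(((nat \<Rightarrow> nat) \<Rightarrow> complex)) \<Rightarrow> nat \<Rightarrow> 'x \<times> nat list \<Rightarrow> 'h \<Rightarrow>\<^sub>L 'h" where
  "family f n x = component n x (A.sample n f)"

lemma component_ucp: "x \<in> L n \<Longrightarrow> is_ucp (A.D n) B (component n x)"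
  unfolding component_def [abs_def]
  using level_ge_1 by (intro is_ucp_comp [OF is_ucp_comp [OF \<iota>_ucp g_ucp] \<Gamma>])

text \<open>Apply \<Gamma> to \<open>g (Suc n) (\<gamma> n s) = g n s\<close> at the generator
  \<open>\<iota> n x c\<close> and insert the averaging formula
  \<open>\<gamma>_\<iota>\<close>.\<close>

lemma component_martingale:
  assumes x: "x \<in> L n" and c: "c \<in> carr (A.D n)"
  shows "(\<Sum>i=1..dX n. component (Suc n) (append_index x i) (A.refine n (Suc n) c)) = of_nat (dX n) *\<^sub>C component n x c"
proof -
  have n: "1 \<le> n" by (rule level_ge_1 [OF x])
  let ?c = "A.refine n (Suc n) c"
  interpret S': operator_system "S (Suc n)" by (rule S_opsys) simp
  have c': "?c \<in> carr (A.D (Suc n))" by (rule is_ucp_carr [OF A.refine_ucp [OF n] c]) simp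
  have i: "\<iota> (Suc n) (append_index x i) ?c \<in> carr (S (Suc n))" if "i \<in> {1..dX n}" for i
    using append_in_level [OF x that] by (intro is_ucp_carr [OF \<iota>_ucp c']) auto
  have \<Gamma>g: "is_ucp (S (Suc n)) B (\<lambda>s. \<Gamma> (g (Suc n) s))"
    by (rule is_ucp_comp [OF g_ucp \<Gamma>]) simp
  have "component n x c = \<Gamma> (g (Suc n) (\<gamma> n (\<iota> n x c)))"
    unfolding component_def using g_compatible [OF n is_ucp_carr [OF \<iota>_ucp [OF n x] c]] by simp
  also have "\<dots> = (1 / of_nat (dX n)) *\<^sub>C (\<Sum>i=1..dX n. component (Suc n) (append_index x i) ?c)"
    unfolding \<gamma>_\<iota> [OF x c] component_def
    by (subst is_ucp_scaleC [OF \<Gamma>g], rule csubspace_sum [OF S'.csubspace_carr i], assumption,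
        subst is_ucp_sum [OF \<Gamma>g S'.csubspace_carr i], assumption, rule refl)
  finally show ?thesis
    using d_pos [of n] by (simp add: scaleC_scaleC scaleC_one)
qed

lemma family_bounded_ops: "f \<in> carr A.C \<Longrightarrow> x \<in> L n \<Longrightarrow> family f n x \<in> bounded_ops"
  unfolding family_def using is_ucp_carr [OF component_ucp is_ucp_carr [OF A.sample_ucp]] by simp

lemma sample_bound:
  assumes f: "f \<in> carr A.C" and r: "\<And>\<omega>. \<omega> \<in> cantor dA \<Longrightarrow> norm (f \<omega>) \<le> r" and a: "a \<in> level A1 dA n"
  shows "norm (A.sample n f a) \<le> r"
  using r A.point_in_cantor [OF a] a by (simp add: A.sample_def pullback_def)

lemma family_bound:
  assumes f: "f \<in> carr A.C" and r: "0 \<le> r" "\<And>\<omega>. \<omega> \<in> cantor dA \<Longrightarrow> norm (f \<omega>) \<le> r" and x: "x \<in> L n"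
  shows "norm (family f n x) \<le> r"
  unfolding family_def
  by (rule diag_norm_bound [OF component_ucp [OF x] subset_refl is_ucp_carr [OF A.sample_ucp f] r(1)])
    (rule sample_bound [OF f r(2)])

text \<open>Sampling a function of the first \<open>m\<close> coordinates at a deeper level is a
  refinement, so from level \<open>m\<close> on the family is an exact martingale.\<close>

lemma family_lift_martingale:
  assumes c: "c \<in> carr (A.D m)" and m: "1 \<le> m" "m \<le> n" and x: "x \<in> L n"
  shows "(\<Sum>i=1..dX n. family (A.lift m c) (Suc n) (append_index x i)) = of_nat (dX n) *\<^sub>C family (A.lift m c) n x"
proof -
  have "A.sample (Suc n) (A.lift m c) = A.refine n (Suc n) (A.sample n (A.lift m c))"
    using m by (simp add: A.sample_lift A.refine_refine)
  moreover have "A.sample n (A.lift m c) \<in> carr (A.D n)"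
    by (rule is_ucp_carr [OF A.sample_ucp is_ucp_carr [OF A.lift_ucp [OF m(1)] c]])
  ultimately show ?thesis
    unfolding family_def by (simp only: component_martingale [OF x])
qed

lemma family_add: "f \<in> carr A.C \<Longrightarrow> f' \<in> carr A.C \<Longrightarrow> x \<in> L n \<Longrightarrow> family (f + f') n x = family f n x + family f' n x"
  unfolding family_def
  by (simp only: is_ucp_add [OF A.sample_ucp] is_ucp_add [OF component_ucp] is_ucp_carr [OF A.sample_ucp])

lemma family_scaleC: "f \<in> carr A.C \<Longrightarrow> x \<in> L n \<Longrightarrow> family (c *\<^sub>C f) n x = c *\<^sub>C family f n x"
  unfolding family_def
  by (simp only: is_ucp_scaleC [OF A.sample_ucp] is_ucp_scaleC [OF component_ucp] is_ucp_carr [OF A.sample_ucp])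

lemma average_bound:
  assumes P: "\<And>z. z \<in> L n \<Longrightarrow> norm (P z) \<le> r" and r: "0 \<le> r" and n: "1 \<le> n"
  shows "norm (average n P j y h k) \<le> r * norm h * norm k"
proof -
  let ?Z = "{z \<in> L n. trunc j z = y}"
  have N: "0 < N n" by (rule card_level_pos [OF n])
  have "norm (\<Sum>z\<in>?Z. cinner h (blinfun_apply (P z) k)) \<le> (\<Sum>z\<in>?Z. r * norm h * norm k)"
  proof (rule order_trans [OF norm_sum sum_mono])
    fix z assume "z \<in> ?Z"
    then have "norm (P z) * norm h * norm k \<le> r * norm h * norm k"
      by (intro mult_right_mono P) auto
    then show "norm (cinner h (blinfun_apply (P z) k)) \<le> r * norm h * norm k"
      using cinner_blinfun_bound [of h "P z" k] by linarith
  qed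
  also have "\<dots> = real (card ?Z) * (r * norm h * norm k)" by simp
  also have "\<dots> \<le> real (N n) * (r * norm h * norm k)"
    using r by (intro mult_right_mono) (auto intro: card_mono simp: finite_level)
  finally show ?thesis
    using N by (simp add: average_def norm_divide field_simps)
qed

lemma average_diff:
  "average n (\<lambda>z. P z - Q z) j y h k = average n P j y h k - average n Q j y h k"
  by (simp add: average_def blinfun.diff_left cinner.diff_right sum_subtractf diff_divide_distrib)

text \<open>Replace \<open>f\<close> by a cylinder function within \<open>s\<close> of it: its
  averages are eventually constant, and those of the difference are small uniformly in
  \<open>n\<close>.\<close>

lemma family_average_convergent:
  assumes f: "f \<in> carr A.C" and y: "y \<in> L j"
  shows "convergent (\<lambda>n. average n (family f n) j y h k)"
proof (rule Cauchy_convergent, rule metric_CauchyI)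
  fix r :: real assume r: "0 < r"
  \<comment> \<open>\<open>K\<close> is positive even if \<open>h\<close> or \<open>k\<close> is 0;
    with \<open>s\<close> as below, \<open>s * K = r / 3\<close> stays under
    \<open>r / 2\<close>.\<close>
  define K where "K = norm h * norm k + 1"
  have K: "0 < K" by (simp add: K_def add_nonneg_pos)
  define s where "s = r / (3 * K)"
  have s: "0 < s" using r K by (simp add: s_def)
  obtain m where m: "1 \<le> m" "\<And>\<omega>. \<omega> \<in> cantor dA \<Longrightarrow> norm (f \<omega> - A.lift m (A.sample m f) \<omega>) < s"
    using A.uniform_approximation [OF f s] by blast
  let ?l = "A.lift m (A.sample m f)"
  have sf: "A.sample m f \<in> carr (A.D m)" by (rule is_ucp_carr [OF A.sample_ucp f])
  have l: "?l \<in> carr A.C" by (rule is_ucp_carr [OF A.lift_ucp [OF m(1)] sf])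
  let ?d = "f + (-1) *\<^sub>C ?l"
  have ml: "(-1) *\<^sub>C ?l \<in> carr A.C" by (rule csubspace_scaleC [OF csubspace_cont l])
  have d: "?d \<in> carr A.C" by (rule csubspace_add [OF csubspace_cont f ml])
  have d_bd: "norm (?d \<omega>) \<le> s" if "\<omega> \<in> cantor dA" for \<omega>
    using m(2) [OF that] by (simp add: scaleC_minus_one)
  have diff: "family f n z - family ?l n z = family ?d n z" if "z \<in> L n" for n z
    unfolding family_add [OF f ml that] family_scaleC [OF l that] by (simp add: scaleC_minus_one)
  have close: "norm (average n (family f n) j y h k - average n (family ?l n) j y h k) < r / 2" if n: "1 \<le> n" for n
  proof -
    have "norm (average n (\<lambda>z. family f n z - family ?l n z) j y h k) \<le> s * norm h * norm k"
    proof (rule average_bound [OF _ _ n])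
      show "norm (family f n z - family ?l n z) \<le> s" if z: "z \<in> L n" for z
        unfolding diff [OF z] by (rule family_bound [OF d _ d_bd z]) (use s in simp_all)
    qed (use s in simp)
    also have "\<dots> \<le> s * K" using s by (simp add: K_def mult.assoc)
    also have "\<dots> < r / 2" using r K by (simp add: s_def)
    finally show ?thesis by (simp add: average_diff)
  qed
  let ?M = "max m j"
  let ?c = "\<Sum>w\<in>{w \<in> L ?M. trunc j w = y}. cinner h (blinfun_apply (family ?l ?M w) k) / of_nat (N ?M)"
  have const: "average n (family ?l n) j y h k = ?c" if n: "?M \<le> n" for n
  proof -
    have "average n (family ?l n) j y h k = (\<Sum>w\<in>{w \<in> L ?M. trunc j w = y}. average n (family ?l n) ?M w h k)"
      using n by (intro average_descendants [OF y]) auto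
    also have "\<dots> = ?c"
      using n m(1) by (intro sum.cong refl average_martingale [where m = m] family_lift_martingale [OF sf]) auto
    finally show ?thesis .
  qed
  have "dist (average n (family f n) j y h k) (average n' (family f n') j y h k) < r" if "?M \<le> n" "?M \<le> n'" for n n'
    using close [of n] close [of n'] const [OF that(1)] const [OF that(2)] m(1) that
      dist_triangle_half_l [of "average n (family f n) j y h k" ?c r "average n' (family f n') j y h k"]
    by (simp add: dist_norm)
  then show "\<exists>M. \<forall>n\<ge>M. \<forall>n'\<ge>M. dist (average n (family f n) j y h k) (average n' (family f n') j y h k) < r"
    by blast
qed

text \<open>The operator chosen is unique by \<open>represents_unique\<close>;
  \<open>restrict\<close> makes the map extensional, as membership in \<open>UCP\<close>
  requires.\<close>

definition extension :: "((nat \<Rightarrow> nat) \<Rightarrow> complex) \<Rightarrow> 'k \<Rightarrow>\<^sub>L 'k" where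
  "extension = restrict (\<lambda>f. SOME R. represents R (family f)) (carr A.C)"

lemma extension_represents: "f \<in> carr A.C \<Longrightarrow> represents (extension f) (family f)"
  and extension_vn: "f \<in> carr A.C \<Longrightarrow> extension f \<in> vn"
proof -
  assume f: "f \<in> carr A.C"
  obtain r where r: "0 \<le> r" "\<And>\<omega>. \<omega> \<in> cantor dA \<Longrightarrow> norm (f \<omega>) \<le> r"
    using A.cont_bounded [OF f] by blast
  have "\<exists>R. represents R (family f)"
    by (rule represents_exists [OF family_bounded_ops [OF f] family_bound [OF f r] r(1) family_average_convergent [OF f]])
  then show R: "represents (extension f) (family f)" unfolding extension_def restrict_apply' [OF f] by (rule someI_ex)
  show "extension f \<in> vn"
    by (rule represents_in_vn [OF R family_bounded_ops [OF f] family_bound [OF f r] r(1)])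
qed

lemma extension_eqI: "f \<in> carr A.C \<Longrightarrow> represents R P \<Longrightarrow> (\<And>n x. x \<in> L n \<Longrightarrow> family f n x = P n x) \<Longrightarrow> extension f = R"
  using extension_represents represents_unique represents_cong [of 0 "family f" P] by blast

text \<open>Linearity and the unit hold because both sides represent the same family, sampling and
  the components being linear and unital. Positivity is obtained at each finite level and passes to
  the limit.\<close>

lemma extension_ucp: "is_ucp A.C V extension"
  unfolding is_ucp_def
proof (intro conjI ballI allI)
  show "extension ` carr A.C \<subseteq> carr V" using extension_vn by auto
  show add: "extension (f + f') = extension f + extension f'" if "f \<in> carr A.C" "f' \<in> carr A.C" for f f'
    by (rule extension_eqI [OF csubspace_add [OF csubspace_cont that]
          represents_add [OF extension_represents [OF that(1)] extension_represents [OF that(2)]]])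
      (rule family_add [OF that])
  show scale: "extension (c *\<^sub>C f) = c *\<^sub>C extension f" if "f \<in> carr A.C" for c f
    by (rule extension_eqI [OF csubspace_scaleC [OF csubspace_cont that] represents_scaleC [OF extension_represents [OF that]]])
      (rule family_scaleC [OF that])
  have unit: "ounit A.C \<in> carr A.C"
    using is_ucp_unit [OF A.lift_ucp [of 1]] is_ucp_carr [OF A.lift_ucp [of 1], of "ounit (A.D 1)"]
    by (simp add: diag_carr) (simp add: diag_opsys_def)
  show "extension (ounit A.C) = ounit V"
  proof (rule extension_eqI [OF unit])
    show "represents (ounit V) (\<lambda>_ _. id_blinfun)" using represents_id by simp
    show "family (ounit A.C) n x = id_blinfun" if "x \<in> L n" for n x
      unfolding family_def is_ucp_unit [OF A.sample_ucp] is_ucp_unit [OF component_ucp [OF that]] by simp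
  qed
  fix p X assume X: "X \<in> pos A.C p"
  then have Xc: "X i j \<in> carr A.C" if "i < p" "j < p" for i j
    using that by (auto simp: cont_opsys_def fun_opsys_def mats_def)
  have X0: "X i j = 0" if "p \<le> i \<or> p \<le> j" for i j
    using X that by (auto simp: cont_opsys_def fun_opsys_def mats_def)
  have zero: "extension 0 = 0"
    using scale [OF csubspace_zero [OF csubspace_cont], of 0] by simp
  have mats: "(\<lambda>i j. extension (X i j)) \<in> mats p vn"
    using Xc X0 extension_vn by (auto simp: mats_def zero)
  \<comment> \<open>The quadratic form of the matrix at level \<open>n\<close>; its summands are
    nonnegative because sampling and the components are completely positive.\<close>
  define S where "S n u = (\<Sum>x\<in>L n. of_nat (N n) * mform p (\<lambda>i j. family (X i j) n x) (\<lambda>i. tadj (e x) (u i)) (\<lambda>i. tadj (e x) (u i)))" for n u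
  have S_pos: "Im (S n u) = 0 \<and> 0 \<le> Re (S n u)" for n u
  proof -
    have "(\<lambda>i j. family (X i j) n x) \<in> pos B p" if "x \<in> L n" for x
      unfolding family_def by (rule is_ucp_pos [OF component_ucp [OF that] is_ucp_pos [OF A.sample_ucp X]])
    then show ?thesis by (auto simp: S_def op_pos_iff intro!: sum_nonneg)
  qed
  have S_lim: "(\<lambda>n. S n u) \<longlonglongrightarrow> mform p (\<lambda>i j. extension (X i j)) u u" for u
  proof -
    have "(\<lambda>n. \<Sum>i<p. \<Sum>j<p. form n (family (X i j) n) (u i) (u j)) \<longlonglongrightarrow> mform p (\<lambda>i j. extension (X i j)) u u"
      unfolding mform_def using extension_represents [OF Xc]
      by (intro tendsto_sum) (simp add: represents_def)
    moreover have "(\<Sum>i<p. \<Sum>j<p. form n (family (X i j) n) (u i) (u j)) = S n u" for n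
    proof -
      have "(\<Sum>i<p. \<Sum>j<p. form n (family (X i j) n) (u i) (u j)) =
          (\<Sum>i<p. \<Sum>x\<in>L n. \<Sum>j<p. of_nat (N n) * cinner (tadj (e x) (u i)) (blinfun_apply (family (X i j) n x) (tadj (e x) (u j))))"
        unfolding form_def by (intro sum.cong refl sum.swap)
      also have "\<dots> = (\<Sum>x\<in>L n. \<Sum>i<p. \<Sum>j<p. of_nat (N n) * cinner (tadj (e x) (u i)) (blinfun_apply (family (X i j) n x) (tadj (e x) (u j))))"
        by (rule sum.swap)
      finally show ?thesis by (simp add: S_def mform_def sum_distrib_left)
    qed
    ultimately show ?thesis by simp
  qed
  have "Im (mform p (\<lambda>i j. extension (X i j)) u u) = 0 \<and> 0 \<le> Re (mform p (\<lambda>i j. extension (X i j)) u u)" for u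
  proof
    show "Im (mform p (\<lambda>i j. extension (X i j)) u u) = 0"
      using tendsto_Im [OF S_lim, of u] S_pos by (simp add: LIMSEQ_const_iff)
    show "0 \<le> Re (mform p (\<lambda>i j. extension (X i j)) u u)"
      by (rule LIMSEQ_le_const [OF tendsto_Re [OF S_lim]]) (use S_pos in blast)
  qed
  with mats show "(\<lambda>i j. extension (X i j)) \<in> pos V p" by (simp add: op_pos_iff)
qed

text \<open>For the indicator function of a cylinder of level \<open>n\<close> the family is a
  martingale from level \<open>n\<close> on, so the weak limit is attained there, and
  \<open>N n\<close> cancels the measure of the cylinder of \<open>x\<close>.\<close>

lemma extension_slice:
  assumes x: "x \<in> L n" and a: "a \<in> level A1 dA n"
  shows "\<Gamma> (g n (\<iota> n x (indicator {a}))) = of_nat (N n) *\<^sub>C slice t (e x) (extension (indicator (cylinder dA bA a)))"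
proof (rule bounded_ops_ext)
  fix h k
  have n: "1 \<le> n" by (rule level_ge_1 [OF x])
  let ?f = "A.lift n (indicator {a})"
  have ia: "indicator {a} \<in> carr (A.D n)" by (rule indicator_diag [OF a])
  have f: "?f \<in> carr A.C" by (rule is_ucp_carr [OF A.lift_ucp [OF n] ia])
  have "cinner (t (e x) h) (blinfun_apply (extension ?f) (t (e x) k)) =
      (if trunc n x = x then cinner h (blinfun_apply (family ?f n x) k) / of_nat (N n) else 0)"
    by (rule represents_martingale_value(1) [OF extension_represents [OF f] x x order_refl
          family_bounded_ops [OF f] family_lift_martingale [OF ia n]])
  moreover have "family ?f n x = \<Gamma> (g n (\<iota> n x (indicator {a})))"
    using n by (simp add: family_def component_def A.sample_lift A.refine_self [OF ia])
  moreover have "extension ?f \<in> bounded_ops"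
    using extension_vn [OF f] vn_bounded_ops by blast
  ultimately show "cinner h (blinfun_apply (\<Gamma> (g n (\<iota> n x (indicator {a})))) k) =
      cinner h (blinfun_apply (of_nat (N n) *\<^sub>C slice t (e x) (extension (indicator (cylinder dA bA a)))) k)"
    using N_pos [OF x]
    by (simp add: scaleC_blinfun.rep_eq cinner_scaleC_right cinner_slice trunc_self [OF x] A.lift_indicator [OF a])
qed

end

lemma corresponds_exists_\<Phi>:
  assumes \<Gamma>: "\<Gamma> \<in> UCP SXA B"
  shows "\<exists>\<Phi>\<in>UCP A.C V. corresponds \<Gamma> \<Phi>"
proof -
  have u: "is_ucp SXA B \<Gamma>" using \<Gamma> by (simp add: UCP_def)
  have "extension \<Gamma> \<in> UCP A.C V"
    using extension_ucp [OF u] by (simp add: UCP_def extension_def [OF u])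
  moreover have "corresponds \<Gamma> (extension \<Gamma>)"
    unfolding corresponds_def by (intro allI impI ballI) (rule extension_slice [OF u])
  ultimately show ?thesis by blast
qed

theorem ucp_correspondence:
  "\<exists>F. bij_betw F (UCP SXA B) (UCP A.C V) \<and>
    (\<forall>\<Gamma>\<in>UCP SXA B. \<forall>\<Phi>\<in>UCP A.C V. F \<Gamma> = \<Phi> \<longleftrightarrow> corresponds \<Gamma> \<Phi>)"
  by (rule bij_betw_of_relation [OF corresponds_exists_\<Phi> corresponds_exists_\<Gamma>
        corresponds_unique_\<Phi> corresponds_unique_\<Gamma>])

end

theorem theorem3p4:
  fixes X1 :: "'x set" and dX :: "nat \<Rightarrow> nat" and bX :: "'x \<Rightarrow> nat"
    and A1 :: "'a set" and dA :: "nat \<Rightarrow> nat" and bA :: "'a \<Rightarrow> nat"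
    and S :: "nat \<Rightarrow> 's::complex_vector opsys"
    and \<iota> :: "nat \<Rightarrow> 'x \<times> nat list \<Rightarrow> ('a \<times> nat list \<Rightarrow> complex) \<Rightarrow> 's"
    and \<gamma> :: "nat \<Rightarrow> 's \<Rightarrow> 's"
    and SXA :: "'t::complex_vector opsys"
    and g :: "nat \<Rightarrow> 's \<Rightarrow> 't"
    and q :: "((nat \<Rightarrow> nat) \<Rightarrow> complex) \<Rightarrow> 'l::chilbert_space"
    and t :: "'l \<Rightarrow> 'h::chilbert_space \<Rightarrow> 'k::chilbert_space"
  assumes separable: "separable_space (euclidean :: 'h topology)"
    and X: "inductive_family X1 dX bX"
    and A: "inductive_family A1 dA bA"
    and universe: "large_universe TYPE('v::complex_vector)"
    and coproducts: "\<And>n. n \<ge> 1 \<Longrightarrow>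
          is_coproduct TYPE('v) (level X1 dX n) (level A1 dA n) (S n) (\<iota> n)"
    and \<gamma>_ucp: "\<And>n. n \<ge> 1 \<Longrightarrow> is_ucp (S n) (S (Suc n)) (\<gamma> n)"
    and \<gamma>_generators: "\<And>n x a. \<lbrakk>n \<ge> 1; x \<in> level X1 dX n; a \<in> level A1 dA n\<rbrakk> \<Longrightarrow>
          \<gamma> n (\<iota> n x (indicator {a})) =
            (1 / of_nat (dX n)) *\<^sub>C
              (\<Sum>i=1..dX n. \<Sum>j=1..dA n. \<iota> (Suc n) (append_index x i) (indicator {append_index a j}))"
    and limit: "is_inductive_limit TYPE('v) S \<gamma> SXA g"
    and L2: "is_L2 (cantor_measure dX) q"
    and tensor: "is_hilbert_tensor t"
  shows "\<exists>F. bij_betw F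
            (UCP SXA (op_opsys (bounded_ops :: ('h \<Rightarrow>\<^sub>L 'h) set)))
            (UCP (cont_opsys (cantor dA))
               (op_opsys (vn_tensor t (Linf_ops (cantor_measure dX) q) bounded_ops))) \<and>
          (\<forall>\<Gamma> \<in> UCP SXA (op_opsys bounded_ops).
           \<forall>\<Phi> \<in> UCP (cont_opsys (cantor dA))
                 (op_opsys (vn_tensor t (Linf_ops (cantor_measure dX) q) bounded_ops)).
             F \<Gamma> = \<Phi> \<longleftrightarrow>
             (\<forall>n\<ge>1. \<forall>x\<in>level X1 dX n. \<forall>a\<in>level A1 dA n.
                \<Gamma> (g n (\<iota> n x (indicator {a}))) =
                  of_nat (card (level X1 dX n)) *\<^sub>C
                    slice t (q (indicator (cylinder dX bX x)))
                      (\<Phi> (indicator (cylinder dA bA a)))))"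
proof -
  \<comment> \<open>Separability and the size of the universe enter through this embedding, which
    replaces them from here on.\<close>
  obtain j :: "('h \<Rightarrow>\<^sub>L 'h) \<Rightarrow> 'v" where j: "linear_embedding j"
    using bounded_ops_embedding [OF separable universe] by blast
  interpret correspondence X1 dX bX q t A1 dA bA S \<iota> \<gamma> SXA g j
    by unfold_locales
      (rule X L2 tensor A linear_embedding.inj [OF j] linear_embedding.add [OF j] linear_embedding.scale [OF j]
        coproducts \<gamma>_ucp \<gamma>_generators limit | assumption)+
  show ?thesis
    using ucp_correspondence unfolding corresponds_def e_def .
qed

end
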